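(* Let $\{|\psi_k\rangle\}_{k\sim\mathcal K}$ be an additive $\epsilon$-approximate state $3$-design on $n$ qubits, used as the auxiliary-state distribution in the state-based classical shadow procedure, and let $\rho$ be an $n$-qubit state. Then any positive semidefinite observable $O$ on $n$ qubits satisfies, for a single classical shadow $\hat\rho$, $$\left|\mathbb E[\mathrm{Tr}(O\hat\rho)]-\mathrm{Tr}(O\rho)\right|\le(2^n+1)\epsilon\|O\|_\infty\quad\text{and}\quad\mathrm{Var}[\mathrm{Tr}(O\hat\rho)]\le3\mathrm{Tr}(O_0^2)+3\epsilon\|O\|_\infty^2(2^n+1)^2.$$
   Context: State-based classical shadow procedure: registers $R_1,R_2$ of $n$ qubits; $R_1$ holds $\rho$, $R_2$ holds $|\zeta\rangle=|\psi_k\rangle$ with $k\sim\mathcal K$; apply qubitwise CNOTs ($R_1$ controls, $R_2$ targets), then $H^{\otimes n}$ on $R_1$, then measure $R_1,R_2$ in the computational basis obtaining $z,x\in\{0,1\}^n$. With $|\zeta_{x,z}\rangle=X^xZ^z|\zeta\rangle$ and $|\zeta^*_{x,z}\rangle$ its entrywise complex conjugate, the shadow is $\hat\rho=(2^n+1)|\zeta^*_{x,z}\rangle\langle\zeta^*_{x,z}|-I$. Expectation and variance are over $k$ and the measurement outcomes. $O_0=O-\frac{\mathrm{Tr}(O)}{2^n}I$. With $\mu$ the Haar measure on $n$-qubit pure states, the ensemble is an additive $\epsilon$-approximate state $t$-design if $\left\|\int|\phi\rangle\langle\phi|^{\otimes t}d\mu(\phi)-\mathbb E_{k\leftarrow\mathcal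 K}[|\psi_k\rangle\langle\psi_k|^{\otimes t}]\right\|_1\le\epsilon$ (trace norm). *)

theory Defs
  imports "HOL-Probability.Probability"
begin

text \<open>Matrices and vectors over the complex numbers, represented as functions on
  indices; the dimension D is passed explicitly and only indices below D matter.
  Computational-basis index of an n-qubit register: a natural number below 2^n,
  whose bit i is the value of qubit i.\<close>

type_synonym cvec = "nat \<Rightarrow> complex"
type_synonym cmat = "nat \<Rightarrow> nat \<Rightarrow> complex"

definition mmul :: "nat \<Rightarrow> cmat \<Rightarrow> cmat \<Rightarrow> cmat" where
  "mmul D A B = (\<lambda>i j. \<Sum>l<D. A i l * B l j)"

definition mtrace :: "nat \<Rightarrow> cmat \<Rightarrow> complex" where
  "mtrace D A = (\<Sum>i<D. A i i)"

definition adj :: "cmat \<Rightarrow> cmat" where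
  "adj A = (\<lambda>i j. cnj (A j i))"

definition ident :: cmat where
  "ident = (\<lambda>i j. if i = j then 1 else 0)"

definition outer :: "cvec \<Rightarrow> cvec \<Rightarrow> cmat" where
  "outer v w = (\<lambda>i j. v i * cnj (w j))"

definition mvmul :: "nat \<Rightarrow> cmat \<Rightarrow> cvec \<Rightarrow> cvec" where
  "mvmul D A v = (\<lambda>i. \<Sum>j<D. A i j * v j)"

definition vnorm :: "nat \<Rightarrow> cvec \<Rightarrow> real" where
  "vnorm D v = sqrt (\<Sum>i<D. (cmod (v i))\<^sup>2)"

definition hermitian :: "nat \<Rightarrow> cmat \<Rightarrow> bool" where
  "hermitian D A \<longleftrightarrow> (\<forall>i<D. \<forall>j<D. A i j = cnj (A j i))"

definition psd :: "nat \<Rightarrow> cmat \<Rightarrow> bool" where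
  "psd D A \<longleftrightarrow> hermitian D A \<and>
     (\<forall>v::cvec. 0 \<le> Re (\<Sum>i<D. \<Sum>j<D. cnj (v i) * A i j * v j))"

definition density_op :: "nat \<Rightarrow> cmat \<Rightarrow> bool" where
  "density_op D \<rho> \<longleftrightarrow> psd D \<rho> \<and> mtrace D \<rho> = 1"

definition mat_abs :: "nat \<Rightarrow> cmat \<Rightarrow> cmat" where
  "mat_abs D A = (THE P. psd D P \<and> (\<forall>i j. (D \<le> i \<or> D \<le> j) \<longrightarrow> P i j = 0) \<and>
       (\<forall>i<D. \<forall>j<D. mmul D P P i j = mmul D (adj A) A i j))"

definition trace_norm :: "nat \<Rightarrow> cmat \<Rightarrow> real" where
  "trace_norm D A = Re (mtrace D (mat_abs D A))"

definition op_norm :: "nat \<Rightarrow> cmat \<Rightarrow> real" where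
  "op_norm D A = Sup {vnorm D (mvmul D A v) | v. vnorm D v = 1}"

definition kron :: "nat \<Rightarrow> cmat \<Rightarrow> cmat \<Rightarrow> cmat" where
  "kron D2 A B = (\<lambda>i j. A (i div D2) (j div D2) * B (i mod D2) (j mod D2))"

fun tensor_pow :: "nat \<Rightarrow> nat \<Rightarrow> cmat \<Rightarrow> cmat" where
  "tensor_pow D 0 A = (\<lambda>i j. 1)"
| "tensor_pow D (Suc t) A = kron (D ^ t) A (tensor_pow D t A)"

text \<open>Haar measure on n-qubit pure states (unit vectors of C^D): the normalised
  standard complex Gaussian vector, i.e. the uniform (unitarily invariant)
  distribution on the unit sphere.\<close>
definition std_complex_gauss :: "complex measure" where
  "std_complex_gauss = distr
     (density (lborel \<Otimes>\<^sub>M lborel) (\<lambda>(x, y). ennreal (std_normal_density x * std_normal_density y)))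
     borel (\<lambda>(x, y). Complex x y)"

definition haar_state :: "nat \<Rightarrow> (nat \<Rightarrow> complex) measure" where
  "haar_state D = distr (PiM {..<D} (\<lambda>_. std_complex_gauss)) (PiM {..<D} (\<lambda>_. borel))
     (\<lambda>g. restrict (\<lambda>i. g i / complex_of_real (vnorm D g)) {..<D})"

definition haar_moment :: "nat \<Rightarrow> nat \<Rightarrow> cmat" where
  "haar_moment D t = (\<lambda>i j. \<integral>\<phi>. tensor_pow D t (outer \<phi> \<phi>) i j \<partial>haar_state D)"

definition ens_moment :: "'k measure \<Rightarrow> ('k \<Rightarrow> cvec) \<Rightarrow> nat \<Rightarrow> nat \<Rightarrow> cmat" where
  "ens_moment K \<psi> D t = (\<lambda>i j. \<integral>k. tensor_pow D t (outer (\<psi> k) (\<psi> k)) i j \<partial>K)"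

definition approx_state_design :: "nat \<Rightarrow> 'k measure \<Rightarrow> ('k \<Rightarrow> cvec) \<Rightarrow> nat \<Rightarrow> real \<Rightarrow> bool" where
  "approx_state_design n K \<psi> t \<epsilon> \<longleftrightarrow>
     trace_norm ((2^n)^t) (\<lambda>i j. haar_moment (2^n) t i j - ens_moment K \<psi> (2^n) t i j) \<le> \<epsilon>"

definition bsign :: "nat \<Rightarrow> nat \<Rightarrow> nat \<Rightarrow> complex" where
  "bsign n z a = (-1) ^ card {i. i < n \<and> bit z i \<and> bit a i}"

definition hadamard_n :: "nat \<Rightarrow> cmat" where
  "hadamard_n n = (\<lambda>r c. bsign n r c / complex_of_real (sqrt (2 ^ n)))"

text \<open>Two registers R1,R2; joint basis index a * 2^n + b for |a>_R1 |b>_R2.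
  Qubitwise CNOT with R1 controlling R2: |a,b> -> |a, b xor a>.\<close>
definition cnot_all :: "nat \<Rightarrow> cmat" where
  "cnot_all n = (\<lambda>(r::nat) (c::nat). if r div 2^n = c div 2^n \<and> r mod 2^n = xor (c mod 2^n) (c div 2^n)
                        then 1 else 0)"

definition shadow_unitary :: "nat \<Rightarrow> cmat" where
  "shadow_unitary n = mmul (4^n) (kron (2^n) (hadamard_n n) ident) (cnot_all n)"

definition outcome_prob :: "nat \<Rightarrow> cmat \<Rightarrow> cvec \<Rightarrow> nat \<Rightarrow> nat \<Rightarrow> real" where
  "outcome_prob n \<rho> \<zeta> z x =
     (let U = shadow_unitary n;
          \<sigma> = mmul (4^n) (mmul (4^n) U (kron (2^n) \<rho> (outer \<zeta> \<zeta>))) (adj U)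
      in Re (\<sigma> (z * 2^n + x) (z * 2^n + x)))"

definition pauli_xz :: "nat \<Rightarrow> nat \<Rightarrow> nat \<Rightarrow> cvec \<Rightarrow> cvec" where
  "pauli_xz n x z \<zeta> = (\<lambda>j. bsign n z (xor j x) * \<zeta> (xor j x))"

definition shadow :: "nat \<Rightarrow> cvec \<Rightarrow> nat \<Rightarrow> nat \<Rightarrow> cmat" where
  "shadow n \<zeta> x z =
     (let w = (\<lambda>j. cnj (pauli_xz n x z \<zeta> j))
      in (\<lambda>i j. (2 ^ n + 1) * outer w w i j - ident i j))"

text \<open>The random variable Tr(Ob rho_hat) (real for Hermitian Ob), its mean and variance
  over k ~ K and the measurement outcomes.\<close>
definition shadow_val :: "nat \<Rightarrow> cmat \<Rightarrow> cvec \<Rightarrow> nat \<Rightarrow> nat \<Rightarrow> real" where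
  "shadow_val n Ob \<zeta> x z = Re (mtrace (2^n) (mmul (2^n) Ob (shadow n \<zeta> x z)))"

definition shadow_mean :: "nat \<Rightarrow> 'k measure \<Rightarrow> ('k \<Rightarrow> cvec) \<Rightarrow> cmat \<Rightarrow> cmat \<Rightarrow> real" where
  "shadow_mean n K \<psi> \<rho> Ob =
     (\<integral>k. (\<Sum>z<2^n. \<Sum>x<2^n. outcome_prob n \<rho> (\<psi> k) z x * shadow_val n Ob (\<psi> k) x z) \<partial>K)"

definition shadow_var :: "nat \<Rightarrow> 'k measure \<Rightarrow> ('k \<Rightarrow> cvec) \<Rightarrow> cmat \<Rightarrow> cmat \<Rightarrow> real" where
  "shadow_var n K \<psi> \<rho> Ob =
     (\<integral>k. (\<Sum>z<2^n. \<Sum>x<2^n. outcome_prob n \<rho> (\<psi> k) z x * (shadow_val n Ob (\<psi> k) x z)\<^sup>2) \<partial>K)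
     - (shadow_mean n K \<psi> \<rho> Ob)\<^sup>2"

definition traceless :: "nat \<Rightarrow> cmat \<Rightarrow> cmat" where
  "traceless n Ob = (\<lambda>i j. Ob i j - mtrace (2^n) Ob / 2^n * ident i j)"

end

(* The outcome (z, x) has probability <w|rho|w> / D and value (D + 1) <w|O|w> - tr O, where D = 2^n and
   w is the conjugate of X^x Z^z zeta.  Hence the first two moments of the shadow are linear functionals
   tr (W M) of the third moment M of the ensemble, where W averages P^T rho^T P (x) P^T B^T P (x) P^T C^T P
   over the Pauli strings P.  Twirling rho to the identity shows that W is bounded by b c as a quadratic
   form if B and C are bounded by b and c, so trace-norm duality turns the design error into an error at
   most b c eps.  Taking C = I reduces the mean to the third moment, and replacing O by its traceless part
   changes the value only by a constant, so the variance is at most the second moment of the traceless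
   part.  The exact Haar value is a sum over the six permutations of three tensor factors. *)
theory Submission
  imports Defs "HOL-Computational_Algebra.Fundamental_Theorem_Algebra"
begin

section \<open>Spectral theorem for Hermitian matrices\<close>

text \<open>The hypothesis is given indirectly: \<open>trace_norm\<close> through a definite
  description of the positive square root, the Haar measure through a normalised Gaussian vector.
  Two preparations answer this: a spectral theorem with uniqueness of square roots, which makes
  \<open>trace_norm\<close> the sum of the absolute eigenvalues, and a computation of Gaussian
  moments. The delicate point of the error estimate is the dimension. W has 4^n summands and only
  the prefactor 1 / 2^n, so bounding each summand by its norm would cost a factor 2^n. The
  conjugated rho is therefore kept as an operator until the sum over strings has been taken.
  Positivity of O enters through its traceless part: subtracting the mean from eigenvalues in [0, c]
  leaves them in [-c, c]. The constant 3 in front of tr(O_0^2) is 1 + 2: for traceless B the Haar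
  value is (tr(B^2) + 2 tr(B^2 rho)) / ((D + 1) (D + 2)), and tr(B^2 rho) is at most
  tr(B^2).\<close>

text \<open>Gaussian elimination, by induction on the number of equations. The index set J is
  arbitrary so that a pivot column can be removed from it. This is the dimension argument behind the
  spectral theorem: D + 1 vectors of C^D are dependent, and fewer than D orthogonality conditions
  have a common nonzero solution.\<close>

lemma homogeneous_system_nontrivial_set:
  fixes c :: "nat \<Rightarrow> 'b \<Rightarrow> 'a::field"
  assumes "finite J" "m < card J"
  shows "\<exists>x. (\<exists>j\<in>J. x j \<noteq> 0) \<and> (\<forall>i<m. (\<Sum>j\<in>J. c i j * x j) = 0)"
  using assms
proof (induction m arbitrary: J c)
  case 0
  then have "J \<noteq> {}" by auto
  then show ?case by (intro exI[of _ "\<lambda>_. 1"]) auto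
next
  case (Suc m)
  show ?case
  proof (cases "\<forall>j\<in>J. c m j = 0")
    case True
    obtain x where "\<exists>j\<in>J. x j \<noteq> 0" "\<forall>i<m. (\<Sum>j\<in>J. c i j * x j) = 0"
      using Suc.IH[of J c] Suc.prems by auto
    with True show ?thesis by (intro exI[of _ x]) (auto simp: less_Suc_eq)
  next
    case False
    then obtain p where p: "p \<in> J" "c m p \<noteq> 0" by auto
    define c' where "c' = (\<lambda>i j. c i j - c i p * c m j / c m p)"
    have "m < card (J - {p})" using Suc.prems p by simp
    then obtain x where x: "\<exists>j\<in>J - {p}. x j \<noteq> 0"
        "\<And>i. i < m \<Longrightarrow> (\<Sum>j\<in>J - {p}. c' i j * x j) = 0"
      using Suc.IH[of "J - {p}" c'] Suc.prems by auto
    define S where "S = (\<Sum>j\<in>J - {p}. c m j * x j)"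
    \<comment> \<open>The value at the pivot is forced by equation m; for the other equations,
      substituting it amounts to the eliminated rows \<open>c'\<close>.\<close>
    define y where "y = x(p := - S / c m p)"
    have split: "(\<Sum>j\<in>J. c i j * y j) = c i p * (- S / c m p) + (\<Sum>j\<in>J - {p}. c i j * x j)" for i
    proof -
      have "(\<Sum>j\<in>J. c i j * y j) = c i p * y p + (\<Sum>j\<in>J - {p}. c i j * y j)"
        using p Suc.prems by (simp add: sum.remove)
      also have "(\<Sum>j\<in>J - {p}. c i j * y j) = (\<Sum>j\<in>J - {p}. c i j * x j)"
        by (intro sum.cong) (auto simp: y_def)
      finally show ?thesis by (simp add: y_def)
    qed
    have "(\<Sum>j\<in>J. c i j * y j) = 0" if "i < Suc m" for i
    proof (cases "i = m")
      case True
      then show ?thesis unfolding split using p by (simp add: S_def)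
    next
      case False
      with that have "(\<Sum>j\<in>J - {p}. c' i j * x j) = 0" using x by simp
      also have "(\<Sum>j\<in>J - {p}. c' i j * x j) = (\<Sum>j\<in>J - {p}. c i j * x j) - c i p / c m p * S"
        by (simp add: c'_def S_def sum_distrib_left sum_subtractf algebra_simps)
      finally show ?thesis unfolding split by (simp add: algebra_simps)
    qed
    moreover have "\<exists>j\<in>J. y j \<noteq> 0" using x(1) by (auto simp: y_def)
    ultimately show ?thesis by blast
  qed
qed

definition cinner :: "nat \<Rightarrow> cvec \<Rightarrow> cvec \<Rightarrow> complex" where
  "cinner D v w = (\<Sum>i<D. cnj (v i) * w i)"

definition qform :: "nat \<Rightarrow> cmat \<Rightarrow> cvec \<Rightarrow> complex" where
  "qform D A v = (\<Sum>i<D. \<Sum>j<D. cnj (v i) * A i j * v j)"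

definition sqnorm :: "nat \<Rightarrow> cvec \<Rightarrow> real" where
  "sqnorm D v = (\<Sum>i<D. (cmod (v i))\<^sup>2)"

lemma sqnorm_nonneg [simp]: "0 \<le> sqnorm D v"
  by (simp add: sqnorm_def sum_nonneg)

lemma sqnorm_eq_0_iff: "sqnorm D v = 0 \<longleftrightarrow> (\<forall>i<D. v i = 0)"
  by (auto simp: sqnorm_def sum_nonneg_eq_0_iff)

lemma cinner_self: "cinner D v v = of_real (sqnorm D v)"
  unfolding cinner_def sqnorm_def of_real_sum
  by (intro sum.cong refl) (simp add: complex_mult_cnj cmod_def algebra_simps flip: complex_norm_square)

lemma cnj_cinner: "cnj (cinner D v w) = cinner D w v"
  by (simp add: cinner_def mult.commute)

lemma cinner_sum_right: "cinner D v (\<lambda>i. \<Sum>k\<in>K. a k * f k i) = (\<Sum>k\<in>K. a k * cinner D v (f k))"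
  unfolding cinner_def sum_distrib_left
  by (subst sum.swap, intro sum.cong refl) (simp only: mult.left_commute)

lemma cinner_hermitian_mvmul:
  assumes "hermitian D A"
  shows "cinner D v (mvmul D A w) = cinner D (mvmul D A v) w"
proof -
  have "cinner D v (mvmul D A w) = (\<Sum>i<D. \<Sum>j<D. cnj (v i) * A i j * w j)"
    by (simp add: cinner_def mvmul_def sum_distrib_left mult.assoc)
  also have "\<dots> = (\<Sum>i<D. \<Sum>j<D. cnj (A j i) * cnj (v i) * w j)"
  proof (intro sum.cong refl)
    fix i j assume "i \<in> {..<D}" "j \<in> {..<D}"
    with assms have "A i j = cnj (A j i)" unfolding hermitian_def by blast
    then show "cnj (v i) * A i j * w j = cnj (A j i) * cnj (v i) * w j" by (metis mult.commute)
  qed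
  also have "\<dots> = cinner D (mvmul D A v) w"
    unfolding cinner_def mvmul_def cnj_sum sum_distrib_right by (subst sum.swap) simp
  finally show ?thesis .
qed

text \<open>A polynomial of minimal degree annihilating \<open>v\<close> has a root; dividing by the
  corresponding linear factor leaves an eigenvector in the cyclic subspace of \<open>v\<close>.\<close>

lemma eigenvector_in_cyclic_subspace:
  assumes v: "\<exists>i<D. v i \<noteq> 0"
  obtains q \<mu> where
    "\<exists>i<D. (\<Sum>k\<le>degree q. coeff q k * ((mvmul D A) ^^ k) v i) \<noteq> 0"
    "\<And>i. i < D \<Longrightarrow> mvmul D A (\<lambda>i. \<Sum>k\<le>degree q. coeff q k * ((mvmul D A) ^^ k) v i) i
        = \<mu> * (\<Sum>k\<le>degree q. coeff q k * ((mvmul D A) ^^ k) v i)"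
proof -
  define w where "w k = ((mvmul D A) ^^ k) v" for k
  define pv where "pv p i = (\<Sum>k\<le>degree p. coeff p k * w k i)" for p :: "complex poly" and i
  have pv_le: "pv p i = (\<Sum>k\<le>n. coeff p k * w k i)" if "degree p \<le> n" for p i n
    unfolding pv_def using that by (intro sum.mono_neutral_left) (auto simp: coeff_eq_0)
  \<comment> \<open>The D + 1 vectors v, A v, ..., A^D v are dependent, which yields a nonzero
    polynomial annihilating v.\<close>
  obtain x where x: "\<exists>k\<in>{..D}. x k \<noteq> 0" "\<forall>i<D. (\<Sum>k\<in>{..D}. w k i * x k) = 0"
    using homogeneous_system_nontrivial_set[of "{..D}" D "\<lambda>i k. w k i"] by auto
  define p0 where "p0 = (\<Sum>k\<le>D. monom (x k) k)"
  have c0: "coeff p0 k = (if k \<le> D then x k else 0)" for k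
    by (simp add: p0_def coeff_sum)
  have "degree p0 \<le> D" by (rule degree_le) (simp add: c0)
  then have "\<forall>i<D. pv p0 i = 0" using x(2) by (simp add: pv_le c0 mult.commute)
  moreover have "p0 \<noteq> 0" using x(1) c0 by (metis atMost_iff coeff_0)
  ultimately have "\<exists>p. (p \<noteq> 0 \<and> (\<forall>i<D. pv p i = 0)) \<and>
      (\<forall>q. q \<noteq> 0 \<and> (\<forall>i<D. pv q i = 0) \<longrightarrow> degree p \<le> degree q)"
    by (intro ex_has_least_nat[of "\<lambda>p. p \<noteq> 0 \<and> (\<forall>i<D. pv p i = 0)" p0 degree]) simp
  then obtain p where p: "p \<noteq> 0" "\<forall>i<D. pv p i = 0"
    and minp: "\<And>q. q \<noteq> 0 \<Longrightarrow> (\<forall>i<D. pv q i = 0) \<Longrightarrow> degree p \<le> degree q"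
    by blast
  have "degree p \<noteq> 0"
  proof
    assume d: "degree p = 0"
    then have "coeff p 0 \<noteq> 0" using p(1) by (metis leading_coeff_0_iff)
    with d p(2) v show False by (auto simp: pv_def w_def)
  qed
  then have "\<not> constant (poly p)" by (simp add: constant_degree)
  then obtain \<mu> where "poly p \<mu> = 0" using fundamental_theorem_of_algebra by blast
  then obtain q where q: "p = [:- \<mu>, 1:] * q" by (auto simp: poly_eq_0_iff_dvd elim: dvdE)
  have q0: "q \<noteq> 0" using p(1) q by auto
  have dq: "degree p = Suc (degree q)" unfolding q using q0
    by (simp add: degree_mult_eq del: mult_pCons_left)
  \<comment> \<open>The degree of q lies below the minimal one, so q(A) v cannot vanish.\<close>
  have nz: "\<exists>i<D. pv q i \<noteq> 0" using minp[OF q0] dq by auto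
  have eig: "mvmul D A (pv q) i = \<mu> * pv q i" if "i < D" for i
  proof -
    have pq: "p = pCons 0 q - smult \<mu> q" by (simp add: q)
    have "0 = pv p i" using p(2) that by simp
    also have "\<dots> = (\<Sum>k\<le>Suc (degree q). coeff p k * w k i)" by (rule pv_le) (simp add: dq)
    also have "\<dots> = (\<Sum>k\<le>Suc (degree q). coeff (pCons 0 q) k * w k i)
        - \<mu> * (\<Sum>k\<le>Suc (degree q). coeff q k * w k i)"
      unfolding pq sum_distrib_left sum_subtractf[symmetric]
      by (intro sum.cong refl) (simp add: algebra_simps)
    also have "(\<Sum>k\<le>Suc (degree q). coeff q k * w k i) = pv q i"
      by (subst pv_le[of q "Suc (degree q)"]) auto
    also have "(\<Sum>k\<le>Suc (degree q). coeff (pCons 0 q) k * w k i)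
        = (\<Sum>k\<le>degree q. coeff q k * w (Suc k) i)"
      by (subst sum.atMost_Suc_shift) simp
    also have "\<dots> = mvmul D A (pv q) i"
      unfolding pv_def mvmul_def w_def funpow.simps comp_apply sum_distrib_left
      by (subst sum.swap) (simp add: mult_ac)
    finally show ?thesis by simp
  qed
  show thesis
    by (rule that[of q \<mu>]) (use nz eig in \<open>auto simp: pv_def[abs_def] w_def\<close>)
qed

text \<open>The orthogonal complement of the eigenvectors found so far is invariant under A, so the
  whole cyclic subspace of a vector in it stays in it. This is why the eigenvector is looked for in
  a cyclic subspace: A need not be restricted to the complement.\<close>

lemma eigenvector_orthogonal_extension:
  assumes A: "hermitian D A" and "m < D"
    and eig: "\<And>k i. k < m \<Longrightarrow> i < D \<Longrightarrow> mvmul D A (e k) i = of_real (l k) * e k i"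
  obtains u \<mu> where "cinner D u u = 1" "\<And>k. k < m \<Longrightarrow> cinner D (e k) u = 0"
    "\<And>i. i < D \<Longrightarrow> mvmul D A u i = of_real \<mu> * u i"
proof -
  obtain v where v: "\<exists>j<D. v j \<noteq> 0" "\<forall>k<m. cinner D (e k) v = 0"
    using homogeneous_system_nontrivial_set[of "{..<D}" m "\<lambda>k j. cnj (e k j)"] \<open>m < D\<close>
    by (auto simp: cinner_def)
  obtain q \<mu> where nz: "\<exists>i<D. (\<Sum>k\<le>degree q. coeff q k * ((mvmul D A) ^^ k) v i) \<noteq> 0"
    and eigq: "\<And>i. i < D \<Longrightarrow> mvmul D A (\<lambda>i. \<Sum>k\<le>degree q. coeff q k * ((mvmul D A) ^^ k) v i) i
        = \<mu> * (\<Sum>k\<le>degree q. coeff q k * ((mvmul D A) ^^ k) v i)"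
    using eigenvector_in_cyclic_subspace[OF v(1), of A] by blast
  define y where "y i = (\<Sum>k\<le>degree q. coeff q k * ((mvmul D A) ^^ k) v i)" for i
  have yeig: "mvmul D A y i = \<mu> * y i" if "i < D" for i
    using eigq[OF that] by (simp add: y_def[abs_def])
  have pow: "cinner D (e k) (((mvmul D A) ^^ r) v) = 0" if "k < m" for k r
  proof (induction r)
    case 0 then show ?case using v(2) that by simp
  next
    case (Suc r)
    have "cinner D (e k) (mvmul D A (((mvmul D A) ^^ r) v))
        = cinner D (mvmul D A (e k)) (((mvmul D A) ^^ r) v)"
      by (rule cinner_hermitian_mvmul[OF A])
    also have "\<dots> = of_real (l k) * cinner D (e k) (((mvmul D A) ^^ r) v)"
      using eig[OF that] by (simp add: cinner_def sum_distrib_left mult_ac)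
    finally show ?case using Suc by simp
  qed
  have orth: "cinner D (e k) y = 0" if "k < m" for k
    unfolding y_def cinner_sum_right using pow[OF that] by simp
  have sy: "sqnorm D y > 0"
    using nz sqnorm_nonneg[of D y] sqnorm_eq_0_iff[of D y] by (auto simp: y_def less_le)
  have "\<mu> * cinner D y y = cinner D y (mvmul D A y)"
    using yeig by (simp add: cinner_def sum_distrib_left mult_ac)
  also have "\<dots> = cinner D (mvmul D A y) y" by (rule cinner_hermitian_mvmul[OF A])
  also have "\<dots> = cnj \<mu> * cinner D y y"
    using yeig by (simp add: cinner_def sum_distrib_left mult_ac)
  finally have "\<mu> = cnj \<mu>" using sy by (simp add: cinner_self)
  then have \<mu>: "\<mu> = of_real (Re \<mu>)" by (simp add: complex_eq_iff)
  define r where "r = complex_of_real (1 / sqrt (sqnorm D y))"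
  have "cinner D (\<lambda>i. r * y i) (\<lambda>i. r * y i) = cnj r * r * cinner D y y"
    by (simp add: cinner_def sum_distrib_left mult_ac)
  also have "\<dots> = 1"
    unfolding cinner_self r_def using sy
    by (simp flip: of_real_mult of_real_divide add: real_sqrt_mult_self)
  finally have 1: "cinner D (\<lambda>i. r * y i) (\<lambda>i. r * y i) = 1" .
  show thesis
  proof (rule that[of "\<lambda>i. r * y i" "Re \<mu>"])
    show "cinner D (e k) (\<lambda>i. r * y i) = 0" if "k < m" for k
      using orth[OF that] by (simp add: cinner_def mult.left_commute flip: sum_distrib_left)
    show "mvmul D A (\<lambda>i. r * y i) i = of_real (Re \<mu>) * (r * y i)" if "i < D" for i
    proof -
      have "mvmul D A (\<lambda>i. r * y i) i = r * mvmul D A y i"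
        by (simp add: mvmul_def sum_distrib_left mult_ac)
      then show ?thesis using yeig[OF that] \<mu> by simp
    qed
  qed (rule 1)
qed

text \<open>The middle clause, the resolution of the identity, makes \<open>ident\<close> diagonal
  in the same basis. Parseval and the Kronecker products with \<open>ident\<close> rest on
  this.\<close>

definition spectral :: "nat \<Rightarrow> cmat \<Rightarrow> (nat \<Rightarrow> cvec) \<Rightarrow> (nat \<Rightarrow> real) \<Rightarrow> bool" where
  "spectral D A e l \<longleftrightarrow>
     (\<forall>k<D. \<forall>m<D. cinner D (e k) (e m) = (if k = m then 1 else 0)) \<and>
     (\<forall>i<D. \<forall>j<D. (\<Sum>k<D. e k i * cnj (e k j)) = (if i = j then 1 else 0)) \<and>
     (\<forall>i<D. \<forall>j<D. A i j = (\<Sum>k<D. of_real (l k) * e k i * cnj (e k j)))"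

text \<open>\<open>v\<close> is what remains of the j-th basis vector after projecting onto the
  \<open>e k\<close>. The D + 1 vectors e_0, ..., e_(D-1), v are dependent; pairing the relation
  with each e_m leaves only the coefficient of v, and pairing it with v then gives v = 0, whose
  entries are the claim.\<close>

lemma orthonormal_complete:
  assumes on: "\<And>k m. k < D \<Longrightarrow> m < D \<Longrightarrow> cinner D (e k) (e m) = (if k = m then 1 else 0)"
    and "i < D" "j < D"
  shows "(\<Sum>k<D. e k i * cnj (e k j)) = (if i = j then 1 else 0)"
proof -
  define v where "v i = (if i = j then 1 else 0) - (\<Sum>k<D. cnj (e k j) * e k i)" for i
  have orth: "cinner D (e m) v = 0" if "m < D" for m
  proof -
    have "cinner D (e m) v = cinner D (e m) (\<lambda>i. if i = j then 1 else 0)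
        - cinner D (e m) (\<lambda>i. \<Sum>k<D. cnj (e k j) * e k i)"
      by (simp add: cinner_def v_def algebra_simps sum_subtractf)
    also have "cinner D (e m) (\<lambda>i. if i = j then 1 else 0) = cnj (e m j)"
      unfolding cinner_def using \<open>j < D\<close> by (simp add: if_distrib cong: if_cong)
    also have "cinner D (e m) (\<lambda>i. \<Sum>k<D. cnj (e k j) * e k i) = cnj (e m j)"
      unfolding cinner_sum_right using that by (simp add: on if_distrib cong: if_cong)
    finally show ?thesis by simp
  qed
  define f where "f k = (if k < D then e k else v)" for k
  obtain x where x: "\<exists>k\<in>{..D}. x k \<noteq> 0" "\<forall>i<D. (\<Sum>k\<in>{..D}. f k i * x k) = 0"
    using homogeneous_system_nontrivial_set[of "{..D}" D "\<lambda>i k. f k i"] by auto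
  have comb: "(\<Sum>k\<le>D. x k * cinner D u (f k)) = 0" for u
  proof -
    have "(\<Sum>k\<le>D. x k * cinner D u (f k)) = cinner D u (\<lambda>i. \<Sum>k\<le>D. x k * f k i)"
      by (rule cinner_sum_right[symmetric])
    also have "\<dots> = 0" unfolding cinner_def using x(2) by (simp add: mult.commute)
    finally show ?thesis .
  qed
  have xk: "x m = 0" if "m < D" for m
  proof -
    have "0 = (\<Sum>k\<le>D. x k * cinner D (e m) (f k))" using comb by simp
    also have "\<dots> = (\<Sum>k\<le>D. if k = m then x k else 0)"
      using that orth by (intro sum.cong) (auto simp: f_def on)
    also have "\<dots> = x m" using that by simp
    finally show ?thesis by simp
  qed
  then have xD: "x D \<noteq> 0" using x(1) by (metis atMost_iff le_neq_implies_less)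
  have "0 = (\<Sum>k\<le>D. x k * cinner D v (f k))" using comb by simp
  also have "\<dots> = (\<Sum>k\<le>D. if k = D then x k * cinner D v v else 0)"
    using xk by (intro sum.cong) (auto simp: f_def)
  also have "\<dots> = x D * cinner D v v" by simp
  finally have "sqnorm D v = 0" using xD by (simp add: cinner_self)
  then have "v i = 0" using \<open>i < D\<close> by (simp add: sqnorm_eq_0_iff)
  then show ?thesis by (simp add: v_def mult.commute split: if_splits)
qed

text \<open>The induction is on the number m of orthonormal eigenvectors already found, up to D.
  Completeness of the resulting basis then turns the eigenvalue equations into the expansion of
  A.\<close>

theorem hermitian_spectral:
  assumes A: "hermitian D A"
  obtains e l where "spectral D A e l"
proof -
  have "\<exists>e l. (\<forall>k<m. \<forall>r<m. cinner D (e k) (e r) = (if k = r then 1 else 0)) \<and>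
      (\<forall>k<m. \<forall>i<D. mvmul D A (e k) i = of_real (l k) * e k i)" if "m \<le> D" for m
    using that
  proof (induction m)
    case 0 then show ?case by simp
  next
    case (Suc m)
    then obtain e l where on: "\<forall>k<m. \<forall>r<m. cinner D (e k) (e r) = (if k = r then 1 else 0)"
      and eig: "\<forall>k<m. \<forall>i<D. mvmul D A (e k) i = complex_of_real (l k) * e k i" by auto
    have "m < D" using Suc.prems by simp
    obtain u \<mu> where u: "cinner D u u = 1" "\<And>k. k < m \<Longrightarrow> cinner D (e k) u = 0"
      "\<And>i. i < D \<Longrightarrow> mvmul D A u i = of_real \<mu> * u i"
      using eigenvector_orthogonal_extension[OF A \<open>m < D\<close>, of e l] eig by blast
    have u': "cinner D u (e k) = 0" if "k < m" for k
      using u(2)[OF that] cnj_cinner[of D "e k" u] by simp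
    show ?case
      by (rule exI[of _ "e(m := u)"], rule exI[of _ "l(m := \<mu>)"])
        (use on eig u u' in \<open>auto simp: less_Suc_eq\<close>)
  qed
  from this[of D] obtain e l
    where on': "\<forall>k<D. \<forall>r<D. cinner D (e k) (e r) = (if k = r then 1 else 0)"
      and eig': "\<forall>k<D. \<forall>i<D. mvmul D A (e k) i = complex_of_real (l k) * e k i"
    by blast
  have on: "cinner D (e k) (e r) = (if k = r then 1 else 0)" if "k < D" "r < D" for k r
    using on' that by blast
  have eig: "mvmul D A (e k) i = complex_of_real (l k) * e k i" if "k < D" "i < D" for k i
    using eig' that by blast
  have compl: "(\<Sum>k<D. e k i * cnj (e k j)) = (if i = j then 1 else 0)" if "i < D" "j < D" for i j
    using orthonormal_complete[OF on that] .
  have "A i j = (\<Sum>k<D. of_real (l k) * e k i * cnj (e k j))" if "i < D" "j < D" for i j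
  proof -
    have "A i j = (\<Sum>r<D. A i r * (if r = j then 1 else 0))"
      using that by (simp add: if_distrib cong: if_cong)
    also have "\<dots> = (\<Sum>r<D. \<Sum>k<D. A i r * (e k r * cnj (e k j)))"
      using that compl unfolding sum_distrib_left[symmetric] by (intro sum.cong refl) simp
    also have "\<dots> = (\<Sum>k<D. mvmul D A (e k) i * cnj (e k j))"
      unfolding mvmul_def sum_distrib_right by (subst sum.swap) (simp add: mult_ac)
    also have "\<dots> = (\<Sum>k<D. of_real (l k) * e k i * cnj (e k j))"
      using eig that by simp
    finally show ?thesis .
  qed
  then show thesis using on compl by (intro that[of e l]) (simp add: spectral_def)
qed

section \<open>Trace norm and Kronecker products\<close>

lemma qform_cong:
  "(\<And>i j. i < D \<Longrightarrow> j < D \<Longrightarrow> A i j = B i j) \<Longrightarrow> qform D A v = qform D B v"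
  by (simp add: qform_def)

lemma qform_spectral_sum:
  assumes "\<And>i j. i < D \<Longrightarrow> j < D \<Longrightarrow> A i j = (\<Sum>k<N. of_real (l k) * e k i * cnj (e k j))"
  shows "qform D A v = of_real (\<Sum>k<N. l k * (cmod (cinner D (e k) v))\<^sup>2)"
proof -
  have "qform D A v = (\<Sum>i<D. \<Sum>j<D. \<Sum>k<N. of_real (l k) * ((cnj (v i) * e k i) * (cnj (e k j) * v j)))"
    unfolding qform_def
    by (intro sum.cong refl) (simp add: assms sum_distrib_left sum_distrib_right mult_ac)
  also have "\<dots> = (\<Sum>i<D. \<Sum>k<N. \<Sum>j<D. of_real (l k) * ((cnj (v i) * e k i) * (cnj (e k j) * v j)))"
    by (intro sum.cong refl sum.swap)
  also have "\<dots> = (\<Sum>k<N. \<Sum>i<D. \<Sum>j<D. of_real (l k) * ((cnj (v i) * e k i) * (cnj (e k j) * v j)))"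
    by (rule sum.swap)
  also have "\<dots> = (\<Sum>k<N. of_real (l k) * (cinner D v (e k) * cinner D (e k) v))"
    by (simp only: cinner_def sum_product flip: sum_distrib_left)
  also have "\<dots> = (\<Sum>k<N. of_real (l k) * of_real ((cmod (cinner D (e k) v))\<^sup>2))"
  proof (intro sum.cong refl)
    fix k
    have "cinner D v (e k) * cinner D (e k) v = of_real ((cmod (cinner D (e k) v))\<^sup>2)"
      by (metis cnj_cinner complex_norm_square mult.commute)
    then show "of_real (l k) * (cinner D v (e k) * cinner D (e k) v)
        = of_real (l k) * of_real ((cmod (cinner D (e k) v))\<^sup>2)" by simp
  qed
  finally show ?thesis by (simp only: of_real_mult of_real_sum)
qed

lemma spectral_decomp:
  "spectral D A e l \<Longrightarrow> i < D \<Longrightarrow> j < D \<Longrightarrow> A i j = (\<Sum>k<D. of_real (l k) * e k i * cnj (e k j))"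
  unfolding spectral_def by blast

lemma spectral_orthonormal:
  "spectral D A e l \<Longrightarrow> k < D \<Longrightarrow> m < D \<Longrightarrow> cinner D (e k) (e m) = (if k = m then 1 else 0)"
  unfolding spectral_def by blast

lemma spectral_complete:
  "spectral D A e l \<Longrightarrow> i < D \<Longrightarrow> j < D \<Longrightarrow> (\<Sum>k<D. e k i * cnj (e k j)) = (if i = j then 1 else 0)"
  unfolding spectral_def by blast

lemma spectral_qform:
  assumes "spectral D A e l"
  shows "qform D A v = of_real (\<Sum>k<D. l k * (cmod (cinner D (e k) v))\<^sup>2)"
  by (rule qform_spectral_sum) (rule spectral_decomp[OF assms])

lemma qform_ident: "qform D ident v = of_real (sqnorm D v)"
proof -
  have "(\<Sum>j<D. cnj (v i) * ident i j * v j) = (\<Sum>j<D. if i = j then cnj (v i) * v j else 0)" for i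
    by (intro sum.cong) (auto simp: ident_def)
  then show ?thesis by (simp add: qform_def cinner_def flip: cinner_self)
qed

lemma spectral_ident: "spectral D A e l \<Longrightarrow> spectral D ident e (\<lambda>_. 1)"
  unfolding spectral_def ident_def by auto

lemma spectral_parseval:
  assumes "spectral D A e l"
  shows "(\<Sum>k<D. (cmod (cinner D (e k) v))\<^sup>2) = sqnorm D v"
  using spectral_qform[OF spectral_ident[OF assms], of v]
  by (simp only: qform_ident of_real_eq_iff mult_1)

lemma spectral_eigenvalue:
  assumes "spectral D A e l" "k < D"
  shows "qform D A (e k) = of_real (l k)"
proof -
  have "(\<Sum>m<D. l m * (cmod (cinner D (e m) (e k)))\<^sup>2) = (\<Sum>m<D. if m = k then l m else 0)"
    using assms by (intro sum.cong) (auto simp: spectral_orthonormal)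
  then show ?thesis using assms by (simp add: spectral_qform[OF assms(1)])
qed

lemma spectral_unit: "spectral D A e l \<Longrightarrow> k < D \<Longrightarrow> sqnorm D (e k) = 1"
  using spectral_orthonormal[of D A e l k k] by (simp add: cinner_self)

lemma hermitian_qform_real:
  assumes "hermitian D A"
  shows "qform D A v = of_real (Re (qform D A v))"
proof -
  obtain e l where "spectral D A e l" using hermitian_spectral[OF assms] .
  from spectral_qform[OF this] show ?thesis by simp
qed

lemma psd_qform: "psd D A \<longleftrightarrow> hermitian D A \<and> (\<forall>v. 0 \<le> Re (qform D A v))"
  by (simp add: psd_def qform_def)

section \<open>Positive square roots and the trace norm\<close>

text \<open>In the eigenbasis the quadratic form is a sum of nonnegative terms, so each of them
  vanishes, and with them the coefficients of P v.\<close>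

lemma psd_kernel:
  assumes "psd D P" "Re (qform D P v) = 0" "i < D"
  shows "mvmul D P v i = 0"
proof -
  obtain e l where s: "spectral D P e l" 
    using assms(1) hermitian_spectral[of D P] unfolding psd_def by blast
  have l: "l k \<ge> 0" if "k < D" for k
    using assms(1) spectral_eigenvalue[OF s that] by (metis psd_qform Re_complex_of_real)
  have "(\<Sum>k<D. l k * (cmod (cinner D (e k) v))\<^sup>2) = 0"
    using assms(2) spectral_qform[OF s, of v] by simp
  then have z: "l k * (cmod (cinner D (e k) v))\<^sup>2 = 0" if "k < D" for k
    using l that by (subst (asm) sum_nonneg_eq_0_iff) auto
  have "mvmul D P v i = (\<Sum>j<D. \<Sum>k<D. of_real (l k) * e k i * (cnj (e k j) * v j))"
    unfolding mvmul_def using \<open>i < D\<close>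
    by (intro sum.cong refl) (simp add: spectral_decomp[OF s] sum_distrib_right sum_distrib_left mult_ac)
  also have "\<dots> = (\<Sum>k<D. of_real (l k) * e k i * cinner D (e k) v)"
    unfolding cinner_def sum_distrib_left by (rule sum.swap)
  also have "\<dots> = 0" using z by (intro sum.neutral) auto
  finally show ?thesis .
qed

text \<open>For \<open>E = P - Q\<close> one has \<open>P E + E Q = 0\<close>, so the nonnegative numbers \<open>tr (E P E)\<close> and
  \<open>tr (E Q E)\<close> add up to zero; hence \<open>P E = Q E = 0\<close> and \<open>E\<^sup>2 = 0\<close>.\<close>

lemma psd_sqrt_unique:
  assumes P: "psd D P" and Q: "psd D Q"
    and eq: "\<And>i j. i < D \<Longrightarrow> j < D \<Longrightarrow> mmul D P P i j = mmul D Q Q i j"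
    and "i < D" "j < D"
  shows "P i j = Q i j"
proof -
  define E where "E i j = P i j - Q i j" for i j
  have herm: "cnj (E i j) = E j i" if "i < D" "j < D" for i j
  proof -
    have "P j i = cnj (P i j)" "Q j i = cnj (Q i j)"
      using P Q that unfolding psd_def hermitian_def by blast+
    then show ?thesis by (simp add: E_def)
  qed
  have PE: "mmul D P E a b + mmul D E Q a b = 0" if "a < D" "b < D" for a b
    using eq[OF that] by (simp add: mmul_def E_def algebra_simps sum_subtractf flip: sum.distrib)
  \<comment> \<open>The columns of E serve as test vectors, so that the sums of quadratic forms
    become the traces of E P E and E Q E.\<close>
  have tP: "(\<Sum>j<D. qform D P (\<lambda>i. E i j)) = (\<Sum>j<D. \<Sum>a<D. E j a * mmul D P E a j)"
    unfolding qform_def mmul_def sum_distrib_left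
    by (intro sum.cong refl) (simp add: herm mult.assoc)
  have "(\<Sum>j<D. qform D Q (\<lambda>i. E i j)) = (\<Sum>j<D. \<Sum>a<D. \<Sum>b<D. E j a * Q a b * E b j)"
    unfolding qform_def by (intro sum.cong refl) (simp add: herm)
  also have "\<dots> = (\<Sum>j<D. \<Sum>b<D. \<Sum>a<D. E j a * Q a b * E b j)"
    by (intro sum.cong refl sum.swap)
  also have "\<dots> = (\<Sum>b<D. \<Sum>j<D. \<Sum>a<D. E j a * Q a b * E b j)" by (rule sum.swap)
  also have "\<dots> = (\<Sum>b<D. \<Sum>j<D. E b j * mmul D E Q j b)"
    unfolding mmul_def sum_distrib_left by (intro sum.cong refl) (simp add: mult_ac)
  finally have tQ: "(\<Sum>j<D. qform D Q (\<lambda>i. E i j)) = (\<Sum>j<D. \<Sum>a<D. E j a * mmul D E Q a j)" .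
  have "(\<Sum>j<D. qform D P (\<lambda>i. E i j)) + (\<Sum>j<D. qform D Q (\<lambda>i. E i j)) = 0"
    unfolding tP tQ sum.distrib[symmetric] distrib_left[symmetric]
    by (intro sum.neutral ballI) (simp add: PE)
  from arg_cong[OF this, of Re]
  have "(\<Sum>j<D. Re (qform D P (\<lambda>i. E i j)) + Re (qform D Q (\<lambda>i. E i j))) = 0"
    by (simp add: sum.distrib)
  moreover have nn: "Re (qform D P v) \<ge> 0" "Re (qform D Q v) \<ge> 0" for v
    using P Q by (auto simp: psd_qform)
  ultimately have "Re (qform D P (\<lambda>i. E i j)) + Re (qform D Q (\<lambda>i. E i j)) = 0" if "j < D" for j
    using that by (subst (asm) sum_nonneg_eq_0_iff) auto
  then have "Re (qform D P (\<lambda>i. E i j)) = 0 \<and> Re (qform D Q (\<lambda>i. E i j)) = 0" if "j < D" for j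
    using nn(1)[of "\<lambda>i. E i j"] nn(2)[of "\<lambda>i. E i j"] that by (metis add_nonneg_eq_0_iff)
  then have PQ0: "mvmul D P (\<lambda>i. E i j) i = 0" "mvmul D Q (\<lambda>i. E i j) i = 0" if "i < D" "j < D" for i j
    using psd_kernel P Q that by blast+
  then have E2: "(\<Sum>k<D. E i k * E k j) = 0" if "i < D" "j < D" for i j
  proof -
    have "(\<Sum>k<D. E i k * E k j) = mvmul D P (\<lambda>i. E i j) i - mvmul D Q (\<lambda>i. E i j) i"
      unfolding mvmul_def E_def sum_subtractf[symmetric] left_diff_distrib[symmetric] by simp
    with \<open>i < D\<close> \<open>j < D\<close> PQ0 show ?thesis by simp
  qed
  have "cinner D (\<lambda>k. E k j) (\<lambda>k. E k j) = 0"
    using E2[OF \<open>j < D\<close> \<open>j < D\<close>] \<open>j < D\<close> by (simp add: cinner_def herm)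
  then have "E i j = 0" using \<open>i < D\<close> by (simp add: cinner_self sqnorm_eq_0_iff)
  then show ?thesis by (simp add: E_def)
qed

lemma spectral_psd:
  assumes "spectral D A e l" "\<And>k. k < D \<Longrightarrow> l k \<ge> 0"
  shows "psd D A"
  unfolding psd_qform
proof
  show "hermitian D A"
    unfolding hermitian_def using spectral_decomp[OF assms(1)] by (simp add: mult_ac)
  show "\<forall>v. 0 \<le> Re (qform D A v)"
    unfolding spectral_qform[OF assms(1)] Re_complex_of_real
    using assms(2) by (intro allI sum_nonneg mult_nonneg_nonneg) auto
qed

lemma spectral_mmul_adj:
  assumes A: "spectral D A e l" and B: "spectral D B e m" and "i < D" "j < D"
  shows "mmul D (adj A) B i j = (\<Sum>k<D. of_real (l k * m k) * e k i * cnj (e k j))"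
proof -
  have "mmul D (adj A) B i j = (\<Sum>r<D. \<Sum>k<D. \<Sum>s<D.
      of_real (l k) * of_real (m s) * e k i * cnj (e s j) * (cnj (e k r) * e s r))"
    unfolding mmul_def adj_def using assms(3,4)
    by (intro sum.cong refl) (simp add: spectral_decomp[OF A] spectral_decomp[OF B] sum_product mult_ac)
  also have "\<dots> = (\<Sum>k<D. \<Sum>s<D. \<Sum>r<D.
      of_real (l k) * of_real (m s) * e k i * cnj (e s j) * (cnj (e k r) * e s r))"
    by (subst sum.swap) (intro sum.cong refl sum.swap)
  also have "\<dots> = (\<Sum>k<D. \<Sum>s<D. of_real (l k) * of_real (m s) * e k i * cnj (e s j) * cinner D (e k) (e s))"
    by (simp add: cinner_def sum_distrib_left)
  also have "\<dots> = (\<Sum>k<D. \<Sum>s<D. if k = s then of_real (l k) * of_real (m s) * e k i * cnj (e s j) else 0)"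
    by (intro sum.cong refl) (simp add: spectral_orthonormal[OF A])
  finally show ?thesis by simp
qed

text \<open>Since \<open>mat_abs\<close> is a definite description, its value is found by exhibiting
  one positive square root and appealing to uniqueness: the matrix with the same eigenvectors and
  the absolute eigenvalues.\<close>

lemma trace_norm_spectral:
  assumes s: "spectral D A e l"
  shows "trace_norm D A = (\<Sum>k<D. \<bar>l k\<bar>)"
proof -
  \<comment> \<open>The zero padding outside the D by D block is what \<open>mat_abs\<close>
    demands; it makes the square root unique as a function on all indices.\<close>
  define P where "P i j = (if i < D \<and> j < D then \<Sum>k<D. of_real \<bar>l k\<bar> * e k i * cnj (e k j) else 0)" for i j
  have sP: "spectral D P e (\<lambda>k. \<bar>l k\<bar>)"
    using s unfolding spectral_def P_def by auto
  have psdP: "psd D P" by (rule spectral_psd[OF sP]) simp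
  have adjP: "mmul D P P i j = mmul D (adj P) P i j" if "i < D" "j < D" for i j
  proof -
    have "P i r = cnj (P r i)" if "r < D" for r
      using psdP that \<open>i < D\<close> unfolding psd_def hermitian_def by blast
    then show ?thesis unfolding mmul_def adj_def by (intro sum.cong refl) (metis lessThan_iff)
  qed
  have PP: "mmul D P P i j = mmul D (adj A) A i j" if "i < D" "j < D" for i j
    using that adjP[OF that] by (simp add: spectral_mmul_adj[OF sP sP] spectral_mmul_adj[OF s s])
  have "mat_abs D A = P"
    unfolding mat_abs_def
  proof (rule the_equality)
    show "psd D P \<and> (\<forall>i j. D \<le> i \<or> D \<le> j \<longrightarrow> P i j = 0) \<and>
        (\<forall>i<D. \<forall>j<D. mmul D P P i j = mmul D (adj A) A i j)"
      using psdP PP by (auto simp: P_def)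
  next
    fix Q assume Q: "psd D Q \<and> (\<forall>i j. D \<le> i \<or> D \<le> j \<longrightarrow> Q i j = 0) \<and>
        (\<forall>i<D. \<forall>j<D. mmul D Q Q i j = mmul D (adj A) A i j)"
    have "Q i j = P i j" for i j
    proof (cases "i < D \<and> j < D")
      case True
      then show ?thesis using Q PP psdP by (intro psd_sqrt_unique[of D Q P]) auto
    next
      case False
      then show ?thesis using Q by (auto simp: P_def not_less)
    qed
    then show "Q = P" by blast
  qed
  then have "trace_norm D A = Re (\<Sum>i<D. \<Sum>k<D. of_real \<bar>l k\<bar> * (cnj (e k i) * e k i))"
    by (simp add: trace_norm_def mtrace_def P_def mult_ac)
  also have "(\<Sum>i<D. \<Sum>k<D. complex_of_real \<bar>l k\<bar> * (cnj (e k i) * e k i))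
      = (\<Sum>k<D. of_real \<bar>l k\<bar> * cinner D (e k) (e k))"
    unfolding cinner_def sum_distrib_left by (rule sum.swap)
  also have "\<dots> = of_real (\<Sum>k<D. \<bar>l k\<bar>)"
    by (simp add: spectral_orthonormal[OF s])
  finally show ?thesis by simp
qed

lemma sum2_spectral:
  assumes s: "spectral D \<Delta> e l"
  shows "(\<Sum>i<D. \<Sum>j<D. W i j * \<Delta> j i) = (\<Sum>k<D. of_real (l k) * qform D W (e k))"
proof -
  have "(\<Sum>i<D. \<Sum>j<D. W i j * \<Delta> j i)
      = (\<Sum>i<D. \<Sum>j<D. \<Sum>k<D. of_real (l k) * (cnj (e k i) * W i j * e k j))"
    by (intro sum.cong refl) (simp add: spectral_decomp[OF s] sum_distrib_left mult_ac)
  also have "\<dots> = (\<Sum>i<D. \<Sum>k<D. \<Sum>j<D. of_real (l k) * (cnj (e k i) * W i j * e k j))"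
    by (intro sum.cong refl sum.swap)
  also have "\<dots> = (\<Sum>k<D. \<Sum>i<D. \<Sum>j<D. of_real (l k) * (cnj (e k i) * W i j * e k j))"
    by (rule sum.swap)
  finally show ?thesis by (simp add: qform_def sum_distrib_left)
qed

text \<open>In the eigenbasis of the Hermitian matrix only the values of the quadratic form of W at
  unit eigenvectors enter, each weighted by an eigenvalue. Hence a bound on the numerical range of W
  is enough.\<close>

lemma trace_norm_duality:
  assumes \<Delta>: "hermitian D \<Delta>" and c: "\<And>v. cmod (qform D W v) \<le> c * sqnorm D v"
  shows "cmod (\<Sum>i<D. \<Sum>j<D. W i j * \<Delta> j i) \<le> c * trace_norm D \<Delta>"
proof -
  obtain e l where s: "spectral D \<Delta> e l" using hermitian_spectral[OF \<Delta>] .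
  have "cmod (\<Sum>i<D. \<Sum>j<D. W i j * \<Delta> j i) \<le> (\<Sum>k<D. cmod (of_real (l k) * qform D W (e k)))"
    unfolding sum2_spectral[OF s] by (rule norm_sum)
  also have "\<dots> \<le> (\<Sum>k<D. \<bar>l k\<bar> * c)"
    using c spectral_unit[OF s]
    by (intro sum_mono) (simp add: norm_mult, metis abs_ge_zero mult_left_mono mult.right_neutral)
  also have "\<dots> = c * trace_norm D \<Delta>"
    by (simp add: trace_norm_spectral[OF s] sum_distrib_left mult.commute)
  finally show ?thesis .
qed

section \<open>Kronecker products: spectra and bounds on quadratic forms\<close>

lemma sum_lessThan_mult:
  fixes f :: "nat \<Rightarrow> nat \<Rightarrow> 'a::comm_monoid_add"
  shows "(\<Sum>i<a * b. f (i div b) (i mod b)) = (\<Sum>p<a. \<Sum>q<b. f p q)"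
proof (cases "b = 0")
  case False
  have "(\<Sum>i<a * b. f (i div b) (i mod b)) = (\<Sum>(p, q)\<in>{..<a} \<times> {..<b}. f p q)"
  proof (rule sum.reindex_bij_witness[where i = "\<lambda>(p, q). p * b + q" and j = "\<lambda>i. (i div b, i mod b)"])
    fix pq assume "pq \<in> {..<a} \<times> {..<b}"
    then obtain p q where pq: "pq = (p, q)" "p < a" "q < b" by auto
    have "p * b + q < Suc p * b" using pq by simp
    also have "\<dots> \<le> a * b" using pq by (intro mult_le_mono1) simp
    finally show "(case pq of (p, q) \<Rightarrow> p * b + q) \<in> {..<a * b}" using pq by simp
  qed (use False in \<open>auto simp: less_mult_imp_div_less\<close>)
  then show ?thesis by (simp add: sum.cartesian_product)
qed auto

lemma sum_lessThan_mult_product: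
  fixes f g :: "nat \<Rightarrow> 'a::semiring_0"
  shows "(\<Sum>i<a * b. f (i div b) * g (i mod b)) = (\<Sum>p<a. f p) * (\<Sum>q<b. g q)"
  unfolding sum_lessThan_mult[of "\<lambda>p q. f p * g q"] by (rule sum_product[symmetric])

lemma mod_less_of_less_mult: "i < a * b \<Longrightarrow> i mod b < (b::nat)"
  by (metis mod_less_divisor mult_0_right not_less0 neq0_conv)

text \<open>Tensor products of eigenvectors diagonalise the Kronecker product. Eigenvectors are
  numbered by quotient and remainder modulo \<open>D2\<close>, the same coding of pairs that
  \<open>kron\<close> uses for matrix indices.\<close>

lemma spectral_kron:
  assumes A: "spectral D1 A e l" and B: "spectral D2 B f m"
  shows "spectral (D1 * D2) (kron D2 A B)
    (\<lambda>k i. e (k div D2) (i div D2) * f (k mod D2) (i mod D2)) (\<lambda>k. l (k div D2) * m (k mod D2))"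
  unfolding spectral_def
proof (intro conjI allI impI)
  fix i j assume ij: "i < D1 * D2" "j < D1 * D2"
  note b = less_mult_imp_div_less[OF ij(1)] less_mult_imp_div_less[OF ij(2)]
    mod_less_of_less_mult[OF ij(1)] mod_less_of_less_mult[OF ij(2)]
  have ij_eq: "i div D2 = j div D2 \<and> i mod D2 = j mod D2 \<longleftrightarrow> i = j"
    by (metis div_mult_mod_eq)
  have "cinner (D1 * D2) (\<lambda>r. e (i div D2) (r div D2) * f (i mod D2) (r mod D2))
        (\<lambda>r. e (j div D2) (r div D2) * f (j mod D2) (r mod D2))
      = cinner D1 (e (i div D2)) (e (j div D2)) * cinner D2 (f (i mod D2)) (f (j mod D2))"
    unfolding cinner_def sum_lessThan_mult_product[symmetric]
    by (intro sum.cong refl) (simp add: mult_ac)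
  then show "cinner (D1 * D2) (\<lambda>r. e (i div D2) (r div D2) * f (i mod D2) (r mod D2))
        (\<lambda>r. e (j div D2) (r div D2) * f (j mod D2) (r mod D2)) = (if i = j then 1 else 0)"
    using b ij_eq by (auto simp: spectral_orthonormal[OF A] spectral_orthonormal[OF B])
  have "(\<Sum>k<D1 * D2. (e (k div D2) (i div D2) * f (k mod D2) (i mod D2)) *
          cnj (e (k div D2) (j div D2) * f (k mod D2) (j mod D2)))
      = (\<Sum>k<D1. e k (i div D2) * cnj (e k (j div D2))) * (\<Sum>k<D2. f k (i mod D2) * cnj (f k (j mod D2)))"
    unfolding sum_lessThan_mult_product[symmetric]
    by (intro sum.cong refl) (simp add: mult_ac)
  then show "(\<Sum>k<D1 * D2. (e (k div D2) (i div D2) * f (k mod D2) (i mod D2)) *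
          cnj (e (k div D2) (j div D2) * f (k mod D2) (j mod D2))) = (if i = j then 1 else 0)"
    using b ij_eq by (auto simp: spectral_complete[OF A] spectral_complete[OF B])
  have "kron D2 A B i j
      = (\<Sum>k<D1. of_real (l k) * e k (i div D2) * cnj (e k (j div D2)))
        * (\<Sum>k<D2. of_real (m k) * f k (i mod D2) * cnj (f k (j mod D2)))"
    using b by (simp add: kron_def spectral_decomp[OF A] spectral_decomp[OF B])
  also have "\<dots> = (\<Sum>k<D1 * D2. of_real (l (k div D2) * m (k mod D2)) *
        (e (k div D2) (i div D2) * f (k mod D2) (i mod D2)) *
          cnj (e (k div D2) (j div D2) * f (k mod D2) (j mod D2)))"
    unfolding sum_lessThan_mult_product[symmetric]
    by (intro sum.cong refl) (simp add: mult_ac)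
  finally show "kron D2 A B i j = (\<Sum>k<D1 * D2. of_real (l (k div D2) * m (k mod D2)) *
        (e (k div D2) (i div D2) * f (k mod D2) (i mod D2)) *
          cnj (e (k div D2) (j div D2) * f (k mod D2) (j mod D2)))" .
qed

lemma spectral_bound:
  assumes "spectral D A e l" "\<And>v. cmod (qform D A v) \<le> c * sqnorm D v" "k < D"
  shows "\<bar>l k\<bar> \<le> c"
  using assms(2)[of "e k"] spectral_eigenvalue[OF assms(1,3)] spectral_unit[OF assms(1,3)] by simp

text \<open>For positive A the operator A (x) B lies between -c and c times A (x) I. The right-hand
  side keeps A instead of a norm of A, because these terms are later summed over all Pauli strings,
  where the sum can be evaluated exactly.\<close>

lemma qform_kron_bound:
  assumes A: "psd D1 A" and B: "hermitian D2 B"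
    and c: "\<And>v. cmod (qform D2 B v) \<le> c * sqnorm D2 v"
  shows "cmod (qform (D1 * D2) (kron D2 A B) v) \<le> c * Re (qform (D1 * D2) (kron D2 A ident) v)"
proof -
  obtain e l where e: "spectral D1 A e l" using hermitian_spectral A unfolding psd_def by blast
  obtain f m where f: "spectral D2 B f m" using hermitian_spectral[OF B] .
  have l: "l k \<ge> 0" if "k < D1" for k
    using A spectral_eigenvalue[OF e that] by (metis psd_qform Re_complex_of_real)
  have m: "\<bar>m k\<bar> \<le> c" if "k < D2" for k by (rule spectral_bound[OF f c that])
  define x where "x k = (cmod (cinner (D1 * D2) (\<lambda>i. e (k div D2) (i div D2) * f (k mod D2) (i mod D2)) v))\<^sup>2" for k
  have "cmod (qform (D1 * D2) (kron D2 A B) v) = \<bar>\<Sum>k<D1 * D2. l (k div D2) * m (k mod D2) * x k\<bar>"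
    unfolding spectral_qform[OF spectral_kron[OF e f]] x_def by (rule norm_of_real)
  also have "\<dots> \<le> (\<Sum>k<D1 * D2. \<bar>l (k div D2) * m (k mod D2) * x k\<bar>)" by (rule sum_abs)
  also have "\<dots> \<le> (\<Sum>k<D1 * D2. c * (l (k div D2) * x k))"
  proof (rule sum_mono)
    fix k assume "k \<in> {..<D1 * D2}"
    then have k: "k div D2 < D1" "k mod D2 < D2"
      using less_mult_imp_div_less mod_less_of_less_mult by auto
    have "\<bar>l (k div D2) * m (k mod D2) * x k\<bar> = \<bar>m (k mod D2)\<bar> * (l (k div D2) * x k)"
      using l[OF k(1)] by (simp add: abs_mult x_def)
    also have "\<dots> \<le> c * (l (k div D2) * x k)"
      using l[OF k(1)] m[OF k(2)] by (intro mult_right_mono) (auto simp: x_def)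
    finally show "\<bar>l (k div D2) * m (k mod D2) * x k\<bar> \<le> c * (l (k div D2) * x k)" .
  qed
  also have "\<dots> = c * Re (qform (D1 * D2) (kron D2 A ident) v)"
    unfolding spectral_qform[OF spectral_kron[OF e spectral_ident[OF f]]]
    by (simp add: x_def sum_distrib_left)
  finally show ?thesis .
qed

text \<open>The version for the two observable slots, where neither factor has to be positive: the
  eigenvalues l m of the product are bounded in absolute value by b c.\<close>

lemma qform_kron_hermitian_bound:
  assumes A: "hermitian D1 A" and B: "hermitian D2 B" and "b \<ge> 0"
    and b: "\<And>v. cmod (qform D1 A v) \<le> b * sqnorm D1 v"
    and c: "\<And>v. cmod (qform D2 B v) \<le> c * sqnorm D2 v"
  shows "cmod (qform (D1 * D2) (kron D2 A B) v) \<le> b * c * sqnorm (D1 * D2) v"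
proof -
  obtain e l where e: "spectral D1 A e l" using hermitian_spectral[OF A] .
  obtain f m where f: "spectral D2 B f m" using hermitian_spectral[OF B] .
  have l: "\<bar>l k\<bar> \<le> b" if "k < D1" for k by (rule spectral_bound[OF e b that])
  have m: "\<bar>m k\<bar> \<le> c" if "k < D2" for k by (rule spectral_bound[OF f c that])
  note ef = spectral_kron[OF e f]
  define g where "g = (\<lambda>k i. e (k div D2) (i div D2) * f (k mod D2) (i mod D2))"
  have "cmod (qform (D1 * D2) (kron D2 A B) v)
      = \<bar>\<Sum>k<D1 * D2. l (k div D2) * m (k mod D2) * (cmod (cinner (D1 * D2) (g k) v))\<^sup>2\<bar>"
    unfolding spectral_qform[OF ef] g_def by (rule norm_of_real)
  also have "\<dots> \<le> (\<Sum>k<D1 * D2. \<bar>l (k div D2) * m (k mod D2) * (cmod (cinner (D1 * D2) (g k) v))\<^sup>2\<bar>)"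
    by (rule sum_abs)
  also have "\<dots> \<le> (\<Sum>k<D1 * D2. b * c * (cmod (cinner (D1 * D2) (g k) v))\<^sup>2)"
  proof (rule sum_mono)
    fix k assume "k \<in> {..<D1 * D2}"
    then have k: "k div D2 < D1" "k mod D2 < D2"
      using less_mult_imp_div_less mod_less_of_less_mult by auto
    show "\<bar>l (k div D2) * m (k mod D2) * (cmod (cinner (D1 * D2) (g k) v))\<^sup>2\<bar>
        \<le> b * c * (cmod (cinner (D1 * D2) (g k) v))\<^sup>2"
      unfolding abs_mult using l[OF k(1)] m[OF k(2)] \<open>b \<ge> 0\<close>
      by (simp add: mult_mono mult_right_mono)
  qed
  also have "\<dots> = b * c * sqnorm (D1 * D2) v"
    using spectral_parseval[OF ef, of v] by (simp add: g_def flip: sum_distrib_left)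
  finally show ?thesis .
qed

lemma hermitian_kron:
  assumes "hermitian D1 A" "hermitian D2 B"
  shows "hermitian (D1 * D2) (kron D2 A B)"
  unfolding hermitian_def
proof (intro allI impI)
  fix i j assume ij: "i < D1 * D2" "j < D1 * D2"
  have "A (i div D2) (j div D2) = cnj (A (j div D2) (i div D2))"
    using assms(1) ij unfolding hermitian_def by (blast intro: less_mult_imp_div_less)
  moreover have "B (i mod D2) (j mod D2) = cnj (B (j mod D2) (i mod D2))"
    using assms(2) ij unfolding hermitian_def by (blast intro: mod_less_of_less_mult)
  ultimately show "kron D2 A B i j = cnj (kron D2 A B j i)" by (simp add: kron_def)
qed

section \<open>The shadow protocol\<close>

lemma xor_less_two_power: "a < 2 ^ n \<Longrightarrow> b < 2 ^ n \<Longrightarrow> xor a b < (2::nat) ^ n"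
  by (metis take_bit_nat_eq_self_iff take_bit_xor)

lemma xor_cancel_right [simp]: "xor (xor a b) b = (a::nat)"
  by (simp add: xor.assoc)

lemma sum_xor_shift:
  assumes "x < (2::nat) ^ n"
  shows "(\<Sum>j<2 ^ n. f (xor j x)) = (\<Sum>j<2 ^ n. f j)"
  by (rule sum.reindex_bij_witness[where i = "\<lambda>j. xor j x" and j = "\<lambda>j. xor j x"])
    (use assms in \<open>auto intro: xor_less_two_power\<close>)

text \<open>Writing the parity sign qubit by qubit reduces its multiplicativity in either argument
  to a check on single bits.\<close>

lemma bsign_prod: "bsign n z a = (\<Prod>i<n. if bit z i \<and> bit a i then - 1 else 1)"
proof -
  have "(\<Prod>i<n. if bit z i \<and> bit a i then - 1 else (1::complex))
      = (\<Prod>i\<in>{i. i < n \<and> bit z i \<and> bit a i}. - 1)"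
    by (intro prod.mono_neutral_cong_right) auto
  then show ?thesis by (simp add: bsign_def)
qed

lemma bsign_xor_right: "bsign n z (xor a b) = bsign n z a * bsign n z b"
  unfolding bsign_prod prod.distrib[symmetric]
  by (intro prod.cong) (auto simp: bit_xor_iff)

lemma bsign_xor_left: "bsign n (xor y z) a = bsign n y a * bsign n z a"
  unfolding bsign_prod prod.distrib[symmetric]
  by (intro prod.cong) (auto simp: bit_xor_iff)

lemma bsign_self [simp]: "bsign n z a * bsign n z a = 1"
  by (simp add: bsign_def flip: power_add mult_2)

lemma cnj_bsign [simp]: "cnj (bsign n z a) = bsign n z a"
  by (simp add: bsign_def)

lemma cmod_bsign [simp]: "cmod (bsign n z a) = 1"
  by (simp add: bsign_def norm_power)

text \<open>Orthogonality of characters: if bit i of c is set, flipping bit i of z permutes the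
  summation range and changes the sign of every term.\<close>

lemma sum_bsign:
  assumes "c < 2 ^ n"
  shows "(\<Sum>z<2 ^ n. bsign n z c) = (if c = 0 then 2 ^ n else 0)"
proof (cases "c = 0")
  case True
  then show ?thesis by (simp add: bsign_def)
next
  case False
  then obtain i where i: "bit c i" by (metis bit_eqI bit_0_eq bot_apply bot_bool_def)
  have "i < n"
    using i assms by (metis bit_take_bit_iff take_bit_nat_eq_self_iff)
  have flip: "bsign n (2 ^ i) c = - 1"
  proof -
    have "{j. j < n \<and> bit ((2::nat) ^ i) j \<and> bit c j} = {i}"
      using i \<open>i < n\<close> by (auto simp: bit_exp_iff)
    then show ?thesis by (simp add: bsign_def)
  qed
  have "(2::nat) ^ i < 2 ^ n" using \<open>i < n\<close> by simp
  then have "(\<Sum>z<2 ^ n. bsign n z c) = (\<Sum>z<2 ^ n. bsign n (xor z (2 ^ i)) c)"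
    by (rule sum_xor_shift[symmetric])
  also have "\<dots> = - (\<Sum>z<2 ^ n. bsign n z c)"
    by (simp add: bsign_xor_left flip sum_negf)
  finally show ?thesis using False by simp
qed

definition conj_pauli :: "nat \<Rightarrow> nat \<Rightarrow> nat \<Rightarrow> cvec \<Rightarrow> cvec" where
  "conj_pauli n x z \<zeta> = (\<lambda>j. cnj (pauli_xz n x z \<zeta> j))"

text \<open>With P = X^x Z^z this is P^T B^T P: exchanging the arguments of B transposes it, the xor
  with x applies X^x and the signs apply Z^z. The transpose moves the complex conjugation from the
  state to the observable.\<close>

definition twist :: "nat \<Rightarrow> nat \<Rightarrow> nat \<Rightarrow> cmat \<Rightarrow> cmat" where
  "twist n x z B = (\<lambda>a b. bsign n z a * bsign n z b * B (xor b x) (xor a x))"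

lemma qform_conj_pauli:
  assumes "x < 2 ^ n"
  shows "qform (2 ^ n) B (conj_pauli n x z \<zeta>) = qform (2 ^ n) (twist n x z B) \<zeta>"
proof -
  have "qform (2 ^ n) B (conj_pauli n x z \<zeta>)
      = (\<Sum>i<2 ^ n. \<Sum>j<2 ^ n. bsign n z (xor i x) * \<zeta> (xor i x) * B i j
          * (bsign n z (xor j x) * cnj (\<zeta> (xor j x))))"
    by (simp add: qform_def conj_pauli_def pauli_xz_def)
  also have "\<dots> = (\<Sum>i<2 ^ n. \<Sum>j<2 ^ n. bsign n z (xor i x) * \<zeta> (xor i x) * B i (xor j x)
          * (bsign n z j * cnj (\<zeta> j)))"
    by (subst (2) sum_xor_shift[OF assms, symmetric]) simp
  also have "\<dots> = (\<Sum>i<2 ^ n. \<Sum>j<2 ^ n. bsign n z i * \<zeta> i * B (xor i x) (xor j x)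
          * (bsign n z j * cnj (\<zeta> j)))"
    by (subst sum_xor_shift[OF assms, symmetric]) simp
  also have "\<dots> = (\<Sum>j<2 ^ n. \<Sum>i<2 ^ n. bsign n z i * \<zeta> i * B (xor i x) (xor j x)
          * (bsign n z j * cnj (\<zeta> j)))"
    by (rule sum.swap)
  also have "\<dots> = qform (2 ^ n) (twist n x z B) \<zeta>"
    unfolding qform_def twist_def by (intro sum.cong refl) (simp add: mult_ac)
  finally show ?thesis .
qed

lemma sqnorm_conj_pauli: "x < 2 ^ n \<Longrightarrow> sqnorm (2 ^ n) (conj_pauli n x z v) = sqnorm (2 ^ n) v"
  using sum_xor_shift[of x n "\<lambda>j. (cmod (v j))\<^sup>2"]
  by (simp add: sqnorm_def conj_pauli_def pauli_xz_def norm_mult)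

lemma hermitian_twist:
  assumes "hermitian (2 ^ n) B" "x < 2 ^ n"
  shows "hermitian (2 ^ n) (twist n x z B)"
  unfolding hermitian_def
proof (intro allI impI)
  fix a b :: nat assume "a < 2 ^ n" "b < 2 ^ n"
  then have "B (xor b x) (xor a x) = cnj (B (xor a x) (xor b x))"
    using assms unfolding hermitian_def by (blast intro: xor_less_two_power)
  then show "twist n x z B a b = cnj (twist n x z B b a)" by (simp add: twist_def)
qed

lemma psd_twist:
  assumes "psd (2 ^ n) B" "x < 2 ^ n"
  shows "psd (2 ^ n) (twist n x z B)"
  using assms hermitian_twist by (simp add: psd_qform flip: qform_conj_pauli)

lemma twist_bound:
  assumes "\<And>v. cmod (qform (2 ^ n) B v) \<le> c * sqnorm (2 ^ n) v" "x < 2 ^ n"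
  shows "cmod (qform (2 ^ n) (twist n x z B) v) \<le> c * sqnorm (2 ^ n) v"
  using assms(1)[of "conj_pauli n x z v"] assms(2)
  by (simp add: qform_conj_pauli sqnorm_conj_pauli)

lemma mtrace_twist: "x < 2 ^ n \<Longrightarrow> mtrace (2 ^ n) (twist n x z B) = mtrace (2 ^ n) B"
  using sum_xor_shift[of x n "\<lambda>j. B j j"] by (simp add: mtrace_def twist_def)

text \<open>Conjugation by a Pauli string preserves products, but the transpose reverses their
  order.\<close>

lemma mmul_twist:
  assumes "x < 2 ^ n"
  shows "mmul (2 ^ n) (twist n x z A) (twist n x z B) = twist n x z (mmul (2 ^ n) B A)"
proof (intro ext)
  fix i j
  have "mmul (2 ^ n) (twist n x z A) (twist n x z B) i j
      = (\<Sum>l<2 ^ n. bsign n z i * bsign n z j * (B (xor j x) (xor l x) * A (xor l x) (xor i x))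
          * (bsign n z l * bsign n z l))"
    unfolding mmul_def twist_def by (intro sum.cong refl) (simp only: mult_ac)
  also have "\<dots> = (\<Sum>l<2 ^ n. bsign n z i * bsign n z j * (B (xor j x) l * A l (xor i x)))"
    unfolding bsign_self mult_1_right
    by (rule sum_xor_shift[OF assms, of "\<lambda>l. bsign n z i * bsign n z j * (B (xor j x) l * A l (xor i x))"])
  finally show "mmul (2 ^ n) (twist n x z A) (twist n x z B) i j = twist n x z (mmul (2 ^ n) B A) i j"
    by (simp add: twist_def mmul_def sum_distrib_left)
qed

text \<open>The Pauli twirl: the sum over z is a character sum that forces a = b, and for a = b the
  sum over x runs through the whole diagonal of B.\<close>

lemma sum_twist:
  assumes "a < 2 ^ n" "b < 2 ^ n"
  shows "(\<Sum>z<2 ^ n. \<Sum>x<2 ^ n. twist n x z B a b) = (if a = b then 2 ^ n * mtrace (2 ^ n) B else 0)"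
proof -
  have "(\<Sum>z<2 ^ n. \<Sum>x<2 ^ n. twist n x z B a b)
      = (\<Sum>z<2 ^ n. bsign n z (xor a b)) * (\<Sum>x<2 ^ n. B (xor b x) (xor a x))"
    by (simp add: twist_def sum_product bsign_xor_right)
  also have "\<dots> = (if a = b then 2 ^ n * (\<Sum>x<2 ^ n. B (xor x a) (xor x a)) else 0)"
    using assms by (auto simp: sum_bsign xor_less_two_power xor.commute)
      (metis xor_cancel_right xor.commute xor.left_neutral)
  also have "(\<Sum>x<2 ^ n. B (xor x a) (xor x a)) = mtrace (2 ^ n) B"
    unfolding mtrace_def by (rule sum_xor_shift[OF assms(1)])
  finally show ?thesis .
qed

section \<open>Outcome probabilities and outcome values of the circuit\<close>

text \<open>The CNOT layer sends |a, b> to |a, b xor a> and the Hadamards leave the second register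
  alone, so the amplitude of (z, x) is nonzero only if b xor a = x.\<close>

lemma shadow_unitary_entry:
  assumes "x < 2 ^ n" "a < 2 ^ n" "b < 2 ^ n"
  shows "shadow_unitary n (z * 2 ^ n + x) (a * 2 ^ n + b)
    = (if b = xor x a then hadamard_n n z a else 0)"
proof -
  have four: "4 ^ n = (2::nat) ^ n * 2 ^ n" by (simp flip: power_mult_distrib)
  have "shadow_unitary n (z * 2 ^ n + x) (a * 2 ^ n + b)
      = (\<Sum>l<2 ^ n * 2 ^ n. hadamard_n n z (l div 2 ^ n) * ident x (l mod 2 ^ n)
          * (if l div 2 ^ n = a \<and> l mod 2 ^ n = xor b a then 1 else 0))"
    using assms by (simp add: shadow_unitary_def mmul_def kron_def cnot_all_def four)
  also have "\<dots> = (\<Sum>p<2 ^ n. \<Sum>q<2 ^ n. hadamard_n n z p * ident x q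
          * (if p = a \<and> q = xor b a then 1 else 0))"
    by (rule sum_lessThan_mult)
  also have "\<dots> = (\<Sum>p<2 ^ n. \<Sum>q<2 ^ n. if q = xor b a then
         if p = a then hadamard_n n z p * ident x q else 0 else 0)"
    by (intro sum.cong) auto
  also have "\<dots> = hadamard_n n z a * ident x (xor b a)"
    using assms by (simp add: xor_less_two_power)
  also have "\<dots> = (if b = xor x a then hadamard_n n z a else 0)"
    by (auto simp: ident_def)
  finally show ?thesis .
qed

text \<open>A row of the unitary has one nonzero entry for each a, so both sums over the joint index
  collapse to sums over the first register. What remains is a quadratic form of rho at a vector
  built from zeta.\<close>

lemma outcome_prob_eq:
  assumes "x < 2 ^ n"
  shows "outcome_prob n \<rho> \<zeta> z x = Re (qform (2 ^ n) \<rho> (conj_pauli n x z \<zeta>)) / 2 ^ n"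
proof -
  define U where "U = shadow_unitary n (z * 2 ^ n + x)"
  have four: "4 ^ n = (2::nat) ^ n * 2 ^ n" by (simp flip: power_mult_distrib)
  \<comment> \<open>Row (z, x) contracted with an arbitrary function of the two register indices;
    needed once for each side of the density matrix.\<close>
  have contract: "(\<Sum>l<4 ^ n. U l * g (l div 2 ^ n) (l mod 2 ^ n))
      = (\<Sum>a<2 ^ n. hadamard_n n z a * g a (xor x a))" for g
  proof -
    have "(\<Sum>l<4 ^ n. U l * g (l div 2 ^ n) (l mod 2 ^ n))
        = (\<Sum>l<2 ^ n * 2 ^ n. U ((l div 2 ^ n) * 2 ^ n + l mod 2 ^ n) * g (l div 2 ^ n) (l mod 2 ^ n))"
      by (simp only: four div_mult_mod_eq)
    also have "\<dots> = (\<Sum>a<2 ^ n. \<Sum>b<2 ^ n. U (a * 2 ^ n + b) * g a b)"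
      by (rule sum_lessThan_mult)
    also have "\<dots> = (\<Sum>a<2 ^ n. \<Sum>b<2 ^ n. if b = xor x a then hadamard_n n z a * g a b else 0)"
      using assms by (intro sum.cong refl) (simp add: U_def shadow_unitary_entry)
    also have "\<dots> = (\<Sum>a<2 ^ n. hadamard_n n z a * g a (xor x a))"
      using assms by (intro sum.cong refl) (simp add: xor_less_two_power)
    finally show ?thesis .
  qed
  have "mmul (4 ^ n) (mmul (4 ^ n) (shadow_unitary n) (kron (2 ^ n) \<rho> (outer \<zeta> \<zeta>)))
        (adj (shadow_unitary n)) (z * 2 ^ n + x) (z * 2 ^ n + x)
      = (\<Sum>m<4 ^ n. (\<Sum>l<4 ^ n. U l * (\<rho> (l div 2 ^ n) (m div 2 ^ n)
            * (\<zeta> (l mod 2 ^ n) * cnj (\<zeta> (m mod 2 ^ n))))) * cnj (U m))"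
    by (simp add: mmul_def adj_def kron_def outer_def U_def)
  also have "\<dots> = (\<Sum>m<4 ^ n. (\<Sum>a<2 ^ n. hadamard_n n z a * (\<rho> a (m div 2 ^ n)
            * (\<zeta> (xor x a) * cnj (\<zeta> (m mod 2 ^ n))))) * cnj (U m))"
    using contract[of "\<lambda>a b. \<rho> a (m div 2 ^ n) * (\<zeta> b * cnj (\<zeta> (m mod 2 ^ n)))" for m] by simp
  \<comment> \<open>Conjugating turns the adjoint factor back into the row \<open>U\<close>, so that
    \<open>contract\<close> applies a second time.\<close>
  also have "\<dots> = cnj (\<Sum>m<4 ^ n. U m * cnj (\<Sum>a<2 ^ n. hadamard_n n z a * (\<rho> a (m div 2 ^ n)
            * (\<zeta> (xor x a) * cnj (\<zeta> (m mod 2 ^ n))))))"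
    by (simp add: mult.commute)
  also have "\<dots> = cnj (\<Sum>a'<2 ^ n. hadamard_n n z a' * cnj (\<Sum>a<2 ^ n. hadamard_n n z a * (\<rho> a a'
            * (\<zeta> (xor x a) * cnj (\<zeta> (xor x a'))))))"
    using contract[of "\<lambda>a' b'. cnj (\<Sum>a<2 ^ n. hadamard_n n z a * (\<rho> a a'
            * (\<zeta> (xor x a) * cnj (\<zeta> b'))))"] by (rule arg_cong)
  also have "\<dots> = (\<Sum>a'<2 ^ n. \<Sum>a<2 ^ n. hadamard_n n z a' * hadamard_n n z a * (\<rho> a a'
            * (\<zeta> (xor x a) * cnj (\<zeta> (xor x a')))))"
    by (simp add: sum_distrib_left hadamard_n_def mult_ac)
  also have "\<dots> = (\<Sum>a<2 ^ n. \<Sum>a'<2 ^ n. hadamard_n n z a' * hadamard_n n z a * (\<rho> a a'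
            * (\<zeta> (xor x a) * cnj (\<zeta> (xor x a')))))"
    by (rule sum.swap)
  also have "\<dots> = (\<Sum>a<2 ^ n. \<Sum>a'<2 ^ n. cnj (conj_pauli n x z \<zeta> a) * \<rho> a a' * conj_pauli n x z \<zeta> a' / 2 ^ n)"
  proof (intro sum.cong refl)
    fix a a' :: nat
    \<comment> \<open>The shift by x contributes the sign \<open>bsign n z x\<close> twice, and the
      two cancel.\<close>
    have "bsign n z (xor a x) * bsign n z (xor a' x) = bsign n z a * bsign n z a' * (bsign n z x * bsign n z x)"
      by (simp only: bsign_xor_right mult_ac)
    then have s: "bsign n z (xor a x) * bsign n z (xor a' x) = bsign n z a * bsign n z a'" by simp
    have "complex_of_real (sqrt (2 ^ n)) * complex_of_real (sqrt (2 ^ n)) = 2 ^ n"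
      by (simp flip: of_real_mult)
    then have "hadamard_n n z a' * hadamard_n n z a = bsign n z a * bsign n z a' / 2 ^ n"
      by (simp add: hadamard_n_def)
    then have "hadamard_n n z a' * hadamard_n n z a * (\<rho> a a' * (\<zeta> (xor x a) * cnj (\<zeta> (xor x a'))))
       = bsign n z (xor a x) * bsign n z (xor a' x) * (\<rho> a a' * (\<zeta> (xor a x) * cnj (\<zeta> (xor a' x)))) / 2 ^ n"
      by (simp add: s xor.commute)
    then show "hadamard_n n z a' * hadamard_n n z a * (\<rho> a a' * (\<zeta> (xor x a) * cnj (\<zeta> (xor x a'))))
       = cnj (conj_pauli n x z \<zeta> a) * \<rho> a a' * conj_pauli n x z \<zeta> a' / 2 ^ n"
      by (simp add: conj_pauli_def pauli_xz_def mult_ac)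
  qed
  also have "\<dots> = qform (2 ^ n) \<rho> (conj_pauli n x z \<zeta>) / 2 ^ n"
    by (simp add: qform_def sum_divide_distrib)
  finally have "outcome_prob n \<rho> \<zeta> z x = Re (qform (2 ^ n) \<rho> (conj_pauli n x z \<zeta>) / 2 ^ n)"
    by (simp add: outcome_prob_def)
  also have "\<dots> = Re (qform (2 ^ n) \<rho> (conj_pauli n x z \<zeta>)) / 2 ^ n"
    using Re_divide_of_real[of "qform (2 ^ n) \<rho> (conj_pauli n x z \<zeta>)" "2 ^ n"]
    by (simp only: of_real_power of_real_numeral)
  finally show ?thesis .
qed

lemma shadow_val_eq:
  "shadow_val n Ob \<zeta> x z = (2 ^ n + 1) * Re (qform (2 ^ n) Ob (conj_pauli n x z \<zeta>)) - Re (mtrace (2 ^ n) Ob)"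
proof -
  have "mtrace (2 ^ n) (mmul (2 ^ n) Ob (shadow n \<zeta> x z))
      = (\<Sum>i<2 ^ n. (2 ^ n + 1) * (\<Sum>j<2 ^ n. cnj (conj_pauli n x z \<zeta> i) * Ob i j * conj_pauli n x z \<zeta> j)
          - (\<Sum>j<2 ^ n. if j = i then Ob i j else 0))"
    unfolding mtrace_def mmul_def sum_distrib_left sum_subtractf[symmetric]
    by (intro sum.cong refl)
      (simp add: shadow_def outer_def conj_pauli_def ident_def Let_def algebra_simps)
  also have "\<dots> = (2 ^ n + 1) * qform (2 ^ n) Ob (conj_pauli n x z \<zeta>) - mtrace (2 ^ n) Ob"
    by (simp add: qform_def mtrace_def sum_subtractf sum_distrib_left)
  also have "(2 ^ n + 1) * qform (2 ^ n) Ob (conj_pauli n x z \<zeta>)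
      = of_real (2 ^ n + 1) * qform (2 ^ n) Ob (conj_pauli n x z \<zeta>)" by simp
  finally show ?thesis by (simp only: shadow_val_def minus_complex.sel Re_complex_of_real times_complex.sel Im_complex_of_real mult_zero_left diff_0_right)
qed

section \<open>Gaussian moments\<close>

lemma (in pair_sigma_finite)
  fixes f :: "'a \<Rightarrow> 'c::{real_normed_field, banach, second_countable_topology}"
  assumes f: "integrable M1 f" and g: "integrable M2 g"
  shows integrable_times_pair: "integrable (M1 \<Otimes>\<^sub>M M2) (\<lambda>(x, y). f x * g y)"
    and integral_times_pair: "(\<integral>(x, y). f x * g y \<partial>(M1 \<Otimes>\<^sub>M M2)) = integral\<^sup>L M1 f * integral\<^sup>L M2 g"
proof -
  have [measurable]: "f \<in> borel_measurable M1" "g \<in> borel_measurable M2" using f g by auto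
  show *: "integrable (M1 \<Otimes>\<^sub>M M2) (\<lambda>(x, y). f x * g y)"
  proof (rule Fubini_integrable)
    show "integrable M1 (\<lambda>x. \<integral>y. norm (case (x, y) of (x, y) \<Rightarrow> f x * g y) \<partial>M2)"
      using f g by (simp add: norm_mult)
    show "AE x in M1. integrable M2 (\<lambda>y. case (x, y) of (x, y) \<Rightarrow> f x * g y)"
      using g by simp
  qed measurable
  show "(\<integral>(x, y). f x * g y \<partial>(M1 \<Otimes>\<^sub>M M2)) = integral\<^sup>L M1 f * integral\<^sup>L M2 g"
    using integral_fst'[OF *] by simp
qed

abbreviation std_gauss :: "real measure" where
  "std_gauss \<equiv> density lborel (\<lambda>x. ennreal (std_normal_density x))"

lemma prob_space_std_gauss: "prob_space std_gauss"
  by (rule prob_space_normal_density) simp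

text \<open>For even k this is the double factorial (k - 1)!!, the k-th moment of the standard
  normal law.\<close>

definition gauss_moment :: "nat \<Rightarrow> real" where
  "gauss_moment k = (if even k then fact k / (2 ^ (k div 2) * fact (k div 2)) else 0)"

lemma normal_density_moment:
  assumes "\<sigma> > 0"
  shows "has_bochner_integral lborel (\<lambda>x. normal_density 0 \<sigma> x * x ^ k) (gauss_moment k * \<sigma> ^ k)"
proof (cases "even k")
  case True
  then obtain m where k: "k = 2 * m" by (elim evenE)
  show ?thesis
    using normal_moment_even[OF assms, of 0 m] assms
    by (simp add: k gauss_moment_def field_simps power_divide flip: power_mult)
next
  case False
  then obtain m where k: "k = 2 * m + 1" by (elim oddE)
  show ?thesis using normal_moment_odd[OF assms, of 0 m] by (simp add: k gauss_moment_def)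
qed

text \<open>Multiplying the standard normal density by exp (-s x^2) gives sigma times the centred
  normal density of variance 1 / (1 + 2 s); the extra sigma explains the exponent
  \<open>Suc k\<close>.\<close>

lemma damped_gauss_moment:
  assumes "s \<ge> 0"
  defines "\<sigma> \<equiv> 1 / sqrt (1 + 2 * s)"
  shows "has_bochner_integral std_gauss (\<lambda>x. x ^ k * exp (- s * x\<^sup>2)) (gauss_moment k * \<sigma> ^ Suc k)"
proof -
  have pos: "1 + 2 * s > 0" using assms(1) by simp
  then have \<sigma>: "\<sigma> > 0" "\<sigma>\<^sup>2 = 1 / (1 + 2 * s)" by (simp_all add: \<sigma>_def power_divide)
  have dens: "std_normal_density x * exp (- s * x\<^sup>2) = \<sigma> * normal_density 0 \<sigma> x" for x
  proof -
    have "sqrt (2 * pi * \<sigma>\<^sup>2) = sqrt (2 * pi) * \<sigma>" using \<sigma>(1) by (simp add: real_sqrt_mult)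
    moreover have "- x\<^sup>2 / (2 * \<sigma>\<^sup>2) = - x\<^sup>2 / 2 + - s * x\<^sup>2"
      unfolding \<sigma>(2) using pos by (simp add: field_simps)
    ultimately show ?thesis
      using \<sigma>(1) by (simp add: normal_density_def exp_add[symmetric] del: minus_divide_left)
  qed
  have "has_bochner_integral lborel (\<lambda>x. \<sigma> * (normal_density 0 \<sigma> x * x ^ k)) (\<sigma> * (gauss_moment k * \<sigma> ^ k))"
    by (intro has_bochner_integral_mult_right normal_density_moment \<sigma>)
  also have "(\<lambda>x. \<sigma> * (normal_density 0 \<sigma> x * x ^ k)) = (\<lambda>x. std_normal_density x *\<^sub>R (x ^ k * exp (- s * x\<^sup>2)))"
    using dens by (simp add: fun_eq_iff mult.assoc[symmetric])
  finally have "has_bochner_integral std_gauss (\<lambda>x. x ^ k * exp (- s * x\<^sup>2)) (\<sigma> * (gauss_moment k * \<sigma> ^ k))"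
    by (intro has_bochner_integral_density) auto
  then show ?thesis by (simp add: mult_ac)
qed

lemma std_complex_gauss_eq: "std_complex_gauss = distr (std_gauss \<Otimes>\<^sub>M std_gauss) borel (\<lambda>(x, y). Complex x y)"
proof -
  interpret prob_space std_gauss by (rule prob_space_std_gauss)
  have "std_gauss \<Otimes>\<^sub>M std_gauss = density (lborel \<Otimes>\<^sub>M lborel)
      (\<lambda>(x, y). ennreal (std_normal_density x) * ennreal (std_normal_density y))"
    by (rule pair_measure_density) (auto intro: sigma_finite_measure_axioms lborel.sigma_finite_measure_axioms)
  then show ?thesis
    by (simp add: std_complex_gauss_def ennreal_mult')
qed

lemma measurable_Complex [measurable]: "(\<lambda>(x, y). Complex x y) \<in> borel_measurable (std_gauss \<Otimes>\<^sub>M std_gauss)"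
  unfolding case_prod_beta Complex_eq by measurable

lemma sets_std_complex_gauss [simp, measurable_cong]: "sets std_complex_gauss = sets borel"
  by (simp add: std_complex_gauss_def)

lemma prob_space_std_complex_gauss: "prob_space std_complex_gauss"
proof -
  interpret prob_space std_gauss by (rule prob_space_std_gauss)
  interpret P: pair_prob_space std_gauss std_gauss ..
  show ?thesis unfolding std_complex_gauss_eq by (rule P.prob_space_distr) measurable
qed

lemma AE_std_complex_gauss_nonzero: "AE z in std_complex_gauss. z \<noteq> 0"
proof -
  have "AE p in lborel \<Otimes>\<^sub>M lborel. p \<noteq> (0::real \<times> real)"
    unfolding lborel_prod by (rule AE_lborel_singleton)
  then have "AE p in density (lborel \<Otimes>\<^sub>M lborel) (\<lambda>(x, y). ennreal (std_normal_density x * std_normal_density y)).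
      (case p of (x, y) \<Rightarrow> Complex x y) \<noteq> 0"
    by (subst AE_density) (auto simp: Complex_eq_0 zero_prod_def)
  then show ?thesis
    unfolding std_complex_gauss_def
    by (subst AE_distr_iff) (auto simp: case_prod_beta Complex_eq)
qed

lemma complex_monomial_expand:
  "Complex x y ^ a * cnj (Complex x y) ^ b = (\<Sum>p\<le>a. \<Sum>q\<le>b.
     (of_nat (a choose p) * of_nat (b choose q) * \<i> ^ (a - p) * (- \<i>) ^ (b - q)) *
      (of_real (x ^ (p + q)) * of_real (y ^ ((a - p) + (b - q)))))"
proof -
  have "Complex x y ^ a = (\<Sum>p\<le>a. of_nat (a choose p) * of_real x ^ p * (\<i> * of_real y) ^ (a - p))"
    unfolding Complex_eq by (rule binomial_ring)
  moreover have "cnj (Complex x y) ^ b = (\<Sum>q\<le>b. of_nat (b choose q) * of_real x ^ q * (- \<i> * of_real y) ^ (b - q))"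
    unfolding Complex_eq by (subst binomial_ring[symmetric]) simp
  ultimately show ?thesis
    by (simp only: sum_product power_mult_distrib power_add of_real_mult of_real_power mult_ac)
qed

text \<open>The damping factors over real and imaginary part, so a binomial expansion reduces the
  integral to real moments. In every term the powers of sigma add up to the same exponent a + b +
  2.\<close>

lemma std_complex_gauss_monomial:
  assumes "s \<ge> 0"
  defines "\<sigma> \<equiv> 1 / sqrt (1 + 2 * s)"
  shows "has_bochner_integral std_complex_gauss (\<lambda>z. z ^ a * cnj z ^ b * of_real (exp (- s * (cmod z)\<^sup>2)))
    (\<Sum>p\<le>a. \<Sum>q\<le>b. (of_nat (a choose p) * of_nat (b choose q) * \<i> ^ (a - p) * (- \<i>) ^ (b - q)) *
      of_real (gauss_moment (p + q) * gauss_moment ((a - p) + (b - q)) * \<sigma> ^ (a + b + 2)))"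
proof -
  interpret prob_space std_gauss by (rule prob_space_std_gauss)
  interpret P: pair_prob_space std_gauss std_gauss ..
  define h where "h k x = complex_of_real (x ^ k * exp (- s * x\<^sup>2))" for k x
  have h: "has_bochner_integral std_gauss (h k) (of_real (gauss_moment k * \<sigma> ^ Suc k))" for k
    unfolding h_def using damped_gauss_moment[OF assms(1), of k] unfolding \<sigma>_def
    by (rule has_bochner_integral_of_real)
  have hh: "has_bochner_integral (std_gauss \<Otimes>\<^sub>M std_gauss) (\<lambda>(x, y). h k x * h m y)
      (of_real (gauss_moment k * \<sigma> ^ Suc k) * of_real (gauss_moment m * \<sigma> ^ Suc m))" for k m
    using P.integrable_times_pair[of "h k" "h m"] P.integral_times_pair[of "h k" "h m"] h[of k] h[of m]
    by (simp add: has_bochner_integral_iff)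
  have "has_bochner_integral (std_gauss \<Otimes>\<^sub>M std_gauss) (\<lambda>w. \<Sum>p\<le>a. \<Sum>q\<le>b.
      (of_nat (a choose p) * of_nat (b choose q) * \<i> ^ (a - p) * (- \<i>) ^ (b - q)) *
      (case w of (x, y) \<Rightarrow> h (p + q) x * h ((a - p) + (b - q)) y))
    (\<Sum>p\<le>a. \<Sum>q\<le>b. (of_nat (a choose p) * of_nat (b choose q) * \<i> ^ (a - p) * (- \<i>) ^ (b - q)) *
      (of_real (gauss_moment (p + q) * \<sigma> ^ Suc (p + q))
        * of_real (gauss_moment ((a - p) + (b - q)) * \<sigma> ^ Suc ((a - p) + (b - q)))))"
    by (intro has_bochner_integral_sum has_bochner_integral_mult_right hh)
  also have "(\<lambda>w. \<Sum>p\<le>a. \<Sum>q\<le>b.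
      (of_nat (a choose p) * of_nat (b choose q) * \<i> ^ (a - p) * (- \<i>) ^ (b - q)) *
      (case w of (x, y) \<Rightarrow> h (p + q) x * h ((a - p) + (b - q)) y))
    = (\<lambda>w. (\<lambda>z. z ^ a * cnj z ^ b * of_real (exp (- s * (cmod z)\<^sup>2))) (case w of (x, y) \<Rightarrow> Complex x y))"
  proof (intro ext)
    fix w :: "real \<times> real"
    obtain x y where w: "w = (x, y)" by (cases w)
    have "exp (- s * (cmod (Complex x y))\<^sup>2) = exp (- s * x\<^sup>2) * exp (- s * y\<^sup>2)"
      by (simp add: complex_norm algebra_simps flip: exp_add)
    then show "(\<Sum>p\<le>a. \<Sum>q\<le>b.
      (of_nat (a choose p) * of_nat (b choose q) * \<i> ^ (a - p) * (- \<i>) ^ (b - q)) *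
      (case w of (x, y) \<Rightarrow> h (p + q) x * h ((a - p) + (b - q)) y))
      = (\<lambda>z. z ^ a * cnj z ^ b * of_real (exp (- s * (cmod z)\<^sup>2))) (case w of (x, y) \<Rightarrow> Complex x y)"
      by (simp add: w h_def complex_monomial_expand sum_distrib_right sum_distrib_left mult_ac)
  qed
  also have "(\<Sum>p\<le>a. \<Sum>q\<le>b. (of_nat (a choose p) * of_nat (b choose q) * \<i> ^ (a - p) * (- \<i>) ^ (b - q)) *
      (of_real (gauss_moment (p + q) * \<sigma> ^ Suc (p + q))
        * of_real (gauss_moment ((a - p) + (b - q)) * \<sigma> ^ Suc ((a - p) + (b - q)))))
    = (\<Sum>p\<le>a. \<Sum>q\<le>b. (of_nat (a choose p) * of_nat (b choose q) * \<i> ^ (a - p) * (- \<i>) ^ (b - q)) *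
      complex_of_real (gauss_moment (p + q) * gauss_moment ((a - p) + (b - q)) * \<sigma> ^ (a + b + 2)))"
  proof (intro sum.cong refl arg_cong2[where f = "(*)"])
    fix p q assume "p \<in> {..a}" "q \<in> {..b}"
    then have "a + b + 2 = Suc (p + q) + Suc ((a - p) + (b - q))" by simp
    then show "complex_of_real (gauss_moment (p + q) * \<sigma> ^ Suc (p + q))
        * of_real (gauss_moment ((a - p) + (b - q)) * \<sigma> ^ Suc ((a - p) + (b - q)))
      = of_real (gauss_moment (p + q) * gauss_moment ((a - p) + (b - q)) * \<sigma> ^ (a + b + 2))"
      by (simp only: power_add of_real_mult mult_ac)
  qed
  finally show ?thesis
    unfolding std_complex_gauss_eq
    by (rule has_bochner_integral_distr[OF _ measurable_Complex, rotated])
      (intro borel_measurable_continuous_onI continuous_intros)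
qed

text \<open>A third moment contains each coordinate and its conjugate at most three times, so
  sixteen cases suffice and are evaluated directly. The factor 2^a a! is E |z|^(2a), as real and
  imaginary part both have variance 1.\<close>

lemma std_complex_gauss_monomial_le_3:
  assumes "s \<ge> 0" "a \<le> 3" "b \<le> 3"
  shows "has_bochner_integral std_complex_gauss (\<lambda>z. z ^ a * cnj z ^ b * of_real (exp (- s * (cmod z)\<^sup>2)))
    (if a = b then of_real (2 ^ a * fact a * (1 / (1 + 2 * s)) ^ Suc a) else 0)"
proof -
  define \<sigma> where "\<sigma> = 1 / sqrt (1 + 2 * s)"
  have \<sigma>: "\<sigma>\<^sup>2 = 1 / (1 + 2 * s)" using assms(1) by (simp add: \<sigma>_def power_divide)
  have g: "gauss_moment 0 = 1" "gauss_moment (Suc 0) = 0" "gauss_moment (Suc (Suc 0)) = 1"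
    "gauss_moment (Suc (Suc (Suc 0))) = 0" "gauss_moment (Suc (Suc (Suc (Suc 0)))) = 3"
    "gauss_moment (Suc (Suc (Suc (Suc (Suc 0))))) = 0"
    "gauss_moment (Suc (Suc (Suc (Suc (Suc (Suc 0)))))) = 15"
    by (simp_all add: gauss_moment_def)
  have coeffs: "(\<Sum>p\<le>a. \<Sum>q\<le>b. (of_nat (a choose p) * of_nat (b choose q) * \<i> ^ (a - p) * (- \<i>) ^ (b - q)) *
      complex_of_real (gauss_moment (p + q) * gauss_moment ((a - p) + (b - q))))
    = (if a = b then of_real (2 ^ a * fact a) else 0)"
  proof -
    have "a = 0 \<or> a = 1 \<or> a = 2 \<or> a = 3" "b = 0 \<or> b = 1 \<or> b = 2 \<or> b = 3" using assms by auto
    then show ?thesis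
      by (elim disjE; simp add: numeral_2_eq_2 numeral_3_eq_3 g; simp add: mult.assoc)
  qed
  have "(\<Sum>p\<le>a. \<Sum>q\<le>b. (of_nat (a choose p) * of_nat (b choose q) * \<i> ^ (a - p) * (- \<i>) ^ (b - q)) *
      of_real (gauss_moment (p + q) * gauss_moment ((a - p) + (b - q)) * \<sigma> ^ (a + b + 2)))
    = (if a = b then of_real (2 ^ a * fact a) else 0) * complex_of_real (\<sigma> ^ (a + b + 2))"
    unfolding coeffs[symmetric] sum_distrib_right
    by (intro sum.cong refl) (simp add: mult_ac)
  also have "\<dots> = (if a = b then of_real (2 ^ a * fact a * (1 / (1 + 2 * s)) ^ Suc a) else 0)"
  proof -
    have "(\<sigma>\<^sup>2) ^ Suc a = \<sigma> ^ (a + a + 2)"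
      unfolding power_mult[symmetric] by (rule arg_cong[where f = "(^) \<sigma>"]) simp
    then show ?thesis unfolding \<sigma>[symmetric] by (simp only: of_real_mult if_distrib mult_zero_left) auto
  qed
  finally show ?thesis
    using std_complex_gauss_monomial[OF assms(1), of a b] by (simp add: \<sigma>_def)
qed

section \<open>Third moment of the Haar measure\<close>

lemma borel_measurable_cnj [measurable (raw)]:
  assumes "f \<in> borel_measurable M"
  shows "(\<lambda>x. cnj (f x)) \<in> borel_measurable M"
proof -
  have "cnj \<in> borel_measurable borel"
    by (intro borel_measurable_continuous_onI continuous_intros)
  from measurable_compose[OF assms this] show ?thesis .
qed

section \<open>Permutations of three indices and multiplicities\<close>

text \<open>Matrix entries of the sum of the six permutation operators on three tensor factors, that
  is, 6 times the projector onto the symmetric subspace.\<close>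

definition sym3 :: "nat \<Rightarrow> nat \<Rightarrow> nat \<Rightarrow> nat \<Rightarrow> nat \<Rightarrow> nat \<Rightarrow> complex" where
  "sym3 i1 i2 i3 j1 j2 j3 =
     of_bool (i1 = j1) * of_bool (i2 = j2) * of_bool (i3 = j3)
   + of_bool (i1 = j1) * of_bool (i2 = j3) * of_bool (i3 = j2)
   + of_bool (i1 = j2) * of_bool (i2 = j1) * of_bool (i3 = j3)
   + of_bool (i1 = j2) * of_bool (i2 = j3) * of_bool (i3 = j1)
   + of_bool (i1 = j3) * of_bool (i2 = j1) * of_bool (i3 = j2)
   + of_bool (i1 = j3) * of_bool (i2 = j2) * of_bool (i3 = j1)"

definition mult3 :: "nat \<Rightarrow> nat \<Rightarrow> nat \<Rightarrow> nat \<Rightarrow> nat" where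
  "mult3 i1 i2 i3 l = of_bool (l = i1) + of_bool (l = i2) + of_bool (l = i3)"

text \<open>Agreement at the entries of the first triple suffices, since these values already
  account for all three slots of the second.\<close>

lemma mult3_eq_imp_perm:
  assumes "mult3 i1 i2 i3 i1 = mult3 j1 j2 j3 i1" "mult3 i1 i2 i3 i2 = mult3 j1 j2 j3 i2"
      "mult3 i1 i2 i3 i3 = mult3 j1 j2 j3 i3"
  shows "(j1, j2, j3) \<in> {(i1, i2, i3), (i1, i3, i2), (i2, i1, i3), (i2, i3, i1), (i3, i1, i2), (i3, i2, i1)}"
proof -
  have "i1 = j1 \<or> i1 = j2 \<or> i1 = j3" using assms(1) unfolding mult3_def by (rule_tac ccontr) simp
  then show ?thesis
  proof (elim disjE)
    assume 1: "i1 = j1"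
    have "i2 = j2 \<or> i2 = j3" using assms(2) unfolding 1 mult3_def by (rule_tac ccontr) simp
    then show ?thesis using assms(3) unfolding 1 mult3_def by (elim disjE; rule_tac ccontr; simp)
  next
    assume 1: "i1 = j2"
    have "i2 = j1 \<or> i2 = j3" using assms(2) unfolding 1 mult3_def by (rule_tac ccontr) simp
    then show ?thesis using assms(3) unfolding 1 mult3_def by (elim disjE; rule_tac ccontr; simp)
  next
    assume 1: "i1 = j3"
    have "i2 = j1 \<or> i2 = j2" using assms(2) unfolding 1 mult3_def by (rule_tac ccontr) simp
    then show ?thesis using assms(3) unfolding 1 mult3_def by (elim disjE; rule_tac ccontr; simp)
  qed
qed

text \<open>Both sides count the permutations of the slots that carry one triple to the other. They
  form a coset of the stabiliser, whose order is the product of the factorials of the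
  multiplicities.\<close>

lemma prod_fact_mult3_support:
  assumes "mult3 i1 i2 i3 i1 = mult3 j1 j2 j3 i1" "mult3 i1 i2 i3 i2 = mult3 j1 j2 j3 i2"
      "mult3 i1 i2 i3 i3 = mult3 j1 j2 j3 i3"
  shows "(\<Prod>l\<in>{i1, i2, i3}. fact (mult3 i1 i2 i3 l)) = sym3 i1 i2 i3 j1 j2 j3"
proof -
  \<comment> \<open>The order of the stabiliser, built up slot by slot: the second index may
    coincide with the first, the third with either of them.\<close>
  define P :: complex where "P = (1 + of_bool (i1 = i2)) * (1 + of_bool (i1 = i3) + of_bool (i2 = i3))"
  have "(\<Prod>l\<in>{i1, i2, i3}. fact (mult3 i1 i2 i3 l)) = P"
  proof -
    consider "i1 = i2" "i2 = i3" | "i1 = i2" "i2 \<noteq> i3" | "i1 = i3" "i2 \<noteq> i3" | "i2 = i3" "i1 \<noteq> i2"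
      | "i1 \<noteq> i2" "i1 \<noteq> i3" "i2 \<noteq> i3" by blast
    then show ?thesis
    proof cases
      case 3
      then have "{i1, i2, i3} = {i2, i3}" by auto
      with 3 show ?thesis by (simp add: P_def mult3_def)
    qed (simp_all add: P_def mult3_def)
  qed
  moreover have "sym3 i1 i2 i3 j1 j2 j3 = P"
    using mult3_eq_imp_perm[OF assms] unfolding insert_iff empty_iff prod.inject
    by (elim disjE conjE FalseE; hypsubst; simp add: P_def sym3_def of_bool_def)
  ultimately show ?thesis by simp
qed

text \<open>The combinatorial part of a Gaussian moment: a coordinate with different multiplicities
  contributes 0, and one that occurs in neither triple contributes 0! = 1.\<close>

lemma prod_fact_mult3:
  assumes "i1 < D" "i2 < D" "i3 < D" "j1 < D" "j2 < D" "j3 < D"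
  shows "(\<Prod>l<D. if mult3 i1 i2 i3 l = mult3 j1 j2 j3 l then fact (mult3 i1 i2 i3 l) else 0)
    = sym3 i1 i2 i3 j1 j2 j3"
proof (cases "\<forall>l<D. mult3 i1 i2 i3 l = mult3 j1 j2 j3 l")
  case True
  have "(\<Prod>l<D. if mult3 i1 i2 i3 l = mult3 j1 j2 j3 l then fact (mult3 i1 i2 i3 l) else (0::complex))
      = (\<Prod>l<D. fact (mult3 i1 i2 i3 l))"
    using True by (intro prod.cong) auto
  also have "\<dots> = (\<Prod>l\<in>{i1, i2, i3}. fact (mult3 i1 i2 i3 l))"
    using assms by (intro prod.mono_neutral_right) (auto simp: mult3_def)
  also have "\<dots> = sym3 i1 i2 i3 j1 j2 j3"
  proof -
    have "mult3 i1 i2 i3 l = mult3 j1 j2 j3 l" if "l \<in> {i1, i2, i3}" for l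
      using True assms that by blast
    then show ?thesis by (intro prod_fact_mult3_support) simp_all
  qed
  finally show ?thesis .
next
  case False
  then obtain l where l: "l < D" "mult3 i1 i2 i3 l \<noteq> mult3 j1 j2 j3 l" by blast
  have "\<not> ((i1 = j1 \<and> i2 = j2) \<and> i3 = j3)" "\<not> ((i1 = j1 \<and> i2 = j3) \<and> i3 = j2)"
    "\<not> ((i1 = j2 \<and> i2 = j1) \<and> i3 = j3)" "\<not> ((i1 = j2 \<and> i2 = j3) \<and> i3 = j1)"
    "\<not> ((i1 = j3 \<and> i2 = j1) \<and> i3 = j2)" "\<not> ((i1 = j3 \<and> i2 = j2) \<and> i3 = j1)"
    using l(2) by (clarify, simp add: mult3_def)+
  then have "sym3 i1 i2 i3 j1 j2 j3 = 0"
    unfolding sym3_def of_bool_conj[symmetric] by (simp only: of_bool_eq) simp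
  moreover have "(\<Prod>l<D. if mult3 i1 i2 i3 l = mult3 j1 j2 j3 l then fact (mult3 i1 i2 i3 l) else (0::complex)) = 0"
    using l by (intro prod_zero) auto
  ultimately show ?thesis by simp
qed

lemma prod_power_of_bool:
  fixes g :: "nat \<Rightarrow> 'a::comm_monoid_mult"
  assumes "i < D"
  shows "(\<Prod>l<D. g l ^ of_bool (l = i)) = g i"
proof -
  have "(\<Prod>l<D. g l ^ of_bool (l = i)) = (\<Prod>l<D. if l = i then g l else 1)"
    by (intro prod.cong) auto
  then show ?thesis using assms by simp
qed

lemma prod_power_mult3:
  fixes g :: "nat \<Rightarrow> 'a::comm_monoid_mult"
  assumes "i1 < D" "i2 < D" "i3 < D"
  shows "(\<Prod>l<D. g l ^ mult3 i1 i2 i3 l) = g i1 * g i2 * g i3"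
  using assms by (simp add: mult3_def power_add prod.distrib prod_power_of_bool)

lemma sum_mult3:
  assumes "i1 < D" "i2 < D" "i3 < D"
  shows "(\<Sum>l<D. mult3 i1 i2 i3 l) = 3"
  using assms by (simp add: mult3_def sum.distrib of_bool_def)

section \<open>From Gaussian vectors to uniformly distributed unit vectors\<close>

abbreviation gauss_vec :: "nat \<Rightarrow> cvec measure" where
  "gauss_vec D \<equiv> PiM {..<D} (\<lambda>_. std_complex_gauss)"

definition mono3 :: "nat \<Rightarrow> nat \<Rightarrow> nat \<Rightarrow> nat \<Rightarrow> nat \<Rightarrow> nat \<Rightarrow> cvec \<Rightarrow> complex" where
  "mono3 i1 i2 i3 j1 j2 j3 v = v i1 * v i2 * v i3 * cnj (v j1 * v j2 * v j3)"

lemma product_sigma_finite_gauss: "product_sigma_finite (\<lambda>_. std_complex_gauss)"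
  using prob_space_std_complex_gauss
  by (intro product_sigma_finite.intro) (simp add: prob_space_imp_sigma_finite)

lemma prob_space_gauss_vec: "prob_space (gauss_vec D)"
  by (intro prob_space_PiM prob_space_std_complex_gauss)

text \<open>The coordinates are independent and the damping is a product over them. The factor 8 =
  2^3 reflects the total degree 3, and D + 3 is the sum of the exponents \<open>Suc (a l)\<close>
  over all coordinates.\<close>

lemma gauss_vec_damped_mono3:
  assumes "s \<ge> 0" and i: "i1 < D" "i2 < D" "i3 < D" and j: "j1 < D" "j2 < D" "j3 < D"
  shows "(\<integral>g. mono3 i1 i2 i3 j1 j2 j3 g * of_real (exp (- s * sqnorm D g)) \<partial>gauss_vec D)
    = of_real (8 * (1 / (1 + 2 * s)) ^ (D + 3)) * sym3 i1 i2 i3 j1 j2 j3"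
proof -
  interpret product_sigma_finite "\<lambda>_::nat. std_complex_gauss" by (rule product_sigma_finite_gauss)
  define a where "a = mult3 i1 i2 i3"
  define b where "b = mult3 j1 j2 j3"
  have ab: "a l \<le> 3" "b l \<le> 3" for l by (auto simp: a_def b_def mult3_def)
  note one = std_complex_gauss_monomial_le_3[OF \<open>s \<ge> 0\<close> ab(1) ab(2)]
  have "mono3 i1 i2 i3 j1 j2 j3 g * of_real (exp (- s * sqnorm D g))
      = (\<Prod>l<D. g l ^ a l * cnj (g l) ^ b l * of_real (exp (- s * (cmod (g l))\<^sup>2)))" for g
  proof -
    have "exp (- s * sqnorm D g) = (\<Prod>l<D. exp (- s * (cmod (g l))\<^sup>2))"
      unfolding sqnorm_def sum_distrib_left by (rule exp_sum) simp
    then show ?thesis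
      unfolding prod.distrib a_def b_def prod_power_mult3[OF i] prod_power_mult3[OF j, of "\<lambda>l. cnj (g l)"]
      by (simp add: mono3_def)
  qed
  then have "(\<integral>g. mono3 i1 i2 i3 j1 j2 j3 g * of_real (exp (- s * sqnorm D g)) \<partial>gauss_vec D)
    = (\<Prod>l<D. \<integral>z. z ^ a l * cnj z ^ b l * of_real (exp (- s * (cmod z)\<^sup>2)) \<partial>std_complex_gauss)"
    by (simp only:) (intro product_integral_prod finite_lessThan integrable.intros[OF one])
  also have "\<dots> = (\<Prod>l<D. of_real (2 ^ a l * (1 / (1 + 2 * s)) ^ Suc (a l)) * (if a l = b l then fact (a l) else 0))"
    by (intro prod.cong refl, subst has_bochner_integral_integral_eq[OF one]) simp
  also have "\<dots> = of_real ((\<Prod>l<D. 2 ^ a l) * (\<Prod>l<D. (1 / (1 + 2 * s)) ^ Suc (a l))) * sym3 i1 i2 i3 j1 j2 j3"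
    unfolding prod.distrib a_def b_def prod_fact_mult3[OF i j]
    by (simp only: of_real_prod of_real_mult prod.distrib)
  also have "(\<Prod>l<D. 2 ^ a l) = (2::real) ^ 3"
    unfolding a_def by (simp only: sum_mult3[OF i] flip: power_sum)
  also have "(\<Prod>l<D. (1 / (1 + 2 * s)) ^ Suc (a l)) = (1 / (1 + 2 * s)) ^ (D + 3)"
  proof -
    have "(\<Sum>l<D. Suc (a l)) = D + 3"
      unfolding a_def using sum_mult3[OF i] by (simp add: sum_Suc)
    then show ?thesis by (simp only: flip: power_sum)
  qed
  finally show ?thesis by simp
qed

text \<open>The integrand that represents 1 / q^3 as a Laplace integral; at q = 0 it is the bare
  weight s^2 / 2.\<close>

definition radial_weight :: "real \<Rightarrow> real \<Rightarrow> real" where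
  "radial_weight q s = (if s < 0 then 0 else s\<^sup>2 / 2 * exp (- s * q))"

text \<open>Up to the factor 1 / q^3 this is the Erlang density of rate q and shape 3, which
  \<open>erlang_density\<close> indexes by 2.\<close>

lemma radial_weight_integral:
  assumes "q > 0"
  shows "has_bochner_integral lborel (radial_weight q) (1 / q ^ 3)"
proof -
  have "(\<integral>\<^sup>+ x. ennreal (erlang_density 2 q x) \<partial>lborel) = ennreal 1"
    using nn_integral_erlang_ith_moment[OF assms, of 2 0] by simp
  then have "has_bochner_integral lborel (erlang_density 2 q) 1"
    using assms by (intro has_bochner_integral_nn_integral) auto
  then have "has_bochner_integral lborel (\<lambda>s. 1 / q ^ 3 * erlang_density 2 q s) (1 / q ^ 3 * 1)"
    by (rule has_bochner_integral_mult_right)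
  moreover have "1 / q ^ 3 * erlang_density 2 q s = radial_weight q s" for s
    using assms by (simp add: erlang_density_def radial_weight_def eval_nat_numeral field_simps)
  ultimately show ?thesis by simp
qed

lemma cmod_sq_le_sqnorm: "i < D \<Longrightarrow> (cmod (v i))\<^sup>2 \<le> sqnorm D v"
  unfolding sqnorm_def by (intro member_le_sum) auto

lemma cmod_mono3_le:
  assumes "i1 < D" "i2 < D" "i3 < D" "j1 < D" "j2 < D" "j3 < D"
  shows "cmod (mono3 i1 i2 i3 j1 j2 j3 v) \<le> sqnorm D v ^ 3"
proof -
  have le: "cmod (v i) \<le> sqrt (sqnorm D v)" if "i < D" for i
    using cmod_sq_le_sqnorm[OF that, of v] by (simp add: real_le_rsqrt)
  have "cmod (mono3 i1 i2 i3 j1 j2 j3 v)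
      = cmod (v i1) * cmod (v i2) * cmod (v i3) * (cmod (v j1) * cmod (v j2) * cmod (v j3))"
    by (simp add: mono3_def norm_mult)
  also have "\<dots> \<le> sqrt (sqnorm D v) * sqrt (sqnorm D v) * sqrt (sqnorm D v)
      * (sqrt (sqnorm D v) * sqrt (sqnorm D v) * sqrt (sqnorm D v))"
    using assms by (intro mult_mono le mult_nonneg_nonneg) auto
  also have "\<dots> = sqnorm D v ^ 3"
  proof -
    have "sqrt (sqnorm D v) * sqrt (sqnorm D v) = sqnorm D v" by simp
    then show ?thesis by (metis (no_types) mult.assoc mult.left_commute power3_eq_cube)
  qed
  finally show ?thesis .
qed

lemma measurable_gauss_vec_component [measurable]:
  "i < D \<Longrightarrow> (\<lambda>g. g i) \<in> borel_measurable (gauss_vec D)"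
  by (subst measurable_cong_sets[OF refl sets_std_complex_gauss[symmetric]]) simp

lemma measurable_sqnorm_gauss_vec [measurable]: "sqnorm D \<in> borel_measurable (gauss_vec D)"
  unfolding sqnorm_def[abs_def]
  by (intro borel_measurable_sum borel_measurable_power borel_measurable_norm measurable_gauss_vec_component) simp

lemma measurable_mono3_gauss_vec:
  assumes "i1 < D" "i2 < D" "i3 < D" "j1 < D" "j2 < D" "j3 < D"
  shows "mono3 i1 i2 i3 j1 j2 j3 \<in> borel_measurable (gauss_vec D)"
  unfolding mono3_def[abs_def]
  by (intro borel_measurable_times borel_measurable_cnj measurable_gauss_vec_component assms)

text \<open>The integral is not evaluated by calculus; \<open>radial_const_eq\<close> reads its
  value off a normalisation.\<close>

definition radial_const :: "nat \<Rightarrow> real" where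
  "radial_const D = (\<integral>s. radial_weight 0 s * (8 * (1 / (1 + 2 * s)) ^ (D + 3)) \<partial>lborel)"

text \<open>Writing \<open>1 / |g|\<^sup>6\<close> as the Laplace integral of \<open>s\<^sup>2 / 2\<close> turns the moments of the normalised
  Gaussian vector into damped Gaussian moments, which factor over the coordinates.\<close>

lemma normalised_gauss_mono3:
  assumes i: "i1 < D" "i2 < D" "i3 < D" and j: "j1 < D" "j2 < D" "j3 < D"
  shows "(\<integral>g. mono3 i1 i2 i3 j1 j2 j3 g / of_real (sqnorm D g ^ 3) \<partial>gauss_vec D)
    = of_real (radial_const D) * sym3 i1 i2 i3 j1 j2 j3"
proof -
  interpret prob_space "gauss_vec D" by (rule prob_space_gauss_vec)
  interpret P: pair_sigma_finite "gauss_vec D" lborel ..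
  define m where "m = mono3 i1 i2 i3 j1 j2 j3"
  have m_meas [measurable]: "m \<in> borel_measurable (gauss_vec D)"
    unfolding m_def by (rule measurable_mono3_gauss_vec[OF i j])
  define F where "F g s = m g * complex_of_real (radial_weight (sqnorm D g) s)" for g s
  have inner: "has_bochner_integral lborel (F g) (m g / of_real (sqnorm D g ^ 3))" for g
  proof (cases "sqnorm D g = 0")
    \<comment> \<open>At g = 0 both sides vanish: the monomial is 0, and so is its quotient by
      0.\<close>
    case True
    then have "m g = 0" using i by (simp add: sqnorm_eq_0_iff m_def mono3_def)
    then show ?thesis by (simp add: F_def[abs_def] has_bochner_integral_zero)
  next
    case False
    then have "sqnorm D g > 0" using sqnorm_nonneg[of D g] by linarith
    from has_bochner_integral_mult_right[OF has_bochner_integral_of_real[OF radial_weight_integral[OF this]], of "m g"]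
    show ?thesis by (simp add: F_def[abs_def])
  qed
  have F_meas [measurable]: "case_prod F \<in> borel_measurable (gauss_vec D \<Otimes>\<^sub>M lborel)"
    unfolding F_def radial_weight_def case_prod_beta by measurable
  have norm_inner: "(\<integral>s. norm (F g s) \<partial>lborel) = cmod (m g) / sqnorm D g ^ 3" for g
  proof -
    have "norm (F g s) = (if sqnorm D g = 0 then 0 else cmod (m g) * radial_weight (sqnorm D g) s)" for s
      using i by (auto simp: F_def norm_mult radial_weight_def sqnorm_eq_0_iff m_def mono3_def)
    then show ?thesis
    proof (cases "sqnorm D g = 0")
      case False
      then have "sqnorm D g > 0" using sqnorm_nonneg[of D g] by linarith
      from has_bochner_integral_integral_eq[OF radial_weight_integral[OF this]] False
      show ?thesis by (simp add: \<open>\<And>s. norm (F g s) = _\<close>)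
    qed simp
  qed
  \<comment> \<open>Boundedness of the normalised monomial supplies the integrability needed to
    exchange the two integrals.\<close>
  have le1: "cmod (m g) / sqnorm D g ^ 3 \<le> 1" for g
    using cmod_mono3_le[OF i j, of g] by (simp add: m_def divide_le_eq_1) (metis sqnorm_nonneg zero_le_power order_le_less)
  have inner_gauss: "(\<integral>g. F g s \<partial>gauss_vec D)
      = of_real (radial_weight 0 s * (8 * (1 / (1 + 2 * s)) ^ (D + 3))) * sym3 i1 i2 i3 j1 j2 j3" for s
  proof (cases "s < 0")
    case True
    then show ?thesis by (simp add: F_def radial_weight_def)
  next
    case False
    then have "(\<integral>g. F g s \<partial>gauss_vec D)
        = (\<integral>g. of_real (radial_weight 0 s) * (m g * of_real (exp (- s * sqnorm D g))) \<partial>gauss_vec D)"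
      by (intro Bochner_Integration.integral_cong refl) (simp add: F_def radial_weight_def)
    also have "\<dots> = of_real (radial_weight 0 s) * (\<integral>g. m g * of_real (exp (- s * sqnorm D g)) \<partial>gauss_vec D)"
      by (rule integral_mult_right_zero)
    finally show ?thesis
      using False gauss_vec_damped_mono3[OF _ i j, of s] unfolding m_def by simp
  qed
  have "integrable (gauss_vec D \<Otimes>\<^sub>M lborel) (case_prod F)"
  proof (rule P.Fubini_integrable)
    have "integrable (gauss_vec D) (\<lambda>g. cmod (m g) / sqnorm D g ^ 3)"
      by (rule integrable_const_bound[where B = 1]) (use le1 in auto)
    then show "integrable (gauss_vec D) (\<lambda>g. \<integral>s. norm (case (g, s) of (g, s) \<Rightarrow> F g s) \<partial>lborel)"
      by (simp add: norm_inner)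
    show "AE g in gauss_vec D. integrable lborel (\<lambda>s. case (g, s) of (g, s) \<Rightarrow> F g s)"
      using inner by (auto simp: has_bochner_integral_iff)
  qed measurable
  then have "(\<integral>g. (\<integral>s. F g s \<partial>lborel) \<partial>gauss_vec D) = (\<integral>s. (\<integral>g. F g s \<partial>gauss_vec D) \<partial>lborel)"
    by (rule P.Fubini_integral[symmetric])
  also have "\<dots> = (\<integral>s. of_real (radial_weight 0 s * (8 * (1 / (1 + 2 * s)) ^ (D + 3)))
      * sym3 i1 i2 i3 j1 j2 j3 \<partial>lborel)"
    by (simp only: inner_gauss)
  also have "\<dots> = (\<integral>s. complex_of_real (radial_weight 0 s * (8 * (1 / (1 + 2 * s)) ^ (D + 3))) \<partial>lborel)
      * sym3 i1 i2 i3 j1 j2 j3"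
    by (rule integral_mult_left_zero)
  also have "\<dots> = of_real (radial_const D) * sym3 i1 i2 i3 j1 j2 j3"
    by (simp only: integral_complex_of_real radial_const_def)
  finally show ?thesis
    by (simp only: has_bochner_integral_integral_eq[OF inner] m_def)
qed

text \<open>The trace of the permutation sum: D^3 for the identity, D^2 for each of the three
  transpositions and D for each of the two 3-cycles.\<close>

lemma sum_sym3_diag:
  "(\<Sum>i1<D. \<Sum>i2<D. \<Sum>i3<D. sym3 i1 i2 i3 i1 i2 i3) = of_nat (D * (D + 1) * (D + 2))"
proof -
  have "(\<Sum>i2<D. \<Sum>i3<D. sym3 i1 i2 i3 i1 i2 i3) = of_nat (D * D + 3 * D + 2)" if "i1 < D" for i1
  proof -
    have "(\<Sum>i3<D. sym3 i1 i2 i3 i1 i2 i3) = (if i2 = i1 then 2 * of_nat D + 4 else of_nat D + 2)"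
       if "i2 < D" for i2
    proof -
      have "sym3 i1 i2 i3 i1 i2 i3 = (1 + (if i3 = i2 then 1 else 0) + (if i3 = i1 then 1 else 0)) * (if i2 = i1 then 2 else 1)" for i3
         by (auto simp: sym3_def)
      then show ?thesis
        using that \<open>i1 < D\<close> by (simp add: sum.distrib flip: sum_distrib_right)
    qed
    then have "(\<Sum>i2<D. \<Sum>i3<D. sym3 i1 i2 i3 i1 i2 i3) = (\<Sum>i2<D. (of_nat D + 2) + (if i2 = i1 then of_nat D + 2 else 0))"
      by (intro sum.cong) auto
    then show ?thesis using that by (simp add: sum.distrib algebra_simps)
  qed
  then show ?thesis by (simp add: algebra_simps)
qed

text \<open>The diagonal normalised monomials sum to |g|^6 / |g|^6 = 1 almost surely, so the trace
  of the permutation sum fixes the constant.\<close>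

lemma radial_const_eq:
  assumes "D > 0"
  shows "radial_const D = 1 / (real D * (D + 1) * (D + 2))"
proof -
  interpret prob_space "gauss_vec D" by (rule prob_space_gauss_vec)
  have bound: "integrable (gauss_vec D) (\<lambda>g. mono3 i1 i2 i3 j1 j2 j3 g / of_real (sqnorm D g ^ 3))"
    if "i1 < D" "i2 < D" "i3 < D" "j1 < D" "j2 < D" "j3 < D" for i1 i2 i3 j1 j2 j3
  proof (rule integrable_const_bound[where B = 1])
    have "norm (mono3 i1 i2 i3 j1 j2 j3 g / of_real (sqnorm D g ^ 3)) \<le> 1" for g
      using cmod_mono3_le[OF that, of g]
      by (simp add: norm_divide norm_power divide_le_eq_1) (metis sqnorm_nonneg zero_le_power order_le_less)
    then show "AE g in gauss_vec D. norm (mono3 i1 i2 i3 j1 j2 j3 g / of_real (sqnorm D g ^ 3)) \<le> 1" by simp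
    show "(\<lambda>g. mono3 i1 i2 i3 j1 j2 j3 g / of_real (sqnorm D g ^ 3)) \<in> borel_measurable (gauss_vec D)"
      using measurable_mono3_gauss_vec[OF that] by measurable
  qed
  have "of_real (radial_const D) * (\<Sum>i1<D. \<Sum>i2<D. \<Sum>i3<D. sym3 i1 i2 i3 i1 i2 i3)
      = (\<Sum>i1<D. \<Sum>i2<D. \<Sum>i3<D. \<integral>g. mono3 i1 i2 i3 i1 i2 i3 g / of_real (sqnorm D g ^ 3) \<partial>gauss_vec D)"
    unfolding sum_distrib_left
    by (intro sum.cong refl normalised_gauss_mono3[symmetric]) auto
  also have "\<dots> = (\<Sum>i1<D. \<Sum>i2<D. \<integral>g. (\<Sum>i3<D. mono3 i1 i2 i3 i1 i2 i3 g / of_real (sqnorm D g ^ 3)) \<partial>gauss_vec D)"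
    by (intro sum.cong refl Bochner_Integration.integral_sum[symmetric] bound) auto
  also have "\<dots> = (\<Sum>i1<D. \<integral>g. (\<Sum>i2<D. \<Sum>i3<D. mono3 i1 i2 i3 i1 i2 i3 g / of_real (sqnorm D g ^ 3)) \<partial>gauss_vec D)"
    by (intro sum.cong refl Bochner_Integration.integral_sum[symmetric] Bochner_Integration.integrable_sum bound) auto
  also have "\<dots> = (\<integral>g. (\<Sum>i1<D. \<Sum>i2<D. \<Sum>i3<D. mono3 i1 i2 i3 i1 i2 i3 g / of_real (sqnorm D g ^ 3)) \<partial>gauss_vec D)"
    by (intro Bochner_Integration.integral_sum[symmetric] Bochner_Integration.integrable_sum bound) auto
  also have "\<dots> = (\<integral>g. 1 \<partial>gauss_vec D)"
  proof (rule integral_cong_AE)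
    \<comment> \<open>Since D > 0 there is a coordinate, and it is almost surely nonzero; hence so
      is the vector by whose norm one divides.\<close>
    have "AE g in gauss_vec D. g 0 \<noteq> 0"
      using assms by (intro AE_PiM_component AE_std_complex_gauss_nonzero prob_space_std_complex_gauss) auto
    then show "AE g in gauss_vec D.
        (\<Sum>i1<D. \<Sum>i2<D. \<Sum>i3<D. mono3 i1 i2 i3 i1 i2 i3 g / of_real (sqnorm D g ^ 3)) = 1"
    proof eventually_elim
      case (elim g)
      then have nz: "sqnorm D g \<noteq> 0" using assms by (auto simp: sqnorm_eq_0_iff)
      have "(\<Sum>i1<D. \<Sum>i2<D. \<Sum>i3<D. mono3 i1 i2 i3 i1 i2 i3 g)
          = (\<Sum>i<D. cnj (g i) * g i) * (\<Sum>i<D. cnj (g i) * g i) * (\<Sum>i<D. cnj (g i) * g i)"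
        unfolding sum_product sum_distrib_right sum_distrib_left mono3_def
        by (intro sum.cong refl) (simp add: mult_ac)
      also have "\<dots> = of_real (sqnorm D g ^ 3)"
        using cinner_self[of D g] by (simp add: cinner_def power3_eq_cube)
      finally show ?case using nz by (simp flip: sum_divide_distrib)
    qed
  qed (use bound in \<open>auto intro!: borel_measurable_sum borel_measurable_integrable\<close>)
  also have "\<dots> = 1" by (simp add: prob_space)
  finally have "of_real (radial_const D) * complex_of_nat (D * (D + 1) * (D + 2)) = 1"
    by (simp only: sum_sym3_diag)
  then have "complex_of_real (radial_const D * real (D * (D + 1) * (D + 2))) = of_real 1" by simp
  then have "radial_const D * real (D * (D + 1) * (D + 2)) = 1" by (simp only: of_real_eq_iff)
  moreover have "real (D * (D + 1) * (D + 2)) \<noteq> 0" using assms by (simp only: of_nat_eq_0_iff) simp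
  ultimately have "radial_const D = 1 / real (D * (D + 1) * (D + 2))"
    by (simp only: nonzero_eq_divide_eq simp_thms)
  then show ?thesis by (simp only: of_nat_mult of_nat_add of_nat_1 of_nat_numeral)
qed

lemma haar_state_mono3:
  assumes i: "i1 < D" "i2 < D" "i3 < D" and j: "j1 < D" "j2 < D" "j3 < D"
  shows "(\<integral>\<phi>. mono3 i1 i2 i3 j1 j2 j3 \<phi> \<partial>haar_state D)
    = sym3 i1 i2 i3 j1 j2 j3 / of_real (real D * (D + 1) * (D + 2))"
proof -
  define T where "T g = restrict (\<lambda>i. g i / complex_of_real (vnorm D g)) {..<D}" for g
  have vn: "vnorm D g = sqrt (sqnorm D g)" for g by (simp add: vnorm_def sqnorm_def)
  have T [measurable]: "T \<in> measurable (gauss_vec D) (PiM {..<D} (\<lambda>_. borel))"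
    unfolding T_def vn by (intro measurable_restrict) measurable
  have m [measurable]: "mono3 i1 i2 i3 j1 j2 j3 \<in> borel_measurable (PiM {..<D} (\<lambda>_. borel))"
    unfolding mono3_def[abs_def] using i j by measurable
  have "(\<integral>\<phi>. mono3 i1 i2 i3 j1 j2 j3 \<phi> \<partial>haar_state D)
      = (\<integral>g. mono3 i1 i2 i3 j1 j2 j3 (T g) \<partial>gauss_vec D)"
    unfolding haar_state_def T_def[symmetric] by (rule integral_distr) measurable
  also have "\<dots> = (\<integral>g. mono3 i1 i2 i3 j1 j2 j3 g / of_real (sqnorm D g ^ 3) \<partial>gauss_vec D)"
  proof (intro Bochner_Integration.integral_cong refl)
    fix g
    have "complex_of_real (sqnorm D g) = complex_of_real (vnorm D g) * complex_of_real (vnorm D g)"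
      by (simp add: vn flip: of_real_mult)
    then show "mono3 i1 i2 i3 j1 j2 j3 (T g) = mono3 i1 i2 i3 j1 j2 j3 g / of_real (sqnorm D g ^ 3)"
      using i j by (simp add: mono3_def T_def power3_eq_cube)
  qed
  also have "\<dots> = of_real (radial_const D) * sym3 i1 i2 i3 j1 j2 j3"
    by (rule normalised_gauss_mono3[OF i j])
  finally show ?thesis
    using i(1) by (subst (asm) radial_const_eq) auto
qed

section \<open>Contraction with the third moment\<close>

lemma sum3_of_bool:
  fixes f :: "nat \<Rightarrow> nat \<Rightarrow> nat \<Rightarrow> complex"
  assumes "a < D" "b < D" "c < D"
  shows "(\<Sum>i<D. \<Sum>j<D. \<Sum>k<D. f i j k * (of_bool (i = a) * of_bool (j = b) * of_bool (k = c))) = f a b c"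
proof -
  have "(\<Sum>i<D. \<Sum>j<D. \<Sum>k<D. f i j k * (of_bool (i = a) * of_bool (j = b) * of_bool (k = c)))
      = (\<Sum>i<D. \<Sum>j<D. \<Sum>k<D. if k = c then if j = b then if i = a then f i j k else 0 else 0 else 0)"
    by (intro sum.cong refl) auto
  then show ?thesis using assms by simp
qed

lemma sum_prod3:
  fixes f g h :: "nat \<Rightarrow> complex"
  shows "(\<Sum>i\<in>A. \<Sum>j\<in>B. \<Sum>k\<in>C. f i * g j * h k) = (\<Sum>i\<in>A. f i) * (\<Sum>j\<in>B. g j) * (\<Sum>k\<in>C. h k)"
  by (simp only: sum_distrib_left[symmetric] sum_distrib_right[symmetric])

lemma mtrace_mmul: "mtrace D (mmul D A B) = (\<Sum>i<D. \<Sum>j<D. A i j * B j i)"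
  by (simp add: mtrace_def mmul_def)

lemma mtrace_mmul_commute: "mtrace D (mmul D A B) = mtrace D (mmul D B A)"
  unfolding mtrace_mmul by (subst sum.swap) (simp add: mult.commute)

text \<open>Each permutation contracts the matrices along its cycles: a fixed point gives a trace, a
  transposition the trace of a product of two, and the 3-cycles give the two cyclic orders of A, B,
  C.\<close>

lemma sym3_contract:
  "(\<Sum>i1<D. \<Sum>i2<D. \<Sum>i3<D. \<Sum>j1<D. \<Sum>j2<D. \<Sum>j3<D.
      A i1 j1 * B i2 j2 * C i3 j3 * sym3 j1 j2 j3 i1 i2 i3)
    = mtrace D A * mtrace D B * mtrace D C
      + mtrace D A * mtrace D (mmul D B C)
      + mtrace D (mmul D A B) * mtrace D C
      + mtrace D (mmul D (mmul D A B) C)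
      + mtrace D (mmul D (mmul D A C) B)
      + mtrace D (mmul D A C) * mtrace D B"
proof -
  have inner: "(\<Sum>j1<D. \<Sum>j2<D. \<Sum>j3<D. A i1 j1 * B i2 j2 * C i3 j3 * sym3 j1 j2 j3 i1 i2 i3)
      = A i1 i1 * B i2 i2 * C i3 i3 + A i1 i1 * B i2 i3 * C i3 i2 + A i1 i2 * B i2 i1 * C i3 i3
      + A i1 i2 * B i2 i3 * C i3 i1 + A i1 i3 * B i2 i1 * C i3 i2 + A i1 i3 * B i2 i2 * C i3 i1"
    if "i1 < D" "i2 < D" "i3 < D" for i1 i2 i3
    unfolding sym3_def distrib_left sum.distrib using that
    by (simp only: sum3_of_bool[where f = "\<lambda>a b c. A i1 a * B i2 b * C i3 c"])
  have t4: "mtrace D (mmul D (mmul D A B) C) = (\<Sum>i1<D. \<Sum>i2<D. \<Sum>i3<D. A i1 i2 * B i2 i3 * C i3 i1)"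
  proof -
    have "mtrace D (mmul D (mmul D A B) C) = (\<Sum>i1<D. \<Sum>i3<D. \<Sum>i2<D. A i1 i2 * B i2 i3 * C i3 i1)"
      by (simp add: mtrace_def mmul_def sum_distrib_right)
    also have "\<dots> = (\<Sum>i1<D. \<Sum>i2<D. \<Sum>i3<D. A i1 i2 * B i2 i3 * C i3 i1)"
      by (intro sum.cong refl sum.swap)
    finally show ?thesis .
  qed
  have t5: "mtrace D (mmul D (mmul D A C) B) = (\<Sum>i1<D. \<Sum>i2<D. \<Sum>i3<D. A i1 i3 * B i2 i1 * C i3 i2)"
    unfolding mtrace_mmul unfolding mmul_def sum_distrib_right by (simp only: mult_ac)
  have t6: "mtrace D (mmul D A C) * mtrace D B = (\<Sum>i1<D. \<Sum>i2<D. \<Sum>i3<D. A i1 i3 * B i2 i2 * C i3 i1)"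
  proof -
    have "mtrace D (mmul D A C) * mtrace D B = (\<Sum>i1<D. (\<Sum>i2<D. B i2 i2) * (\<Sum>i3<D. A i1 i3 * C i3 i1))"
      by (simp add: mtrace_def mmul_def sum_distrib_left[symmetric] mult.commute)
    then show ?thesis by (simp add: sum_product mult_ac)
  qed
  have t3: "mtrace D (mmul D A B) * mtrace D C = (\<Sum>i1<D. \<Sum>i2<D. \<Sum>i3<D. A i1 i2 * B i2 i1 * C i3 i3)"
    unfolding mtrace_mmul sum_distrib_right by (simp add: mtrace_def sum_distrib_left)
  have t2: "mtrace D A * mtrace D (mmul D B C) = (\<Sum>i1<D. \<Sum>i2<D. \<Sum>i3<D. A i1 i1 * B i2 i3 * C i3 i2)"
    unfolding mtrace_def[of D A] mtrace_mmul sum_distrib_right by (simp add: sum_distrib_left mult.assoc)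
  have t1: "mtrace D A * mtrace D B * mtrace D C = (\<Sum>i1<D. \<Sum>i2<D. \<Sum>i3<D. A i1 i1 * B i2 i2 * C i3 i3)"
    unfolding mtrace_def by (rule sum_prod3[symmetric])
  show ?thesis
    unfolding t1 t2 t3 t4 t5 t6 sum.distrib[symmetric]
    by (intro sum.cong refl inner) auto
qed

section \<open>Three-fold tensor products in base-D digits\<close>

text \<open>Because \<open>tensor_pow\<close> nests to the right, the leading base-D digit of an
  index belongs to the first tensor factor.\<close>

lemma tensor_pow_3_outer:
  "tensor_pow D 3 (outer \<phi> \<phi>) i j = mono3 (i div D ^ 2) (i mod D ^ 2 div D) (i mod D ^ 2 mod D)
     (j div D ^ 2) (j mod D ^ 2 div D) (j mod D ^ 2 mod D) \<phi>"
  by (simp add: numeral_3_eq_3 kron_def outer_def mono3_def power2_eq_square mult_ac)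

lemma digits_less:
  assumes "i < (D::nat) ^ 3"
  shows "i div D ^ 2 < D" "i mod D ^ 2 div D < D" "i mod D ^ 2 mod D < D"
proof -
  have i: "i < D * D ^ 2" using assms by (simp add: power3_eq_cube power2_eq_square)
  then have m: "i mod D ^ 2 < D * D"
    unfolding power2_eq_square by (metis mod_less_of_less_mult mult.assoc)
  show "i div D ^ 2 < D" using i by (rule less_mult_imp_div_less)
  show "i mod D ^ 2 div D < D" using m by (rule less_mult_imp_div_less)
  show "i mod D ^ 2 mod D < D" using m by (rule mod_less_of_less_mult)
qed

lemma sum_digits3:
  fixes f :: "nat \<Rightarrow> nat \<Rightarrow> nat \<Rightarrow> 'a::comm_monoid_add"
  shows "(\<Sum>i<D ^ 3. f (i div D ^ 2) (i mod D ^ 2 div D) (i mod D ^ 2 mod D))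
    = (\<Sum>i1<D. \<Sum>i2<D. \<Sum>i3<D. f i1 i2 i3)"
proof -
  have "(\<Sum>i<D ^ 3. f (i div D ^ 2) (i mod D ^ 2 div D) (i mod D ^ 2 mod D))
      = (\<Sum>i<D * D ^ 2. f (i div D ^ 2) (i mod D ^ 2 div D) (i mod D ^ 2 mod D))"
    by (simp only: power3_eq_cube power2_eq_square mult.assoc)
  also have "\<dots> = (\<Sum>i1<D. \<Sum>q<D ^ 2. f i1 (q div D) (q mod D))"
    by (rule sum_lessThan_mult)
  also have "\<dots> = (\<Sum>i1<D. \<Sum>i2<D. \<Sum>i3<D. f i1 i2 i3)"
    unfolding power2_eq_square by (simp only: sum_lessThan_mult)
  finally show ?thesis .
qed

definition kron3 :: "nat \<Rightarrow> cmat \<Rightarrow> cmat \<Rightarrow> cmat \<Rightarrow> cmat" where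
  "kron3 D A B C = kron (D ^ 2) A (kron D B C)"

text \<open>\<open>f\<close> is left abstract so that the same rearrangement serves the pure-state
  monomials and the Haar moment. The digits of j come first in \<open>f\<close> because the sum is
  the trace of a product.\<close>

lemma sum2_kron3:
  "(\<Sum>i<D ^ 3. \<Sum>j<D ^ 3. kron3 D A B C i j * f (j div D ^ 2) (j mod D ^ 2 div D) (j mod D ^ 2 mod D)
       (i div D ^ 2) (i mod D ^ 2 div D) (i mod D ^ 2 mod D))
    = (\<Sum>i1<D. \<Sum>i2<D. \<Sum>i3<D. \<Sum>j1<D. \<Sum>j2<D. \<Sum>j3<D.
      A i1 j1 * B i2 j2 * C i3 j3 * f j1 j2 j3 i1 i2 i3)"
proof -
  have inner: "(\<Sum>j<D ^ 3. kron3 D A B C i j * f (j div D ^ 2) (j mod D ^ 2 div D) (j mod D ^ 2 mod D)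
       (i div D ^ 2) (i mod D ^ 2 div D) (i mod D ^ 2 mod D))
    = (\<Sum>j1<D. \<Sum>j2<D. \<Sum>j3<D. A (i div D ^ 2) j1 * B (i mod D ^ 2 div D) j2 * C (i mod D ^ 2 mod D) j3
        * f j1 j2 j3 (i div D ^ 2) (i mod D ^ 2 div D) (i mod D ^ 2 mod D))" for i
    unfolding sum_digits3[symmetric] by (simp add: kron3_def kron_def mult_ac)
  show ?thesis unfolding inner by (rule sum_digits3)
qed

text \<open>This is what makes a product of an outcome probability and two outcome values linear in
  the third moment.\<close>

lemma sum2_kron3_mono3:
  "(\<Sum>i<D ^ 3. \<Sum>j<D ^ 3. kron3 D A B C i j * tensor_pow D 3 (outer v v) j i)
    = qform D A v * qform D B v * qform D C v"
proof -
  have "(\<Sum>i<D ^ 3. \<Sum>j<D ^ 3. kron3 D A B C i j * tensor_pow D 3 (outer v v) j i)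
     = (\<Sum>i1<D. \<Sum>i2<D. \<Sum>i3<D. \<Sum>j1<D. \<Sum>j2<D. \<Sum>j3<D.
      A i1 j1 * B i2 j2 * C i3 j3 * mono3 j1 j2 j3 i1 i2 i3 v)"
    unfolding tensor_pow_3_outer by (rule sum2_kron3)
  also have "\<dots> = (\<Sum>i1<D. \<Sum>i2<D. \<Sum>i3<D. (\<Sum>j1<D. cnj (v i1) * A i1 j1 * v j1)
      * (\<Sum>j2<D. cnj (v i2) * B i2 j2 * v j2) * (\<Sum>j3<D. cnj (v i3) * C i3 j3 * v j3))"
    unfolding sum_prod3[symmetric] by (intro sum.cong refl) (simp add: mono3_def mult_ac)
  also have "\<dots> = qform D A v * qform D B v * qform D C v"
    unfolding qform_def by (rule sum_prod3)
  finally show ?thesis .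
qed

lemma haar_moment_3:
  assumes "i < D ^ 3" "j < D ^ 3"
  shows "haar_moment D 3 i j = sym3 (i div D ^ 2) (i mod D ^ 2 div D) (i mod D ^ 2 mod D)
     (j div D ^ 2) (j mod D ^ 2 div D) (j mod D ^ 2 mod D) / of_real (real D * (D + 1) * (D + 2))"
  unfolding haar_moment_def tensor_pow_3_outer
  by (intro haar_state_mono3 digits_less assms)

lemma cnj_mono3: "cnj (mono3 i1 i2 i3 j1 j2 j3 v) = mono3 j1 j2 j3 i1 i2 i3 v"
  by (simp add: mono3_def mult_ac)

lemma cnj_tensor_pow_3: "cnj (tensor_pow D 3 (outer v v) i j) = tensor_pow D 3 (outer v v) j i"
  unfolding tensor_pow_3_outer by (rule cnj_mono3)

text \<open>Hermiticity of both moments makes trace-norm duality applicable to their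
  difference.\<close>

lemma cnj_haar_moment_3: "cnj (haar_moment D 3 i j) = haar_moment D 3 j i"
  unfolding haar_moment_def cnj_tensor_pow_3[symmetric, of D _ j i] by simp

lemma cnj_ens_moment_3: "cnj (ens_moment K \<psi> D 3 i j) = ens_moment K \<psi> D 3 j i"
  unfolding ens_moment_def cnj_tensor_pow_3[symmetric, of D _ j i] by simp

lemma qform_sum: "qform D (\<lambda>i j. \<Sum>k\<in>S. A k i j) v = (\<Sum>k\<in>S. qform D (A k) v)"
proof -
  have "qform D (\<lambda>i j. \<Sum>k\<in>S. A k i j) v = (\<Sum>i<D. \<Sum>j<D. \<Sum>k\<in>S. cnj (v i) * A k i j * v j)"
    by (simp add: qform_def sum_distrib_left sum_distrib_right)
  also have "\<dots> = (\<Sum>i<D. \<Sum>k\<in>S. \<Sum>j<D. cnj (v i) * A k i j * v j)"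
    by (intro sum.cong refl sum.swap)
  also have "\<dots> = (\<Sum>k\<in>S. \<Sum>i<D. \<Sum>j<D. cnj (v i) * A k i j * v j)"
    by (rule sum.swap)
  finally show ?thesis by (simp add: qform_def)
qed

lemma qform_divide: "qform D (\<lambda>i j. A i j / c) v = qform D A v / c"
  by (simp add: qform_def sum_divide_distrib)

lemma qform_scale: "qform D (\<lambda>i j. c * A i j) v = c * qform D A v"
  by (simp add: qform_def sum_distrib_left mult_ac)

section \<open>The operator that represents the outcome statistics\<close>

text \<open>The divisor is 2^n and not the number 4^n of Pauli strings: it is the 1 / 2^n of the
  outcome probability, so that the trace against a pure third power is an expectation over
  outcomes.\<close>

definition test_mat :: "nat \<Rightarrow> cmat \<Rightarrow> cmat \<Rightarrow> cmat \<Rightarrow> cmat" where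
  "test_mat n \<rho> B C = (\<lambda>i j. (\<Sum>z<2 ^ n. \<Sum>x<2 ^ n.
     kron3 (2 ^ n) (twist n x z \<rho>) (twist n x z B) (twist n x z C) i j) / 2 ^ n)"

text \<open>The twirl acts on the first factor alone and turns rho into a multiple of the identity.
  N = D^2 serves the bound on \<open>test_mat\<close>, N = 1 the normalisation of the outcome
  probabilities.\<close>

lemma sum_qform_twist:
  assumes "mtrace (2 ^ n) \<rho> = 1"
  shows "(\<Sum>z<2 ^ n. \<Sum>x<2 ^ n. qform (2 ^ n * N) (kron N (twist n x z \<rho>) ident) v)
    = of_real (2 ^ n * sqnorm (2 ^ n * N) v)"
proof -
  have "(\<Sum>z<2 ^ n. \<Sum>x<2 ^ n. qform (2 ^ n * N) (kron N (twist n x z \<rho>) ident) v)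
      = qform (2 ^ n * N) (\<lambda>i j. \<Sum>z<2 ^ n. \<Sum>x<2 ^ n. kron N (twist n x z \<rho>) ident i j) v"
    by (simp only: qform_sum)
  also have "\<dots> = qform (2 ^ n * N) (\<lambda>i j. 2 ^ n * ident i j) v"
  proof (rule qform_cong)
    fix i j assume ij: "i < 2 ^ n * N" "j < 2 ^ n * N"
    have "(\<Sum>z<2 ^ n. \<Sum>x<2 ^ n. kron N (twist n x z \<rho>) ident i j)
        = (\<Sum>z<2 ^ n. \<Sum>x<2 ^ n. twist n x z \<rho> (i div N) (j div N)) * ident (i mod N) (j mod N)"
      by (simp only: kron_def sum_distrib_right)
    also have "\<dots> = 2 ^ n * ident i j"
      using assms sum_twist[OF less_mult_imp_div_less[OF ij(1)] less_mult_imp_div_less[OF ij(2)], of \<rho>]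
      by (auto simp: ident_def) (metis div_mult_mod_eq)
    finally show "(\<Sum>z<2 ^ n. \<Sum>x<2 ^ n. kron N (twist n x z \<rho>) ident i j) = 2 ^ n * ident i j" .
  qed
  finally show ?thesis by (simp add: qform_scale qform_ident)
qed

lemma sum_qform_conj_pauli:
  assumes "mtrace (2 ^ n) \<rho> = 1"
  shows "(\<Sum>z<2 ^ n. \<Sum>x<2 ^ n. qform (2 ^ n) \<rho> (conj_pauli n x z v)) = of_real (2 ^ n * sqnorm (2 ^ n) v)"
proof -
  have "qform (2 ^ n) \<rho> (conj_pauli n x z v) = qform (2 ^ n) (kron 1 (twist n x z \<rho>) ident) v"
    if "x < 2 ^ n" for x z
    unfolding qform_conj_pauli[OF that] by (intro qform_cong) (simp add: kron_def ident_def)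
  then show ?thesis using sum_qform_twist[OF assms, of 1 v] by simp
qed

text \<open>For each string the summand is bounded by b c times the form of the twisted rho tensored
  with the identity. These forms are added up before being estimated; by the twirl their sum is 2^n
  times the squared norm, which cancels the divisor.\<close>

lemma test_mat_bound:
  assumes \<rho>: "density_op (2 ^ n) \<rho>" and B: "hermitian (2 ^ n) B" and C: "hermitian (2 ^ n) C"
    and b: "\<And>v. cmod (qform (2 ^ n) B v) \<le> b * sqnorm (2 ^ n) v" "b \<ge> 0"
    and c: "\<And>v. cmod (qform (2 ^ n) C v) \<le> c * sqnorm (2 ^ n) v"
  shows "cmod (qform ((2 ^ n) ^ 3) (test_mat n \<rho> B C) v) \<le> b * c * sqnorm ((2 ^ n) ^ 3) v"
proof -
  define D :: nat where "D = 2 ^ n"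
  have D3: "D ^ 3 = D * D ^ 2" and D2: "D ^ 2 = D * D" by (simp_all add: power3_eq_cube power2_eq_square)
  have one: "cmod (qform (D ^ 3) (kron3 D (twist n x z \<rho>) (twist n x z B) (twist n x z C)) v)
      \<le> b * c * Re (qform (D * D ^ 2) (kron (D ^ 2) (twist n x z \<rho>) ident) v)" if "x < D" for x z
    unfolding D3 kron3_def
  proof (rule qform_kron_bound)
    have x: "x < 2 ^ n" using that by (simp add: D_def)
    show "psd D (twist n x z \<rho>)" unfolding D_def using psd_twist x \<rho> by (simp add: density_op_def)
    have hB: "hermitian D (twist n x z B)" unfolding D_def by (rule hermitian_twist[OF B x])
    have hC: "hermitian D (twist n x z C)" unfolding D_def by (rule hermitian_twist[OF C x])
    show "hermitian (D ^ 2) (kron D (twist n x z B) (twist n x z C))"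
      unfolding D2 by (rule hermitian_kron[OF hB hC])
    show "cmod (qform (D ^ 2) (kron D (twist n x z B) (twist n x z C)) v) \<le> b * c * sqnorm (D ^ 2) v" for v
      unfolding D2
      by (rule qform_kron_hermitian_bound[OF hB hC b(2)])
        (use twist_bound[OF b(1) x] twist_bound[OF c x] in \<open>auto simp: D_def\<close>)
  qed
  have "cmod (qform (D ^ 3) (test_mat n \<rho> B C) v)
      = cmod (\<Sum>z<D. \<Sum>x<D. qform (D ^ 3) (kron3 D (twist n x z \<rho>) (twist n x z B) (twist n x z C)) v) / D"
    unfolding test_mat_def qform_divide qform_sum by (simp add: norm_divide norm_power D_def)
  also have "\<dots> \<le> (\<Sum>z<D. \<Sum>x<D. cmod (qform (D ^ 3) (kron3 D (twist n x z \<rho>) (twist n x z B) (twist n x z C)) v)) / D"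
    by (intro divide_right_mono order.trans[OF norm_sum] sum_mono norm_sum) simp_all
  also have "\<dots> \<le> (\<Sum>z<D. \<Sum>x<D. b * c * Re (qform (D * D ^ 2) (kron (D ^ 2) (twist n x z \<rho>) ident) v)) / D"
    by (intro divide_right_mono sum_mono one) auto
  also have "\<dots> = b * c * Re (\<Sum>z<D. \<Sum>x<D. qform (D * D ^ 2) (kron (D ^ 2) (twist n x z \<rho>) ident) v) / D"
    by (simp add: sum_distrib_left)
  also have "(\<Sum>z<D. \<Sum>x<D. qform (D * D ^ 2) (kron (D ^ 2) (twist n x z \<rho>) ident) v)
      = of_real (D * sqnorm (D * D ^ 2) v)"
    unfolding D_def using \<rho> by (subst sum_qform_twist) (auto simp: density_op_def)
  also have "b * c * Re (of_real (D * sqnorm (D * D ^ 2) v)) / D = b * c * sqnorm (D ^ 3) v"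
    by (simp add: D_def D3[unfolded D_def])
  finally show ?thesis by (simp add: D_def)
qed

lemma sum2_swap_out:
  fixes f :: "nat \<Rightarrow> nat \<Rightarrow> nat \<Rightarrow> nat \<Rightarrow> complex"
  shows "(\<Sum>i<N. \<Sum>j<N. (\<Sum>z<M. \<Sum>x<M. f z x i j) / c * g i j)
    = (\<Sum>z<M. \<Sum>x<M. (\<Sum>i<N. \<Sum>j<N. f z x i j * g i j)) / c"
proof -
  have "(\<Sum>i<N. \<Sum>j<N. (\<Sum>z<M. \<Sum>x<M. f z x i j) / c * g i j)
      = (\<Sum>p\<in>{..<N} \<times> {..<N}. \<Sum>q\<in>{..<M} \<times> {..<M}. f (fst q) (snd q) (fst p) (snd p) / c * g (fst p) (snd p))"
    by (simp add: sum.cartesian_product' sum_distrib_right sum_divide_distrib)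
  also have "\<dots> = (\<Sum>q\<in>{..<M} \<times> {..<M}. \<Sum>p\<in>{..<N} \<times> {..<N}. f (fst q) (snd q) (fst p) (snd p) / c * g (fst p) (snd p))"
    by (rule sum.swap)
  also have "\<dots> = (\<Sum>z<M. \<Sum>x<M. (\<Sum>i<N. \<Sum>j<N. f z x i j * g i j)) / c"
    by (simp add: sum.cartesian_product' sum_divide_distrib)
  finally show ?thesis .
qed

definition outcome_mean :: "nat \<Rightarrow> cmat \<Rightarrow> cmat \<Rightarrow> cmat \<Rightarrow> cvec \<Rightarrow> real" where
  "outcome_mean n \<rho> B C \<zeta> = (\<Sum>z<2 ^ n. \<Sum>x<2 ^ n. outcome_prob n \<rho> \<zeta> z x
     * (Re (qform (2 ^ n) B (conj_pauli n x z \<zeta>)) * Re (qform (2 ^ n) C (conj_pauli n x z \<zeta>))))"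

lemma test_mat_pure:
  assumes "hermitian (2 ^ n) \<rho>" "hermitian (2 ^ n) B" "hermitian (2 ^ n) C"
  shows "(\<Sum>i<(2 ^ n) ^ 3. \<Sum>j<(2 ^ n) ^ 3. test_mat n \<rho> B C i j * tensor_pow (2 ^ n) 3 (outer \<zeta> \<zeta>) j i)
    = of_real (outcome_mean n \<rho> B C \<zeta>)"
proof -
  have "(\<Sum>i<(2 ^ n) ^ 3. \<Sum>j<(2 ^ n) ^ 3. test_mat n \<rho> B C i j * tensor_pow (2 ^ n) 3 (outer \<zeta> \<zeta>) j i)
      = (\<Sum>z<2 ^ n. \<Sum>x<2 ^ n. qform (2 ^ n) (twist n x z \<rho>) \<zeta> * qform (2 ^ n) (twist n x z B) \<zeta>
          * qform (2 ^ n) (twist n x z C) \<zeta>) / 2 ^ n"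
    unfolding test_mat_def sum2_swap_out sum2_kron3_mono3 ..
  also have "\<dots> = (\<Sum>z<2 ^ n. \<Sum>x<2 ^ n. of_real (outcome_prob n \<rho> \<zeta> z x
     * (Re (qform (2 ^ n) B (conj_pauli n x z \<zeta>)) * Re (qform (2 ^ n) C (conj_pauli n x z \<zeta>)))))"
    unfolding sum_divide_distrib
  proof (intro sum.cong refl)
    fix z x :: nat assume "x \<in> {..<2 ^ n}"
    then have x: "x < 2 ^ n" by simp
    show "qform (2 ^ n) (twist n x z \<rho>) \<zeta> * qform (2 ^ n) (twist n x z B) \<zeta>
          * qform (2 ^ n) (twist n x z C) \<zeta> / 2 ^ n = of_real (outcome_prob n \<rho> \<zeta> z x
     * (Re (qform (2 ^ n) B (conj_pauli n x z \<zeta>)) * Re (qform (2 ^ n) C (conj_pauli n x z \<zeta>))))"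
      unfolding qform_conj_pauli[OF x, symmetric] outcome_prob_eq[OF x]
      by (subst (1 2 3) hermitian_qform_real) (simp_all add: assms)
  qed
  finally show ?thesis by (simp add: outcome_mean_def)
qed

text \<open>Twisting preserves traces, so all 4^n strings contribute the same value; the factors
  inside the traces stand in reversed order because of the transpose.\<close>

lemma test_mat_haar:
  "(\<Sum>i<(2 ^ n) ^ 3. \<Sum>j<(2 ^ n) ^ 3. test_mat n \<rho> B C i j * haar_moment (2 ^ n) 3 j i)
    = (let D = 2 ^ n; tr = mtrace D in
       (tr \<rho> * tr B * tr C + tr \<rho> * tr (mmul D C B) + tr (mmul D B \<rho>) * tr C
        + tr (mmul D C (mmul D B \<rho>)) + tr (mmul D B (mmul D C \<rho>)) + tr (mmul D C \<rho>) * tr B)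
       / of_real ((2 ^ n + 1) * (2 ^ n + 2)))" (is "?lhs = (let D = 2 ^ n; tr = mtrace D in ?v D tr / _)")
proof -
  define D :: nat where "D = 2 ^ n"
  define V where "V = ?v D (mtrace D)"
  define \<kappa> where "\<kappa> = complex_of_real (real D * (D + 1) * (D + 2))"
  have D0: "D > 0" by (simp add: D_def)
  have "?lhs = (\<Sum>z<D. \<Sum>x<D. \<Sum>i<D ^ 3. \<Sum>j<D ^ 3.
      kron3 D (twist n x z \<rho>) (twist n x z B) (twist n x z C) i j * haar_moment D 3 j i) / D"
    unfolding test_mat_def sum2_swap_out D_def by simp
  also have "\<dots> = (\<Sum>z<D. \<Sum>x<D. V / \<kappa>) / D"
  proof (intro arg_cong2[where f = "(/)"] sum.cong refl)
    fix z x assume "x \<in> {..<D}"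
    then have x: "x < 2 ^ n" by (simp add: D_def)
    have "(\<Sum>i<D ^ 3. \<Sum>j<D ^ 3.
        kron3 D (twist n x z \<rho>) (twist n x z B) (twist n x z C) i j * haar_moment D 3 j i)
      = (\<Sum>i<D ^ 3. \<Sum>j<D ^ 3. kron3 D (twist n x z \<rho>) (twist n x z B) (twist n x z C) i j
          * (sym3 (j div D ^ 2) (j mod D ^ 2 div D) (j mod D ^ 2 mod D)
              (i div D ^ 2) (i mod D ^ 2 div D) (i mod D ^ 2 mod D))) / \<kappa>"
      unfolding sum_divide_distrib \<kappa>_def by (intro sum.cong refl) (simp add: haar_moment_3)
    also have "\<dots> = V / \<kappa>"
      unfolding sum2_kron3 sym3_contract V_def D_def
      by (simp only: mtrace_twist[OF x] mmul_twist[OF x])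
    finally show "(\<Sum>i<D ^ 3. \<Sum>j<D ^ 3.
        kron3 D (twist n x z \<rho>) (twist n x z B) (twist n x z C) i j * haar_moment D 3 j i) = V / \<kappa>" .
  qed
  \<comment> \<open>4^n equal terms divided by 2^n leave one factor D, which cancels the D in D (D +
    1) (D + 2).\<close>
  also have "\<dots> = of_nat D * V / \<kappa>" using D0 by simp
  also have "\<dots> = V / of_real ((real D + 1) * (real D + 2))"
    unfolding \<kappa>_def of_real_mult using D0 by (simp only: mult.assoc of_real_of_nat_eq) (simp add: add.commute)
  finally show ?thesis by (simp add: V_def D_def Let_def)
qed

section \<open>Mean and variance of the shadow\<close>

lemma spectral_mvmul:
  assumes s: "spectral D A e l" and "k < D" "i < D"
  shows "mvmul D A (e k) i = of_real (l k) * e k i"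
proof -
  have "mvmul D A (e k) i = (\<Sum>j<D. \<Sum>m<D. of_real (l m) * e m i * (cnj (e m j) * e k j))"
    unfolding mvmul_def using assms(3)
    by (intro sum.cong refl) (simp add: spectral_decomp[OF s] sum_distrib_right sum_distrib_left mult_ac)
  also have "\<dots> = (\<Sum>m<D. of_real (l m) * e m i * cinner D (e m) (e k))"
    unfolding cinner_def sum_distrib_left by (rule sum.swap)
  also have "\<dots> = (\<Sum>m<D. if m = k then of_real (l m) * e m i else 0)"
    using assms(2) by (intro sum.cong refl) (simp add: spectral_orthonormal[OF s])
  finally show ?thesis using assms(2) by simp
qed

lemma vnorm_eq_sqrt: "vnorm D v = sqrt (sqnorm D v)"
  by (simp add: vnorm_def sqnorm_def)

text \<open>The supremum in \<open>op_norm\<close> is informative only if the set is bounded.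
  Entries of a unit vector have modulus at most 1, so the row sums of |A i j| give a crude
  bound.\<close>

lemma bdd_above_op_norm: "bdd_above {vnorm D (mvmul D A v) | v. vnorm D v = 1}"
proof (rule bdd_aboveI)
  fix y assume "y \<in> {vnorm D (mvmul D A v) | v. vnorm D v = 1}"
  then obtain v where y: "y = vnorm D (mvmul D A v)" and "vnorm D v = 1" by auto
  then have v: "sqnorm D v = 1" by (simp add: vnorm_eq_sqrt)
  have "cmod (v j) \<le> 1" if "j < D" for j
    using cmod_sq_le_sqnorm[OF that, of v] v by (simp add: power_le_one_iff abs_square_le_1)
  then have "cmod (mvmul D A v i) \<le> (\<Sum>j<D. cmod (A i j))" for i
    unfolding mvmul_def
    by (intro order.trans[OF norm_sum] sum_mono) (simp add: norm_mult mult_left_le)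
  then show "y \<le> sqrt (\<Sum>i<D. (\<Sum>j<D. cmod (A i j))\<^sup>2)"
    unfolding y vnorm_def by (intro real_sqrt_le_mono sum_mono power_mono) auto
qed

lemma eigenvalue_le_op_norm:
  assumes s: "spectral D A e l" and "k < D"
  shows "\<bar>l k\<bar> \<le> op_norm D A"
proof -
  have "sqnorm D (mvmul D A (e k)) = (l k)\<^sup>2 * sqnorm D (e k)"
    unfolding sqnorm_def sum_distrib_left
    by (intro sum.cong refl) (simp add: spectral_mvmul[OF s \<open>k < D\<close>] norm_mult power_mult_distrib)
  then have "vnorm D (mvmul D A (e k)) = \<bar>l k\<bar>"
    using spectral_unit[OF assms] by (simp add: vnorm_eq_sqrt)
  moreover have "vnorm D (e k) = 1" using spectral_unit[OF assms] by (simp add: vnorm_eq_sqrt)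
  ultimately show ?thesis
    unfolding op_norm_def by (intro cSup_upper bdd_above_op_norm) (auto intro: exI[of _ "e k"])
qed

lemma mtrace_spectral:
  assumes s: "spectral D A e l"
  shows "mtrace D A = of_real (\<Sum>k<D. l k)"
proof -
  have "mtrace D A = (\<Sum>i<D. \<Sum>j<D. ident i j * A j i)"
    unfolding mtrace_def ident_def by (intro sum.cong refl) (simp add: if_distrib[of "\<lambda>x. x * _"] cong: if_cong)
  also have "\<dots> = (\<Sum>k<D. of_real (l k))"
    unfolding sum2_spectral[OF s] by (intro sum.cong refl) (simp add: qform_ident spectral_unit[OF s])
  finally show ?thesis by simp
qed

text \<open>For the third claim, the eigenvalues and hence their mean lie in [0, c], so the forms of
  A and of its scalar part both lie between 0 and c |v|^2 and differ by at most that. For an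
  indefinite matrix, removing the trace can increase the norm.\<close>

lemma psd_op_norm:
  assumes "psd D A" "D > 0"
  shows "0 \<le> op_norm D A" "cmod (qform D A v) \<le> op_norm D A * sqnorm D v"
    "cmod (qform D (\<lambda>i j. A i j - mtrace D A / of_nat D * ident i j) v) \<le> op_norm D A * sqnorm D v"
proof -
  have herm: "hermitian D A" using assms(1) by (simp add: psd_def)
  obtain e l where s: "spectral D A e l" using hermitian_spectral[OF herm] .
  have l: "0 \<le> l k" "l k \<le> op_norm D A" if "k < D" for k
    using eigenvalue_le_op_norm[OF s that] assms(1) spectral_eigenvalue[OF s that]
    by (auto simp: psd_qform) (metis Re_complex_of_real)
  show "0 \<le> op_norm D A" using l[OF assms(2)] by linarith
  define q where "q = (\<Sum>k<D. l k * (cmod (cinner D (e k) v))\<^sup>2)"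
  have q: "qform D A v = of_real q" unfolding q_def by (rule spectral_qform[OF s])
  have "0 \<le> q" unfolding q_def using l by (intro sum_nonneg mult_nonneg_nonneg) auto
  have "q \<le> (\<Sum>k<D. op_norm D A * (cmod (cinner D (e k) v))\<^sup>2)"
    unfolding q_def using l by (intro sum_mono mult_right_mono) auto
  then have qle: "q \<le> op_norm D A * sqnorm D v"
    by (simp add: spectral_parseval[OF s] flip: sum_distrib_left)
  show "cmod (qform D A v) \<le> op_norm D A * sqnorm D v" using q qle \<open>0 \<le> q\<close> by simp
  define t where "t = (\<Sum>k<D. l k) / D"
  have t: "0 \<le> t" unfolding t_def using l by (intro divide_nonneg_nonneg sum_nonneg) auto
  have "(\<Sum>k<D. l k) \<le> (\<Sum>k<D. op_norm D A)" using l by (intro sum_mono) auto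
  then have "t \<le> op_norm D A" unfolding t_def using assms(2) by (simp add: field_simps)
  then have "0 \<le> t * sqnorm D v" "t * sqnorm D v \<le> op_norm D A * sqnorm D v"
    using t by (auto intro: mult_right_mono)
  then have "\<bar>q - t * sqnorm D v\<bar> \<le> op_norm D A * sqnorm D v" using qle \<open>0 \<le> q\<close> by linarith
  moreover have "qform D (\<lambda>i j. A i j - mtrace D A / of_nat D * ident i j) v = of_real (q - t * sqnorm D v)"
  proof -
    have "qform D (\<lambda>i j. A i j - mtrace D A / of_nat D * ident i j) v
        = qform D A v - mtrace D A / of_nat D * qform D ident v"
      unfolding qform_def sum_distrib_left sum_subtractf[symmetric]
      by (intro sum.cong refl) (simp add: algebra_simps)
    then show ?thesis by (simp add: q qform_ident mtrace_spectral[OF s] t_def)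
  qed
  ultimately show "cmod (qform D (\<lambda>i j. A i j - mtrace D A / of_nat D * ident i j) v)
      \<le> op_norm D A * sqnorm D v"
    by (simp only: norm_of_real)
qed

lemma mmul_ident_left: "i < D \<Longrightarrow> mmul D ident A i j = A i j"
  by (simp add: mmul_def ident_def if_distrib[of "\<lambda>x. x * _"] cong: if_cong)

lemma mmul_assoc: "mmul D A (mmul D B C) = mmul D (mmul D A B) C"
proof (intro ext)
  fix i j
  have "mmul D A (mmul D B C) i j = (\<Sum>k<D. \<Sum>m<D. A i k * B k m * C m j)"
    by (simp add: mmul_def sum_distrib_left mult.assoc)
  also have "\<dots> = (\<Sum>m<D. \<Sum>k<D. A i k * B k m * C m j)" by (rule sum.swap)
  finally show "mmul D A (mmul D B C) i j = mmul D (mmul D A B) C i j"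
    by (simp add: mmul_def sum_distrib_right)
qed

text \<open>In the eigenbasis of B the diagonal entries of rho are nonnegative with sum 1, so tr(B^2
  rho) is a convex combination of the squared eigenvalues, while tr(B^2) is their sum.\<close>

lemma trace_square_times_density:
  assumes B: "hermitian D B" and \<rho>: "density_op D \<rho>"
  shows "Re (mtrace D (mmul D B (mmul D B \<rho>))) \<le> Re (mtrace D (mmul D B B))"
    and "0 \<le> Re (mtrace D (mmul D B B))"
proof -
  obtain e l where s: "spectral D B e l" using hermitian_spectral[OF B] .
  have BB: "mmul D B B i j = (\<Sum>k<D. of_real (l k * l k) * e k i * cnj (e k j))" if "i < D" "j < D" for i j
  proof -
    have "B i r = cnj (B r i)" if "r < D" for r
      using B \<open>i < D\<close> that unfolding hermitian_def by blast
    then have "mmul D B B i j = mmul D (adj B) B i j"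
      unfolding mmul_def adj_def by (intro sum.cong refl) (metis lessThan_iff)
    then show ?thesis using spectral_mmul_adj[OF s s that] by simp
  qed
  then have s2: "spectral D (mmul D B B) e (\<lambda>k. l k * l k)"
    using s unfolding spectral_def by simp
  have \<rho>k: "0 \<le> Re (qform D \<rho> (e k))" for k using \<rho> by (simp add: density_op_def psd_qform)
  have sum1: "(\<Sum>k<D. qform D \<rho> (e k)) = 1"
  proof -
    have "mtrace D \<rho> = (\<Sum>i<D. \<Sum>j<D. \<rho> i j * ident j i)"
      unfolding mtrace_def ident_def by (simp add: if_distrib cong: if_cong)
    also have "\<dots> = (\<Sum>k<D. qform D \<rho> (e k))"
      unfolding sum2_spectral[OF spectral_ident[OF s]] by simp
    finally show ?thesis using \<rho> by (simp add: density_op_def)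
  qed
  have le1: "Re (qform D \<rho> (e k)) \<le> 1" if "k < D" for k
  proof -
    have "Re (qform D \<rho> (e k)) \<le> (\<Sum>k<D. Re (qform D \<rho> (e k)))"
      using that \<rho>k by (intro member_le_sum) auto
    also have "\<dots> = 1" using sum1 by (metis Re_sum one_complex.sel(1))
    finally show ?thesis .
  qed
  have trBB: "mtrace D (mmul D B B) = of_real (\<Sum>k<D. l k * l k)" by (rule mtrace_spectral[OF s2])
  show "0 \<le> Re (mtrace D (mmul D B B))"
    unfolding trBB Re_complex_of_real by (intro sum_nonneg) simp
  have "mtrace D (mmul D B (mmul D B \<rho>)) = (\<Sum>i<D. \<Sum>j<D. \<rho> i j * mmul D B B j i)"
    unfolding mmul_assoc[of D B B \<rho>] by (subst mtrace_mmul_commute) (rule mtrace_mmul)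
  also have "\<dots> = (\<Sum>k<D. of_real (l k * l k) * qform D \<rho> (e k))" by (rule sum2_spectral[OF s2])
  finally have "Re (mtrace D (mmul D B (mmul D B \<rho>))) = (\<Sum>k<D. (l k * l k) * Re (qform D \<rho> (e k)))"
    by simp
  also have "\<dots> \<le> (\<Sum>k<D. (l k * l k) * 1)"
    using le1 by (intro sum_mono mult_left_mono) auto
  finally show "Re (mtrace D (mmul D B (mmul D B \<rho>))) \<le> Re (mtrace D (mmul D B B))"
    by (simp only: trBB Re_complex_of_real mult_1_right)
qed

lemma trace_norm_nonneg: "hermitian D A \<Longrightarrow> 0 \<le> trace_norm D A"
  using hermitian_spectral[of D A] trace_norm_spectral by (metis abs_ge_zero sum_nonneg)

section \<open>Expectations over the ensemble and their deviation from the Haar values\<close>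

locale design_shadow = prob_space K for K :: "'k measure" +
  fixes n :: nat and \<psi> :: "'k \<Rightarrow> cvec" and \<epsilon> :: real and \<rho> :: cmat
  assumes unit: "k \<in> space K \<Longrightarrow> sqnorm (2 ^ n) (\<psi> k) = 1"
    and meas [measurable]: "(\<lambda>k. \<psi> k j) \<in> borel_measurable K"
    and design: "approx_state_design n K \<psi> 3 \<epsilon>"
    and dens: "density_op (2 ^ n) \<rho>"
begin

lemma hermitian_rho: "hermitian (2 ^ n) \<rho>" and mtrace_rho: "mtrace (2 ^ n) \<rho> = 1"
  using dens by (auto simp: density_op_def psd_def)

lemma hermitian_error: "hermitian N (\<lambda>i j. haar_moment D 3 i j - ens_moment K \<psi> D 3 i j)"
  by (simp add: hermitian_def cnj_haar_moment_3 cnj_ens_moment_3)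

text \<open>Inherited from the trace norm that epsilon dominates; it allows the variance bound to
  enlarge the coefficient of epsilon.\<close>

lemma eps_nonneg: "0 \<le> \<epsilon>"
  using design trace_norm_nonneg[OF hermitian_error] unfolding approx_state_design_def
  by (rule order.trans[rotated])

lemma integrable_tensor:
  assumes "i < (2 ^ n) ^ 3" "j < (2 ^ n) ^ 3"
  shows "integrable K (\<lambda>k. tensor_pow (2 ^ n) 3 (outer (\<psi> k) (\<psi> k)) i j)"
  unfolding tensor_pow_3_outer
proof (rule integrable_const_bound[where B = 1])
  show "AE k in K. norm (mono3 (i div (2 ^ n)\<^sup>2) (i mod (2 ^ n)\<^sup>2 div 2 ^ n) (i mod (2 ^ n)\<^sup>2 mod 2 ^ n)
      (j div (2 ^ n)\<^sup>2) (j mod (2 ^ n)\<^sup>2 div 2 ^ n) (j mod (2 ^ n)\<^sup>2 mod 2 ^ n) (\<psi> k)) \<le> 1"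
  proof (rule AE_I2)
    fix k assume "k \<in> space K"
    then show "norm (mono3 (i div (2 ^ n)\<^sup>2) (i mod (2 ^ n)\<^sup>2 div 2 ^ n) (i mod (2 ^ n)\<^sup>2 mod 2 ^ n)
      (j div (2 ^ n)\<^sup>2) (j mod (2 ^ n)\<^sup>2 div 2 ^ n) (j mod (2 ^ n)\<^sup>2 mod 2 ^ n) (\<psi> k)) \<le> 1"
      using cmod_mono3_le[OF digits_less[OF assms(1)] digits_less[OF assms(2)], of "\<psi> k"] unit by simp
  qed
qed (simp add: mono3_def)

text \<open>The outcome mean is a finite linear combination of bounded tensor entries, which gives
  integrability and lets the expectation over k pass inside the trace.\<close>

lemma outcome_mean_ens:
  assumes "hermitian (2 ^ n) B" "hermitian (2 ^ n) C"
  shows integrable_outcome_mean: "integrable K (\<lambda>k. outcome_mean n \<rho> B C (\<psi> k))"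
    and test_mat_ens: "(\<Sum>i<(2 ^ n) ^ 3. \<Sum>j<(2 ^ n) ^ 3. test_mat n \<rho> B C i j * ens_moment K \<psi> (2 ^ n) 3 j i)
      = of_real (\<integral>k. outcome_mean n \<rho> B C (\<psi> k) \<partial>K)"
proof -
  define F where "F k = (\<Sum>i<(2 ^ n) ^ 3. \<Sum>j<(2 ^ n) ^ 3.
      test_mat n \<rho> B C i j * tensor_pow (2 ^ n) 3 (outer (\<psi> k) (\<psi> k)) j i)" for k
  have F: "F k = of_real (outcome_mean n \<rho> B C (\<psi> k))" for k
    unfolding F_def by (rule test_mat_pure[OF hermitian_rho assms])
  have "integrable K F"
    unfolding F_def by (intro Bochner_Integration.integrable_sum integrable_mult_right integrable_tensor) auto
  then have "integrable K (\<lambda>k. Re (F k))" by (rule integrable_bounded_linear[OF bounded_linear_Re])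
  then show "integrable K (\<lambda>k. outcome_mean n \<rho> B C (\<psi> k))" by (simp add: F)
  have "(\<integral>k. F k \<partial>K) = (\<Sum>i<(2 ^ n) ^ 3. \<integral>k. (\<Sum>j<(2 ^ n) ^ 3.
      test_mat n \<rho> B C i j * tensor_pow (2 ^ n) 3 (outer (\<psi> k) (\<psi> k)) j i) \<partial>K)"
    unfolding F_def
    by (intro Bochner_Integration.integral_sum Bochner_Integration.integrable_sum integrable_mult_right integrable_tensor) auto
  also have "\<dots> = (\<Sum>i<(2 ^ n) ^ 3. \<Sum>j<(2 ^ n) ^ 3. \<integral>k.
      test_mat n \<rho> B C i j * tensor_pow (2 ^ n) 3 (outer (\<psi> k) (\<psi> k)) j i \<partial>K)"
    by (intro sum.cong refl Bochner_Integration.integral_sum integrable_mult_right integrable_tensor) auto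
  also have "\<dots> = (\<Sum>i<(2 ^ n) ^ 3. \<Sum>j<(2 ^ n) ^ 3. test_mat n \<rho> B C i j * ens_moment K \<psi> (2 ^ n) 3 j i)"
    by (simp only: integral_mult_right_zero ens_moment_def)
  finally show "(\<Sum>i<(2 ^ n) ^ 3. \<Sum>j<(2 ^ n) ^ 3. test_mat n \<rho> B C i j * ens_moment K \<psi> (2 ^ n) 3 j i)
      = of_real (\<integral>k. outcome_mean n \<rho> B C (\<psi> k) \<partial>K)"
    by (simp only: F integral_complex_of_real)
qed

lemma outcome_mean_error:
  assumes B: "hermitian (2 ^ n) B" "\<And>v. cmod (qform (2 ^ n) B v) \<le> b * sqnorm (2 ^ n) v" "b \<ge> 0"
    and C: "hermitian (2 ^ n) C" "\<And>v. cmod (qform (2 ^ n) C v) \<le> c * sqnorm (2 ^ n) v" "c \<ge> 0"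
  shows "\<bar>Re (\<Sum>i<(2 ^ n) ^ 3. \<Sum>j<(2 ^ n) ^ 3. test_mat n \<rho> B C i j * haar_moment (2 ^ n) 3 j i)
      - (\<integral>k. outcome_mean n \<rho> B C (\<psi> k) \<partial>K)\<bar> \<le> b * c * \<epsilon>"
proof -
  define T where "T = test_mat n \<rho> B C"
  have "\<bar>Re (\<Sum>i<(2 ^ n) ^ 3. \<Sum>j<(2 ^ n) ^ 3. T i j * haar_moment (2 ^ n) 3 j i)
      - (\<integral>k. outcome_mean n \<rho> B C (\<psi> k) \<partial>K)\<bar>
    = \<bar>Re ((\<Sum>i<(2 ^ n) ^ 3. \<Sum>j<(2 ^ n) ^ 3. T i j * haar_moment (2 ^ n) 3 j i)
      - (\<Sum>i<(2 ^ n) ^ 3. \<Sum>j<(2 ^ n) ^ 3. T i j * ens_moment K \<psi> (2 ^ n) 3 j i))\<bar>"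
    unfolding T_def test_mat_ens[OF B(1) C(1)] by simp
  also have "\<dots> \<le> cmod ((\<Sum>i<(2 ^ n) ^ 3. \<Sum>j<(2 ^ n) ^ 3. T i j * haar_moment (2 ^ n) 3 j i)
      - (\<Sum>i<(2 ^ n) ^ 3. \<Sum>j<(2 ^ n) ^ 3. T i j * ens_moment K \<psi> (2 ^ n) 3 j i))"
    by (rule abs_Re_le_cmod)
  also have "\<dots> = cmod (\<Sum>i<(2 ^ n) ^ 3. \<Sum>j<(2 ^ n) ^ 3.
      T i j * (haar_moment (2 ^ n) 3 j i - ens_moment K \<psi> (2 ^ n) 3 j i))"
    by (simp only: right_diff_distrib sum_subtractf)
  also have "\<dots> \<le> b * c * trace_norm ((2 ^ n) ^ 3) (\<lambda>i j. haar_moment (2 ^ n) 3 i j - ens_moment K \<psi> (2 ^ n) 3 i j)"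
    unfolding T_def
    by (intro trace_norm_duality[OF hermitian_error] test_mat_bound dens B C)
  also have "\<dots> \<le> b * c * \<epsilon>"
    using design B(3) C(3) unfolding approx_state_design_def by (intro mult_left_mono) auto
  finally show ?thesis unfolding T_def .
qed

lemma sum_outcome_prob:
  assumes "sqnorm (2 ^ n) \<zeta> = 1"
  shows "(\<Sum>z<2 ^ n. \<Sum>x<2 ^ n. outcome_prob n \<rho> \<zeta> z x) = 1"
proof -
  have "(\<Sum>z<2 ^ n. \<Sum>x<2 ^ n. outcome_prob n \<rho> \<zeta> z x)
      = Re (\<Sum>z<2 ^ n. \<Sum>x<2 ^ n. qform (2 ^ n) \<rho> (conj_pauli n x z \<zeta>)) / 2 ^ n"
    by (simp add: outcome_prob_eq sum_divide_distrib)
  then show ?thesis using assms by (simp add: sum_qform_conj_pauli[OF mtrace_rho])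
qed

lemma Re_qform_ident_conj_pauli:
  "sqnorm (2 ^ n) \<zeta> = 1 \<Longrightarrow> x < 2 ^ n \<Longrightarrow> Re (qform (2 ^ n) ident (conj_pauli n x z \<zeta>)) = 1"
  by (simp add: qform_ident sqnorm_conj_pauli)

text \<open>An affine form is needed because the outcome value is affine in the quadratic form, with
  different constants for the observable and for its traceless part. The slot \<open>ident\<close>
  contributes 1 on unit vectors, and b passes through as the probabilities sum to 1.\<close>

lemma cond_mean:
  assumes "sqnorm (2 ^ n) \<zeta> = 1"
  shows "(\<Sum>z<2 ^ n. \<Sum>x<2 ^ n. outcome_prob n \<rho> \<zeta> z x * (a * Re (qform (2 ^ n) B (conj_pauli n x z \<zeta>)) + b))
    = a * outcome_mean n \<rho> B ident \<zeta> + b"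
proof -
  have "(\<Sum>z<2 ^ n. \<Sum>x<2 ^ n. outcome_prob n \<rho> \<zeta> z x * (a * Re (qform (2 ^ n) B (conj_pauli n x z \<zeta>)) + b))
      = a * outcome_mean n \<rho> B ident \<zeta> + b * (\<Sum>z<2 ^ n. \<Sum>x<2 ^ n. outcome_prob n \<rho> \<zeta> z x)"
    unfolding outcome_mean_def sum_distrib_left sum.distrib[symmetric]
    by (intro sum.cong refl) (simp add: Re_qform_ident_conj_pauli[OF assms] algebra_simps)
  then show ?thesis by (simp add: sum_outcome_prob[OF assms])
qed

lemma cond_square:
  assumes "sqnorm (2 ^ n) \<zeta> = 1"
  shows "(\<Sum>z<2 ^ n. \<Sum>x<2 ^ n. outcome_prob n \<rho> \<zeta> z x * (a * Re (qform (2 ^ n) B (conj_pauli n x z \<zeta>)) + b)\<^sup>2)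
    = a\<^sup>2 * outcome_mean n \<rho> B B \<zeta> + (2 * a * b * outcome_mean n \<rho> B ident \<zeta> + b\<^sup>2)"
proof -
  have "(\<Sum>z<2 ^ n. \<Sum>x<2 ^ n. outcome_prob n \<rho> \<zeta> z x * (a * Re (qform (2 ^ n) B (conj_pauli n x z \<zeta>)) + b)\<^sup>2)
      = a\<^sup>2 * outcome_mean n \<rho> B B \<zeta> + (\<Sum>z<2 ^ n. \<Sum>x<2 ^ n. outcome_prob n \<rho> \<zeta> z x *
          (2 * a * b * Re (qform (2 ^ n) B (conj_pauli n x z \<zeta>)) + b\<^sup>2))"
    unfolding outcome_mean_def sum_distrib_left sum.distrib[symmetric]
    by (intro sum.cong refl) (simp add: power2_eq_square algebra_simps)
  then show ?thesis by (simp only: cond_mean[OF assms])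
qed

lemma hermitian_ident: "hermitian D ident"
  by (simp add: hermitian_def ident_def)

section \<open>Bias and variance\<close>

text \<open>For the Haar measure the estimator is unbiased: the mean of <w|O|w> is (tr O + tr(O
  rho)) / (D + 1), which the factor D + 1 and the subtraction of tr O in the shadow undo. The same
  factor multiplies the design error.\<close>

lemma shadow_mean_error:
  assumes Ob: "psd (2 ^ n) Ob"
  shows "\<bar>shadow_mean n K \<psi> \<rho> Ob - Re (mtrace (2 ^ n) (mmul (2 ^ n) Ob \<rho>))\<bar>
    \<le> (2 ^ n + 1) * \<epsilon> * op_norm (2 ^ n) Ob"
proof -
  define D :: real where "D = 2 ^ n"
  have D: "D > 0" by (simp add: D_def)
  define tO where "tO = mtrace (2 ^ n) Ob"
  define t where "t = mtrace (2 ^ n) (mmul (2 ^ n) Ob \<rho>)"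
  have herm: "hermitian (2 ^ n) Ob" using Ob by (simp add: psd_def)
  define I where "I = (\<integral>k. outcome_mean n \<rho> Ob ident (\<psi> k) \<partial>K)"
  have "shadow_mean n K \<psi> \<rho> Ob = (\<integral>k. (D + 1) * outcome_mean n \<rho> Ob ident (\<psi> k) + - Re tO \<partial>K)"
    unfolding shadow_mean_def
  proof (intro Bochner_Integration.integral_cong refl)
    fix k assume "k \<in> space K"
    from cond_mean[OF unit[OF this], of "D + 1" Ob "- Re tO"]
    show "(\<Sum>z<2 ^ n. \<Sum>x<2 ^ n. outcome_prob n \<rho> (\<psi> k) z x * shadow_val n Ob (\<psi> k) x z)
        = (D + 1) * outcome_mean n \<rho> Ob ident (\<psi> k) + - Re tO"
      by (simp add: shadow_val_eq D_def tO_def)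
  qed
  also have "\<dots> = (D + 1) * I - Re tO"
    using integrable_outcome_mean[OF herm hermitian_ident] by (simp add: I_def prob_space)
  finally have mean: "shadow_mean n K \<psi> \<rho> Ob = (D + 1) * I - Re tO" .
  have tid: "mtrace (2 ^ n) ident = of_real D" by (simp add: mtrace_def ident_def D_def)
  have idl: "mtrace (2 ^ n) (mmul (2 ^ n) ident A) = mtrace (2 ^ n) A" for A
    unfolding mtrace_def by (intro sum.cong refl) (simp add: mmul_ident_left)
  have idm: "mmul (2 ^ n) Ob (mmul (2 ^ n) ident \<rho>) = mmul (2 ^ n) Ob \<rho>"
    unfolding mmul_def[of "2 ^ n" Ob] by (intro ext sum.cong refl) (simp add: mmul_ident_left)
  have "(\<Sum>i<(2 ^ n) ^ 3. \<Sum>j<(2 ^ n) ^ 3. test_mat n \<rho> Ob ident i j * haar_moment (2 ^ n) 3 j i)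
      = (tO * of_real D + tO + t * of_real D + t + t + tO) / of_real ((D + 1) * (D + 2))"
    unfolding test_mat_haar Let_def idl idm tid mtrace_rho by (simp add: t_def tO_def D_def)
  \<comment> \<open>The six contractions group into D + 2 copies of tr O + tr(O rho), cancelling the
    D + 2 of the Haar constant.\<close>
  also have "\<dots> = ((tO + t) * of_real (D + 2)) / of_real ((D + 1) * (D + 2))"
    by (simp add: algebra_simps)
  also have "\<dots> = (tO + t) / of_real (D + 1)"
    unfolding of_real_mult using D by (subst mult_divide_mult_cancel_right) (auto simp flip: of_real_add)
  finally have "Re (\<Sum>i<(2 ^ n) ^ 3. \<Sum>j<(2 ^ n) ^ 3. test_mat n \<rho> Ob ident i j * haar_moment (2 ^ n) 3 j i)
      = (Re tO + Re t) / (D + 1)"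
    by (simp only: Re_divide_of_real plus_complex.sel)
  moreover have "\<bar>Re (\<Sum>i<(2 ^ n) ^ 3. \<Sum>j<(2 ^ n) ^ 3. test_mat n \<rho> Ob ident i j * haar_moment (2 ^ n) 3 j i) - I\<bar>
      \<le> op_norm (2 ^ n) Ob * 1 * \<epsilon>"
    unfolding I_def
    by (intro outcome_mean_error herm hermitian_ident psd_op_norm Ob) (simp_all add: qform_ident)
  ultimately have "\<bar>(Re tO + Re t) / (D + 1) - I\<bar> \<le> op_norm (2 ^ n) Ob * \<epsilon>" by simp
  then have "(D + 1) * \<bar>(Re tO + Re t) / (D + 1) - I\<bar> \<le> (D + 1) * (op_norm (2 ^ n) Ob * \<epsilon>)"
    using D by (intro mult_left_mono) auto
  moreover have "(D + 1) * \<bar>(Re tO + Re t) / (D + 1) - I\<bar> = \<bar>(D + 1) * ((Re tO + Re t) / (D + 1) - I)\<bar>"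
    using D by (simp add: abs_mult)
  moreover have "(D + 1) * ((Re tO + Re t) / (D + 1) - I) = Re t - shadow_mean n K \<psi> \<rho> Ob"
    unfolding mean using D by (simp add: right_diff_distrib)
  ultimately have "\<bar>Re t - shadow_mean n K \<psi> \<rho> Ob\<bar> \<le> (D + 1) * (op_norm (2 ^ n) Ob * \<epsilon>)" by simp
  then show ?thesis by (simp add: t_def D_def abs_minus_commute mult_ac)
qed

lemma shadow_var_bound:
  assumes Ob: "psd (2 ^ n) Ob"
  shows "shadow_var n K \<psi> \<rho> Ob
    \<le> 3 * Re (mtrace (2 ^ n) (mmul (2 ^ n) (traceless n Ob) (traceless n Ob)))
      + 3 * \<epsilon> * (op_norm (2 ^ n) Ob)\<^sup>2 * (2 ^ n + 1)\<^sup>2"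
proof -
  define D :: real where "D = 2 ^ n"
  have D: "D \<ge> 1" by (simp add: D_def)
  define B where "B = traceless n Ob"
  define c where "c = op_norm (2 ^ n) Ob"
  define \<tau> where "\<tau> = mtrace (2 ^ n) (mmul (2 ^ n) B B)"
  define \<tau>\<rho> where "\<tau>\<rho> = mtrace (2 ^ n) (mmul (2 ^ n) B (mmul (2 ^ n) B \<rho>))"
  have hermO: "hermitian (2 ^ n) Ob" using Ob by (simp add: psd_def)
  obtain e l where s: "spectral (2 ^ n) Ob e l" using hermitian_spectral[OF hermO] .
  \<comment> \<open>The mean eigenvalue tr O / D. Since (D + 1) t - D t = t, the outcome value
    becomes (D + 1) <w|B|w> + t.\<close>
  define t where "t = (\<Sum>k<2 ^ n. l k) / D"
  have trO: "mtrace (2 ^ n) Ob = of_real (D * t)"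
    using mtrace_spectral[OF s] by (simp add: t_def D_def)
  have B_eq: "B = (\<lambda>i j. Ob i j - of_real t * ident i j)"
    by (simp add: B_def traceless_def trO D_def)
  have hermB: "hermitian (2 ^ n) B"
    unfolding hermitian_def
  proof (intro allI impI)
    fix i j :: nat assume "i < 2 ^ n" "j < 2 ^ n"
    then have "Ob i j = cnj (Ob j i)" using hermO unfolding hermitian_def by blast
    then show "B i j = cnj (B j i)" by (simp add: B_eq ident_def)
  qed
  \<comment> \<open>Positivity of the observable is used here: its traceless part obeys the same
    bound c.\<close>
  have c: "c \<ge> 0" "cmod (qform (2 ^ n) B v) \<le> c * sqnorm (2 ^ n) v" for v
    using psd_op_norm(1)[OF Ob] psd_op_norm(3)[OF Ob, of v] by (auto simp: c_def B_def traceless_def)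
  have qO: "qform (2 ^ n) Ob v = qform (2 ^ n) B v + of_real (t * sqnorm (2 ^ n) v)" for v
  proof -
    have "qform (2 ^ n) B v = qform (2 ^ n) Ob v - of_real t * qform (2 ^ n) ident v"
      unfolding qform_def sum_distrib_left sum_subtractf[symmetric] B_eq
      by (intro sum.cong refl) (simp add: algebra_simps)
    then show ?thesis by (simp add: qform_ident)
  qed
  have val: "shadow_val n Ob \<zeta> x z = (D + 1) * Re (qform (2 ^ n) B (conj_pauli n x z \<zeta>)) + t"
    if "sqnorm (2 ^ n) \<zeta> = 1" "x < 2 ^ n" for \<zeta> x z
    using that by (simp add: shadow_val_eq qO sqnorm_conj_pauli trO D_def algebra_simps)
  define I1 where "I1 = (\<integral>k. outcome_mean n \<rho> B ident (\<psi> k) \<partial>K)"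
  define I2 where "I2 = (\<integral>k. outcome_mean n \<rho> B B (\<psi> k) \<partial>K)"
  note int1 = integrable_outcome_mean[OF hermB hermitian_ident]
  note int2 = integrable_outcome_mean[OF hermB hermB]
  have "shadow_mean n K \<psi> \<rho> Ob = (\<integral>k. (D + 1) * outcome_mean n \<rho> B ident (\<psi> k) + t \<partial>K)"
    unfolding shadow_mean_def
  proof (intro Bochner_Integration.integral_cong refl)
    fix k assume "k \<in> space K"
    note u = unit[OF this]
    show "(\<Sum>z<2 ^ n. \<Sum>x<2 ^ n. outcome_prob n \<rho> (\<psi> k) z x * shadow_val n Ob (\<psi> k) x z)
        = (D + 1) * outcome_mean n \<rho> B ident (\<psi> k) + t"
      unfolding cond_mean[OF u, symmetric] by (intro sum.cong refl) (simp add: val[OF u])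
  qed
  also have "\<dots> = (D + 1) * I1 + t" using int1 by (simp add: I1_def prob_space)
  finally have mean: "shadow_mean n K \<psi> \<rho> Ob = (D + 1) * I1 + t" .
  have "(\<integral>k. (\<Sum>z<2^n. \<Sum>x<2^n. outcome_prob n \<rho> (\<psi> k) z x * (shadow_val n Ob (\<psi> k) x z)\<^sup>2) \<partial>K)
      = (\<integral>k. (D + 1)\<^sup>2 * outcome_mean n \<rho> B B (\<psi> k)
          + (2 * (D + 1) * t * outcome_mean n \<rho> B ident (\<psi> k) + t\<^sup>2) \<partial>K)"
  proof (intro Bochner_Integration.integral_cong refl)
    fix k assume "k \<in> space K"
    note u = unit[OF this]
    show "(\<Sum>z<2^n. \<Sum>x<2^n. outcome_prob n \<rho> (\<psi> k) z x * (shadow_val n Ob (\<psi> k) x z)\<^sup>2)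
        = (D + 1)\<^sup>2 * outcome_mean n \<rho> B B (\<psi> k)
          + (2 * (D + 1) * t * outcome_mean n \<rho> B ident (\<psi> k) + t\<^sup>2)"
      unfolding cond_square[OF u, symmetric] by (intro sum.cong refl) (simp add: val[OF u])
  qed
  also have "\<dots> = (D + 1)\<^sup>2 * I2 + (2 * (D + 1) * t * I1 + t\<^sup>2)"
    using int1 int2 by (simp add: I1_def I2_def prob_space)
  finally have "shadow_var n K \<psi> \<rho> Ob = (D + 1)\<^sup>2 * I2 + (2 * (D + 1) * t * I1 + t\<^sup>2) - ((D + 1) * I1 + t)\<^sup>2"
    by (simp only: shadow_var_def mean)
  \<comment> \<open>The shift by t drops out of the variance; the remaining squared mean is then
    discarded.\<close>
  also have "\<dots> = (D + 1)\<^sup>2 * I2 - ((D + 1) * I1)\<^sup>2"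
    by (simp add: power2_eq_square algebra_simps)
  also have "\<dots> \<le> (D + 1)\<^sup>2 * I2" by simp
  finally have var: "shadow_var n K \<psi> \<rho> Ob \<le> (D + 1)\<^sup>2 * I2" .
  have trB: "mtrace (2 ^ n) B = 0"
  proof -
    have "mtrace (2 ^ n) B = mtrace (2 ^ n) Ob - of_real t * 2 ^ n"
      by (simp add: mtrace_def B_eq ident_def sum_subtractf)
    then show ?thesis by (simp add: trO D_def)
  qed
  \<comment> \<open>As tr B = 0, three of the six contractions vanish; left are tr(B^2) and twice
    tr(B^2 rho).\<close>
  have "(\<Sum>i<(2 ^ n) ^ 3. \<Sum>j<(2 ^ n) ^ 3. test_mat n \<rho> B B i j * haar_moment (2 ^ n) 3 j i)
      = (\<tau> + \<tau>\<rho> + \<tau>\<rho>) / of_real ((D + 1) * (D + 2))"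
    unfolding test_mat_haar Let_def trB mtrace_rho by (simp add: \<tau>_def \<tau>\<rho>_def D_def)
  then have exact: "Re (\<Sum>i<(2 ^ n) ^ 3. \<Sum>j<(2 ^ n) ^ 3. test_mat n \<rho> B B i j * haar_moment (2 ^ n) 3 j i)
      = (Re \<tau> + 2 * Re \<tau>\<rho>) / ((D + 1) * (D + 2))"
    by (simp only: Re_divide_of_real plus_complex.sel) simp
  note \<tau> = trace_square_times_density[OF hermB dens, folded \<tau>_def \<tau>\<rho>_def]
  have "\<bar>(Re \<tau> + 2 * Re \<tau>\<rho>) / ((D + 1) * (D + 2)) - I2\<bar> \<le> c * c * \<epsilon>"
    unfolding I2_def exact[symmetric] by (intro outcome_mean_error hermB c)
  then have "I2 \<le> (Re \<tau> + 2 * Re \<tau>\<rho>) / ((D + 1) * (D + 2)) + c * c * \<epsilon>" by linarith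
  also have "\<dots> \<le> 3 * Re \<tau> / ((D + 1) * (D + 2)) + c * c * \<epsilon>"
    using \<tau>(1) D by (intro add_right_mono divide_right_mono) auto
  finally have "(D + 1)\<^sup>2 * I2 \<le> (D + 1)\<^sup>2 * (3 * Re \<tau> / ((D + 1) * (D + 2)) + c * c * \<epsilon>)"
    by (intro mult_left_mono) auto
  also have "\<dots> = 3 * Re \<tau> * ((D + 1) / (D + 2)) + \<epsilon> * c\<^sup>2 * (D + 1)\<^sup>2"
  proof -
    have "p\<^sup>2 * (3 * a / (p * q)) = 3 * a * (p / q)" if "p \<noteq> 0" for p q a :: real
      using that by (simp add: power2_eq_square)
    from this[of "D + 1" "Re \<tau>" "D + 2"] show ?thesis
      using D unfolding distrib_left by (simp add: power2_eq_square mult_ac)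
  qed
  \<comment> \<open>The ratio (D + 1) / (D + 2) is rounded up to 1. The epsilon term carries
    coefficient 1 up to this point and is relaxed to the stated 3, which is legitimate because
    epsilon is nonnegative.\<close>
  also have "\<dots> \<le> 3 * Re \<tau> * 1 + 3 * (\<epsilon> * c\<^sup>2 * (D + 1)\<^sup>2)"
  proof (intro add_mono mult_left_mono)
    show "(D + 1) / (D + 2) \<le> 1" using D by simp
    have "0 \<le> \<epsilon> * c\<^sup>2 * (D + 1)\<^sup>2" using eps_nonneg by simp
    then show "\<epsilon> * c\<^sup>2 * (D + 1)\<^sup>2 \<le> 3 * (\<epsilon> * c\<^sup>2 * (D + 1)\<^sup>2)" by linarith
  qed (use \<tau>(2) in auto)
  finally show ?thesis using var by (simp add: \<tau>_def B_def c_def D_def)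
qed

end

theorem theorem5:
  fixes n :: nat and K :: "'k measure" and \<psi> :: "'k \<Rightarrow> cvec"
    and \<epsilon> :: real and \<rho> Ob :: cmat
  assumes "prob_space K"
    and "\<forall>k\<in>space K. vnorm (2^n) (\<psi> k) = 1"
    and "\<forall>j. (\<lambda>k. \<psi> k j) \<in> borel_measurable K"
    and "approx_state_design n K \<psi> 3 \<epsilon>"
    and "density_op (2^n) \<rho>"
    and "psd (2^n) Ob"
  shows "(\<bar>shadow_mean n K \<psi> \<rho> Ob - Re (mtrace (2^n) (mmul (2^n) Ob \<rho>))\<bar>
           \<le> (2^n + 1) * \<epsilon> * op_norm (2^n) Ob)
         \<and> (shadow_var n K \<psi> \<rho> Ob
           \<le> 3 * Re (mtrace (2^n) (mmul (2^n) (traceless n Ob) (traceless n Ob)))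
              + 3 * \<epsilon> * (op_norm (2^n) Ob)\<^sup>2 * (2^n + 1)\<^sup>2)"
proof -
  interpret prob_space K by (rule assms(1))
  interpret design_shadow K n \<psi> \<epsilon> \<rho>
    using assms(2-5) by unfold_locales (auto simp: vnorm_eq_sqrt)
  show ?thesis using shadow_mean_error[OF assms(6)] shadow_var_bound[OF assms(6)] by blast
qed

end
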